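(* Let $K'$ be a field of characteristic $0$ with henselian valuation ring $A'$ and residue field of characteristic $p>2$. Let $L'|K'$ be a non-trivial Galois extension of degree $p$ with valuation ring $B'$. Let $\zeta$ be a primitive $p$-th root of unity, $K=K'(\zeta)$, $L=L'(\zeta)$ with valuation rings $A,B$, $\sigma$ a generator of $\mathrm{Gal}(L|K)$, $\Lambda=\mathrm{Gal}(L|L')$. Then $\mathcal{H}'=\mathcal{N}'$.
   Context: Put $\mathfrak{z}=\zeta-1$ and let $\mathfrak{A}$ be the set of $h\in K$ such that the solutions of $X^p=h$ generate $L$ over $K$; $\mathcal{H}$ is the ideal of $A$ generated by $\{\mathfrak{z}^p/(h-1):h\in\mathfrak{A}\}$, and $\mathcal{H}'=\mathcal{H}^\Lambda$ (invariants under $\Lambda\cong\mathrm{Gal}(K|K')$), an ideal of $A'$. $\mathcal{J}'$ is the ideal of $B'$ generated by $\{\sigma(b)/b-1:b\in L'^\times\}$ and $\mathcal{N}'$ the ideal of $A'$ generated by $N_{L'|K'}(\mathcal{J}')$. *)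

theory Defs
  imports "HOL-Computational_Algebra.Polynomial"
begin

text \<open>All fields are subfields of an ambient field of type 'a (characteristic 0).\<close>

definition subring :: "'a::field set \<Rightarrow> bool" where
  "subring R \<longleftrightarrow> 0 \<in> R \<and> 1 \<in> R \<and> (\<forall>x\<in>R. \<forall>y\<in>R. x + y \<in> R \<and> x - y \<in> R \<and> x * y \<in> R)"

definition subfield :: "'a::field set \<Rightarrow> bool" where
  "subfield F \<longleftrightarrow> subring F \<and> (\<forall>x\<in>F. inverse x \<in> F)"

definition gen_field :: "'a::field set \<Rightarrow> 'a set" where
  "gen_field S = \<Inter>{F. subfield F \<and> S \<subseteq> F}"

definition valuation_ring :: "'a::field set \<Rightarrow> 'a set \<Rightarrow> bool" where
  "valuation_ring F V \<longleftrightarrow> subfield F \<and> subring V \<and> V \<subseteq> F \<and>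
     (\<forall>x\<in>F. x \<noteq> 0 \<longrightarrow> x \<in> V \<or> inverse x \<in> V)"

definition max_ideal :: "'a::field set \<Rightarrow> 'a set" where
  "max_ideal V = {x\<in>V. x = 0 \<or> inverse x \<notin> V}"

definition henselian :: "'a::field set \<Rightarrow> 'a set \<Rightarrow> bool" where
  "henselian F V \<longleftrightarrow> valuation_ring F V \<and>
     (\<forall>f a. (\<forall>i. coeff f i \<in> V) \<longrightarrow> lead_coeff f = 1 \<longrightarrow> a \<in> V \<longrightarrow>
        poly f a \<in> max_ideal V \<longrightarrow> poly (pderiv f) a \<notin> max_ideal V \<longrightarrow>
        (\<exists>b\<in>V. poly f b = 0 \<and> b - a \<in> max_ideal V))"

definition ext_degree_is :: "'a::field set \<Rightarrow> 'a set \<Rightarrow> nat \<Rightarrow> bool" where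
  "ext_degree_is K L (n::nat) \<longleftrightarrow> (\<exists>b. (\<forall>i<n. b i \<in> L) \<and>
      L = {x. \<exists>c. (\<forall>i<n. c i \<in> K) \<and> x = (\<Sum>i<n. c i * b i)} \<and>
      (\<forall>c. (\<forall>i<n. c i \<in> K) \<longrightarrow> (\<Sum>i<n. c i * b i) = 0 \<longrightarrow> (\<forall>i<n. c i = 0)))"

definition Gal :: "'a::field set \<Rightarrow> 'a set \<Rightarrow> ('a \<Rightarrow> 'a) set" where
  "Gal K L = {f. bij_betw f L L \<and> (\<forall>x\<in>L. \<forall>y\<in>L. f (x + y) = f x + f y \<and> f (x * y) = f x * f y)
      \<and> f 1 = 1 \<and> (\<forall>x\<in>K. f x = x) \<and> (\<forall>x. x \<notin> L \<longrightarrow> f x = x)}"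

definition galois_of_degree :: "'a::field set \<Rightarrow> 'a set \<Rightarrow> nat \<Rightarrow> bool" where
  "galois_of_degree K L n \<longleftrightarrow> subfield K \<and> subfield L \<and> K \<subseteq> L \<and>
     ext_degree_is K L n \<and> finite (Gal K L) \<and> card (Gal K L) = n"

definition field_norm :: "'a::field set \<Rightarrow> 'a set \<Rightarrow> 'a \<Rightarrow> 'a" where
  "field_norm K L x = (\<Prod>\<tau>\<in>Gal K L. \<tau> x)"

definition gen_ideal :: "'a::field set \<Rightarrow> 'a set \<Rightarrow> 'a set" where
  "gen_ideal R S = {x. \<exists>(n::nat) c s. (\<forall>i<n. c i \<in> R \<and> s i \<in> S) \<and> x = (\<Sum>i<n. c i * s i)}"

end

theory Submission
  imports Defs "HOL-Algebra.Coset"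
begin

text \<open>
  Every ideal in question is generated by elements of \<open>L\<close>, so the claim compares the values
  \<open>v(z^p / (h - 1))\<close> for \<open>h \<in> \<AA>\<close> with the values \<open>p v(\<sigma> b / b - 1)\<close> for \<open>b \<in> L'\<close>,
  where \<open>v\<close> is the unique extension of the henselian valuation to \<open>L\<close> and \<open>z = \<zeta> - 1\<close>.

  Given \<open>h = a^p\<close>, invariance of \<open>v\<close> under \<open>\<sigma>\<close> yields \<open>v(h - 1) = p v(a - 1)\<close>. If \<open>v(a - 1) > 0\<close>,
  the trace of \<open>(a - 1) / z\<close> to \<open>L'\<close> is the required \<open>b\<close>; otherwise any \<open>b\<close> with
  \<open>v(\<sigma> b / b - 1) \<le> v(z)\<close> will do, and one exists because \<open>\<sigma>^p = 1\<close>.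

  Conversely, let \<open>b = f(a)\<close> with \<open>a\<close> a Kummer generator, \<open>h = a^p\<close>, and \<open>f\<close> of degree less than \<open>p\<close>.
  Suppose that no element of \<open>K\<close> lies in the ball around \<open>a\<close> of radius \<open>v(z a / u)\<close>, where
  \<open>u = \<sigma> b / b - 1\<close>. Then no polynomial over \<open>K\<close> of degree less than \<open>p\<close> has a zero in this ball: if \<open>g\<close> is one of
  minimal degree, with \<open>D\<close> zeros there, repeated division by \<open>g\<close> shows that the number of zeros of
  \<open>X^p - h\<close> in the ball is \<open>j D\<close> for some \<open>j\<close> with \<open>j deg g \<le> p\<close>; but all \<open>p\<close> zeros are in the ball, so
  \<open>D = 1\<close> and \<open>g\<close> is linear. Thus \<open>f\<close> is nearly constant on the ball, which contains
  \<open>\<sigma> a\<close>, contradicting \<open>\<sigma> b - b = u b\<close>. Hence some \<open>c \<in> K\<close> is in the ball, and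
  \<open>(a / c)^p\<close> is the required element of \<open>\<AA>\<close>.
\<close>

section \<open>Subfields, polynomials over them, and homomorphisms\<close>

text \<open>The value group is arbitrary and \<open>L\<close> may have defect over \<open>K\<close>:
  there need be no uniformizer, and no element of \<open>K\<close> closest to a Kummer generator.
  Values are therefore compared by divisibility, and \<open>kummer_approx\<close> and
  \<open>ex_sigma_diff_ge\<close> argue by contradiction instead of choosing an optimal element.
  Zeros in a ball may lie outside every field at hand, so they are counted by an index read off from
  coefficients. The exponent \<open>p\<close> on both sides has a similar source: a norm is a
  product of \<open>p\<close> conjugates of equal value, and \<open>h - 1\<close> is the product of
  the \<open>p\<close> factors \<open>a - \<omega> ^ k\<close>. Hensel's lemma enters only through
  \<open>conj_le\<close>, from which the equality of the values of conjugates and the uniqueness of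
  the extended valuation follow. Descending from \<open>L\<close> to \<open>L'\<close> is harmless
  because \<open>Gal L' L\<close> commutes with \<open>\<sigma>\<close> and its order is a unit
  modulo the maximal ideal.\<close>

lemma subfield_subring: "subfield F \<Longrightarrow> subring F"
  by (simp add: subfield_def)

lemma subring_0: "subring R \<Longrightarrow> 0 \<in> R"
  and subring_1: "subring R \<Longrightarrow> 1 \<in> R"
  and subring_add: "subring R \<Longrightarrow> x \<in> R \<Longrightarrow> y \<in> R \<Longrightarrow> x + y \<in> R"
  and subring_diff: "subring R \<Longrightarrow> x \<in> R \<Longrightarrow> y \<in> R \<Longrightarrow> x - y \<in> R"
  and subring_mult: "subring R \<Longrightarrow> x \<in> R \<Longrightarrow> y \<in> R \<Longrightarrow> x * y \<in> R"
  by (simp_all add: subring_def)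

lemma subring_uminus: "subring R \<Longrightarrow> x \<in> R \<Longrightarrow> - x \<in> R"
  using subring_diff[of R 0 x] by (simp add: subring_0)

lemma subring_sum: "subring R \<Longrightarrow> (\<And>i. i \<in> I \<Longrightarrow> f i \<in> R) \<Longrightarrow> sum f I \<in> R"
  by (induction I rule: infinite_finite_induct) (auto simp: subring_0 subring_add)

lemma subring_prod: "subring R \<Longrightarrow> (\<And>i. i \<in> I \<Longrightarrow> f i \<in> R) \<Longrightarrow> prod f I \<in> R"
  by (induction I rule: infinite_finite_induct) (auto simp: subring_1 subring_mult)

lemma subring_power: "subring R \<Longrightarrow> x \<in> R \<Longrightarrow> x ^ n \<in> R"
  by (induction n) (auto simp: subring_1 subring_mult)

lemma subring_of_nat: "subring R \<Longrightarrow> of_nat n \<in> R"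
  by (induction n) (auto simp: subring_0 subring_1 subring_add)

lemma subfield_inverse: "subfield F \<Longrightarrow> x \<in> F \<Longrightarrow> inverse x \<in> F"
  by (simp add: subfield_def)

lemma subfield_divide: "subfield F \<Longrightarrow> x \<in> F \<Longrightarrow> y \<in> F \<Longrightarrow> x / y \<in> F"
  by (simp add: divide_inverse subfield_inverse subring_mult subfield_subring)

lemmas subring_closed = subring_0 subring_1 subring_add subring_diff subring_mult
  subring_uminus subring_sum subring_prod subring_power subring_of_nat
lemmas subfield_closed = subring_closed[OF subfield_subring] subfield_inverse subfield_divide

text \<open>Gaussian elimination on the last coordinate: a pivot vector clears it in all the others,
  which are then combinations of one generator fewer.\<close>

lemma lin_dep:
  fixes K :: "'a::field set" and v b :: "_ \<Rightarrow> 'a"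
  assumes K: "subfield K"
    and "finite I" "m < card I"
    and "\<And>i. i \<in> I \<Longrightarrow> \<exists>c. (\<forall>j<m. c j \<in> K) \<and> v i = (\<Sum>j<(m::nat). c j * b j)"
  shows "\<exists>c. (\<forall>i\<in>I. c i \<in> K) \<and> (\<exists>i\<in>I. c i \<noteq> 0) \<and> (\<Sum>i\<in>I. c i * v i) = 0"
  using assms(2-)
proof (induction m arbitrary: I v)
  case 0
  then have "\<And>i. i \<in> I \<Longrightarrow> v i = 0" by auto
  then show ?case using 0 K
    by (intro exI[of _ "\<lambda>_. 1"]) (auto simp: subfield_closed card_gt_0_iff)
next
  case (Suc m)
  from Suc.prems(3) obtain c where c: "\<And>i j. i \<in> I \<Longrightarrow> j < Suc m \<Longrightarrow> c i j \<in> K"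
      "\<And>i. i \<in> I \<Longrightarrow> v i = (\<Sum>j<Suc m. c i j * b j)"
    by metis
  show ?case
  proof (cases "\<forall>i\<in>I. c i m = 0")
    case True
    have "\<And>i. i \<in> I \<Longrightarrow> \<exists>c. (\<forall>j<m. c j \<in> K) \<and> v i = (\<Sum>j<m. c j * b j)"
      using c True by (auto intro!: exI[of _ "c _"])
    then show ?thesis using Suc.IH[of I v] Suc.prems(1,2) by auto
  next
    case False
    then obtain k where k: "k \<in> I" "c k m \<noteq> 0" by blast
    define r where "r i = c i m / c k m" for i
    have rK: "r i \<in> K" if "i \<in> I" for i
      using that k c K by (auto simp: r_def subfield_closed)
    define w where "w i = v i - r i * v k" for i
    have "\<exists>c. (\<forall>j<m. c j \<in> K) \<and> w i = (\<Sum>j<m. c j * b j)" if "i \<in> I - {k}" for i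
    proof (intro exI[of _ "\<lambda>j. c i j - r i * c k j"] conjI allI impI)
      fix j assume "j < m"
      then show "c i j - r i * c k j \<in> K"
        using that k c rK K by (auto simp: subfield_closed)
    next
      have "w i = (\<Sum>j<Suc m. (c i j - r i * c k j) * b j)"
        using that k by (simp only: w_def c DiffD1 left_diff_distrib sum_subtractf sum_distrib_left mult.assoc)
      then show "w i = (\<Sum>j<m. (c i j - r i * c k j) * b j)"
        using k by (simp add: r_def)
    qed
    moreover have "m < card (I - {k})" using Suc.prems k by simp
    ultimately obtain d where d: "\<forall>i\<in>I - {k}. d i \<in> K" "\<exists>i\<in>I - {k}. d i \<noteq> 0"
        "(\<Sum>i\<in>I - {k}. d i * w i) = 0"
      using Suc.IH[of "I - {k}" w] Suc.prems(1) by auto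
    \<comment> \<open>The coefficient of the pivot collects the multiples of \<open>v k\<close> that
      were subtracted in \<open>w\<close>.\<close>
    define e where "e i = (if i = k then - (\<Sum>i\<in>I - {k}. d i * r i) else d i)" for i
    have "(\<Sum>i\<in>I. e i * v i) = e k * v k + (\<Sum>i\<in>I - {k}. d i * v i)"
      using k Suc.prems(1) by (simp add: sum.remove[of I k] e_def)
    also have "\<dots> = (\<Sum>i\<in>I - {k}. d i * w i)"
      by (simp add: e_def w_def right_diff_distrib sum_subtractf sum_distrib_right mult.assoc)
    finally have "(\<Sum>i\<in>I. e i * v i) = 0" using d by simp
    moreover have "\<forall>i\<in>I. e i \<in> K"
      using d rK K by (auto simp: e_def intro!: subfield_closed)
    moreover have "\<exists>i\<in>I. e i \<noteq> 0" using d by (auto simp: e_def)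
    ultimately show ?thesis by blast
  qed
qed

section \<open>Polynomials with coefficients in a subset of the ambient field\<close>

definition poly_over :: "'a::field set \<Rightarrow> 'a poly set" where
  "poly_over R = {f. \<forall>i. coeff f i \<in> R}"

lemma poly_over_closed:
  assumes "subring R"
  shows "0 \<in> poly_over R" "1 \<in> poly_over R"
    "f \<in> poly_over R \<Longrightarrow> g \<in> poly_over R \<Longrightarrow> f + g \<in> poly_over R"
    "f \<in> poly_over R \<Longrightarrow> g \<in> poly_over R \<Longrightarrow> f - g \<in> poly_over R"
    "f \<in> poly_over R \<Longrightarrow> g \<in> poly_over R \<Longrightarrow> f * g \<in> poly_over R"
    "c \<in> R \<Longrightarrow> monom c n \<in> poly_over R"
    "c \<in> R \<Longrightarrow> f \<in> poly_over R \<Longrightarrow> pCons c f \<in> poly_over R"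
    "c \<in> R \<Longrightarrow> f \<in> poly_over R \<Longrightarrow> smult c f \<in> poly_over R"
  using assms unfolding poly_over_def
  by (auto simp: coeff_mult coeff_pCons coeff_monom subring_closed intro!: subring_sum split: nat.split)

lemma poly_over_prod:
  "subring R \<Longrightarrow> (\<And>i. i \<in> I \<Longrightarrow> f i \<in> poly_over R) \<Longrightarrow> prod f I \<in> poly_over R"
  by (induction I rule: infinite_finite_induct) (auto simp: poly_over_closed)

lemma poly_over_mono: "R \<subseteq> S \<Longrightarrow> f \<in> poly_over R \<Longrightarrow> f \<in> poly_over S"
  by (auto simp: poly_over_def)

lemma poly_over_poly: "subring R \<Longrightarrow> f \<in> poly_over R \<Longrightarrow> x \<in> R \<Longrightarrow> poly f x \<in> R"
  by (auto simp: poly_altdef poly_over_def intro!: subring_closed)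

lemma poly_over_tail:
  "pCons c f \<in> poly_over R \<Longrightarrow> c \<in> R \<and> f \<in> poly_over R"
  unfolding poly_over_def mem_Collect_eq by (metis coeff_pCons_0 coeff_pCons_Suc)

lemma poly_over_pcompose:
  "subring R \<Longrightarrow> f \<in> poly_over R \<Longrightarrow> g \<in> poly_over R \<Longrightarrow> pcompose f g \<in> poly_over R"
proof (induction f)
  case (pCons c f)
  then have "c \<in> R" "f \<in> poly_over R"
    using poly_over_tail by auto
  then show ?case using pCons by (auto simp: pcompose_pCons poly_over_closed)
qed (simp add: poly_over_closed)

lemma poly_over_sum_monom:
  assumes "subring R" "\<And>i. i < n \<Longrightarrow> c i \<in> R"
  shows "(\<Sum>i<n. monom (c i) i) \<in> poly_over R"
  using assms by (auto simp: poly_over_def coeff_sum coeff_monom intro!: subring_closed)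

lemma coeff_sum_monom: "coeff (\<Sum>i<n. monom (c i) i) k = (if k < n then c k else 0)"
  by (simp add: coeff_sum coeff_monom)

lemma degree_sum_monom: "0 < n \<Longrightarrow> degree (\<Sum>i<n. monom (c i) i) < n"
  by (rule degree_lessI) (auto simp: coeff_sum_monom)

lemma poly_sum_degree_less:
  fixes f :: "'a::comm_semiring_1 poly"
  assumes "degree f < n"
  shows "poly f x = (\<Sum>i<n. coeff f i * x ^ i)"
proof -
  have "(\<Sum>i<n. coeff f i * x ^ i) = (\<Sum>i\<le>degree f. coeff f i * x ^ i)"
    using assms by (intro sum.mono_neutral_right) (auto simp: coeff_eq_0)
  then show ?thesis by (simp add: poly_altdef)
qed

text \<open>Long division uses only field operations on the coefficients, so quotient and remainder
  stay over \<open>F\<close>.\<close>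

lemma poly_over_division:
  assumes F: "subfield F" and f: "f \<in> poly_over F" and g: "g \<in> poly_over F" "g \<noteq> 0"
  shows "\<exists>q\<in>poly_over F. \<exists>r\<in>poly_over F. f = q * g + r \<and> (r = 0 \<or> degree r < degree g)"
  using f
proof (induction "degree f" arbitrary: f rule: less_induct)
  case less
  note R = subfield_subring[OF F]
  show ?case
  proof (cases "f = 0 \<or> degree f < degree g")
    case True
    then show ?thesis using less.prems R
      by (intro bexI[of _ 0] bexI[of _ f]) (auto simp: poly_over_closed)
  next
    case False
    define c where "c = monom (lead_coeff f / lead_coeff g) (degree f - degree g)"
    have c: "c \<in> poly_over F" unfolding c_def using less.prems g F
      by (intro poly_over_closed R subfield_closed) (auto simp: poly_over_def)
    define f' where "f' = f - c * g"
    have f': "f' \<in> poly_over F" using c g less.prems R by (simp add: f'_def poly_over_closed)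
    have c0: "c \<noteq> 0" using False g by (simp add: c_def)
    have dc: "degree (c * g) = degree f"
      using False g c0 by (simp add: degree_mult_eq c_def degree_monom_eq)
    have lc: "lead_coeff (c * g) = lead_coeff f"
      using False g by (simp add: lead_coeff_mult c_def degree_monom_eq del: coeff_mult_degree_sum)
    show ?thesis
    \<comment> \<open>In degree 0, cancelling the leading term leaves 0 and cannot lower the degree,
      so the induction hypothesis does not apply.\<close>
    proof (cases "degree f = 0")
      case True
      then have "degree g = 0" using False by simp
      with True have "f' = 0" using dc lc unfolding f'_def
        by (metis degree_0_id eq_iff_diff_eq_0)
      then show ?thesis using c R by (intro bexI[of _ c] bexI[of _ 0]) (auto simp: poly_over_closed f'_def)
    next
      case nz: False
      have "degree f' < degree f"
      proof (rule degree_lessI)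
        show "f' \<noteq> 0 \<or> 0 < degree f" using nz by simp
        show "\<forall>k\<ge>degree f. coeff f' k = 0"
        proof (intro allI impI)
          fix k assume "k \<ge> degree f"
          then consider "k = degree f" | "k > degree f" by linarith
          then show "coeff f' k = 0"
          proof cases
            case 1 then show ?thesis using dc lc unfolding f'_def by (metis coeff_diff eq_iff_diff_eq_0)
          next
            case 2 then show ?thesis using dc by (simp add: f'_def coeff_eq_0)
          qed
        qed
      qed
      from less.hyps[OF this f'] obtain q r where qr: "q \<in> poly_over F" "r \<in> poly_over F"
        "f' = q * g + r" "r = 0 \<or> degree r < degree g" by blast
      then show ?thesis using c R
        by (intro bexI[of _ "q + c"] bexI[of _ r]) (auto simp: poly_over_closed f'_def algebra_simps)
    qed
  qed
qed

text \<open>The difference of two monic polynomials of degree \<open>n\<close> has degree less than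
  \<open>n\<close>, so agreement at \<open>n\<close> points is enough.\<close>

lemma poly_eq_prod_roots:
  fixes f :: "'a::field poly"
  assumes "finite S" "card S = degree f" "lead_coeff f = 1" "\<And>x. x \<in> S \<Longrightarrow> poly f x = 0"
  shows "f = (\<Prod>s\<in>S. [:- s, 1:])"
proof (rule poly_eqI_degree_lead_coeff[of _ "card S" _ S])
  have *: "degree (\<Prod>s\<in>S. [:- s, 1:]) = card S"
    by (subst degree_prod_sum_eq) auto
  show "degree (\<Prod>s\<in>S. [:- s, 1:]) \<le> card S" using * by simp
  have "lead_coeff (\<Prod>s\<in>S. [:- s, 1:]) = 1" by (simp add: lead_coeff_prod)
  then show "coeff f (card S) = coeff (\<Prod>s\<in>S. [:- s, 1:]) (card S)"
    using * assms by simp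
qed (use assms in \<open>auto simp: poly_prod\<close>)

section \<open>Homomorphisms defined on a subfield\<close>

definition hom_on :: "'a::field set \<Rightarrow> ('a \<Rightarrow> 'a) \<Rightarrow> bool" where
  "hom_on F \<phi> \<longleftrightarrow> \<phi> 1 = 1 \<and> (\<forall>x\<in>F. \<forall>y\<in>F. \<phi> (x + y) = \<phi> x + \<phi> y \<and> \<phi> (x * y) = \<phi> x * \<phi> y)"

context
  fixes F :: "'a::field set" and \<phi> :: "'a \<Rightarrow> 'a"
  assumes F: "subfield F" and h: "hom_on F \<phi>"
begin

lemma hom_add: "x \<in> F \<Longrightarrow> y \<in> F \<Longrightarrow> \<phi> (x + y) = \<phi> x + \<phi> y"
  and hom_mult: "x \<in> F \<Longrightarrow> y \<in> F \<Longrightarrow> \<phi> (x * y) = \<phi> x * \<phi> y"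
  and hom_1: "\<phi> 1 = 1"
  using h by (auto simp: hom_on_def)

lemma hom_0: "\<phi> 0 = 0"
proof -
  have "\<phi> (0 + 0) = \<phi> 0 + \<phi> 0" using F by (intro hom_add) (auto simp: subfield_closed)
  then show ?thesis by (metis add.right_neutral add_left_cancel)
qed

lemma hom_diff: "x \<in> F \<Longrightarrow> y \<in> F \<Longrightarrow> \<phi> (x - y) = \<phi> x - \<phi> y"
  using hom_add[of "x - y" y] F by (simp add: subfield_closed)

lemma hom_uminus: "x \<in> F \<Longrightarrow> \<phi> (- x) = - \<phi> x"
  using hom_diff[of 0 x] F by (simp add: subfield_closed hom_0)

lemma hom_inverse: "x \<in> F \<Longrightarrow> \<phi> (inverse x) = inverse (\<phi> x)"
proof (cases "x = 0")
  case False
  assume x: "x \<in> F"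
  have "\<phi> x * \<phi> (inverse x) = 1"
    using hom_mult[of x "inverse x"] x F False by (simp add: subfield_closed hom_1)
  then show ?thesis by (simp add: inverse_unique)
qed (simp add: hom_0)

lemma hom_divide: "x \<in> F \<Longrightarrow> y \<in> F \<Longrightarrow> \<phi> (x / y) = \<phi> x / \<phi> y"
  using F by (simp add: divide_inverse hom_mult hom_inverse subfield_closed)

lemma hom_power: "x \<in> F \<Longrightarrow> \<phi> (x ^ n) = \<phi> x ^ n"
  by (induction n) (auto simp: hom_1 hom_mult subfield_closed F)

lemma hom_sum: "(\<And>i. i \<in> I \<Longrightarrow> f i \<in> F) \<Longrightarrow> \<phi> (sum f I) = (\<Sum>i\<in>I. \<phi> (f i))"
  by (induction I rule: infinite_finite_induct) (auto simp: hom_0 hom_add subfield_closed F)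

lemma hom_prod: "(\<And>i. i \<in> I \<Longrightarrow> f i \<in> F) \<Longrightarrow> \<phi> (prod f I) = (\<Prod>i\<in>I. \<phi> (f i))"
  by (induction I rule: infinite_finite_induct) (auto simp: hom_1 hom_mult subfield_closed F)

lemma hom_eq_0_iff: "x \<in> F \<Longrightarrow> \<phi> x = 0 \<longleftrightarrow> x = 0"
  using hom_mult[of x "inverse x"] F subfield_inverse[OF F, of x]
  by (metis hom_0 hom_1 mult_zero_left right_inverse zero_neq_one)

lemma hom_inj: "inj_on \<phi> F"
  by (rule inj_onI) (metis F eq_iff_diff_eq_0 hom_diff hom_eq_0_iff subring_diff subfield_subring)

lemma coeff_map_hom: "coeff (map_poly \<phi> f) i = \<phi> (coeff f i)"
  by (simp add: coeff_map_poly hom_0)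

lemma map_hom_mult:
  assumes "f \<in> poly_over F" "g \<in> poly_over F"
  shows "map_poly \<phi> (f * g) = map_poly \<phi> f * map_poly \<phi> g"
proof (rule poly_eqI)
  fix n
  have "\<phi> (\<Sum>i\<le>n. coeff f i * coeff g (n - i)) = (\<Sum>i\<le>n. \<phi> (coeff f i) * \<phi> (coeff g (n - i)))"
    using assms F by (subst hom_sum) (auto simp: poly_over_def hom_mult subfield_closed)
  then show "coeff (map_poly \<phi> (f * g)) n = coeff (map_poly \<phi> f * map_poly \<phi> g) n"
    by (simp add: coeff_map_hom coeff_mult)
qed

lemma map_hom_add:
  assumes "f \<in> poly_over F" "g \<in> poly_over F"
  shows "map_poly \<phi> (f + g) = map_poly \<phi> f + map_poly \<phi> g"
  using assms by (intro poly_eqI) (auto simp: coeff_map_hom hom_add poly_over_def)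

lemma map_hom_prod:
  "(\<And>i. i \<in> I \<Longrightarrow> f i \<in> poly_over F) \<Longrightarrow> map_poly \<phi> (prod f I) = (\<Prod>i\<in>I. map_poly \<phi> (f i))"
  by (induction I rule: infinite_finite_induct)
    (auto simp: map_hom_mult poly_over_prod subfield_subring F hom_1)

lemma hom_poly:
  assumes "f \<in> poly_over F" "x \<in> F"
  shows "\<phi> (poly f x) = poly (map_poly \<phi> f) (\<phi> x)"
  using assms(1)
proof (induction f)
  case (pCons c f)
  then have "c \<in> F" "f \<in> poly_over F" using poly_over_tail by auto
  moreover have "map_poly \<phi> (pCons c f) = pCons (\<phi> c) (map_poly \<phi> f)"
    by (intro poly_eqI) (simp add: coeff_map_hom coeff_pCons split: nat.split)
  ultimately show ?case using pCons assms F
    by (simp add: hom_add hom_mult subfield_closed poly_over_poly subfield_subring)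
qed (simp add: hom_0)

text \<open>The product depends only on the family of its roots, which \<open>\<phi>\<close>
  permutes. Applied to Galois orbits, this puts coefficients into fixed fields.\<close>

lemma hom_fix_coeff_prod:
  assumes "\<And>i. i \<in> I \<Longrightarrow> e i \<in> F" "bij_betw \<pi> I I" "\<And>i. i \<in> I \<Longrightarrow> \<phi> (e i) = e (\<pi> i)"
  shows "\<phi> (coeff (\<Prod>i\<in>I. [:- e i, 1:]) n) = coeff (\<Prod>i\<in>I. [:- e i, 1:]) n"
proof -
  have "map_poly \<phi> (\<Prod>i\<in>I. [:- e i, 1:]) = (\<Prod>i\<in>I. map_poly \<phi> [:- e i, 1:])"
    using assms F by (intro map_hom_prod) (auto simp: poly_over_closed subfield_closed subfield_subring)
  also have "\<dots> = (\<Prod>i\<in>I. [:- e (\<pi> i), 1:])"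
    using assms by (intro prod.cong refl) (auto simp: map_poly_pCons hom_0 hom_1 hom_uminus)
  also have "\<dots> = (\<Prod>i\<in>I. [:- e i, 1:])"
    by (rule prod.reindex_bij_betw[OF assms(2)])
  finally show ?thesis by (metis coeff_map_hom)
qed

end

section \<open>Simple extensions and Galois groups of prime degree\<close>

lemma gen_field_superset: "S \<subseteq> gen_field S"
  by (auto simp: gen_field_def)

lemma gen_field_least: "subfield F \<Longrightarrow> S \<subseteq> F \<Longrightarrow> gen_field S \<subseteq> F"
  by (auto simp: gen_field_def)

lemma subfield_gen_field: "subfield (gen_field S)"
  unfolding gen_field_def subfield_def subring_def by blast

text \<open>Once powers of the variable are divided out, the relation
  \<open>c + x * poly g x = 0\<close> has \<open>c \<noteq> 0\<close>, and
  \<open>- poly g x / c\<close> is the inverse.\<close>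

lemma inverse_mem_subring:
  assumes "subfield F" "subring R" "F \<subseteq> R" "x \<in> R" "x \<noteq> 0"
    "g \<in> poly_over F" "g \<noteq> 0" "poly g x = 0"
  shows "inverse x \<in> R"
  using assms(6-)
proof (induction g)
  case (pCons c g)
  have cg: "c \<in> F" "g \<in> poly_over F" using pCons.prems poly_over_tail by auto
  show ?case
  proof (cases "c = 0")
    case True
    then show ?thesis using pCons cg assms by auto
  next
    case False
    have "x * (- poly g x * inverse c) = 1"
      using pCons.prems(3) False by (simp add: field_simps neg_eq_iff_add_eq_0 add.commute)
    then have "inverse x = - poly g x * inverse c" by (rule inverse_unique)
    moreover have "inverse c \<in> R" "poly g x \<in> R"
      using cg assms subfield_inverse poly_over_mono[of F R] by (auto intro!: poly_over_poly)
    ultimately show ?thesis using assms(2) by (simp add: subring_closed)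
  qed
qed simp

lemma poly_reduce:
  assumes F: "subfield F" and g: "g \<in> poly_over F" "degree g = n" "n > 0" "poly g \<alpha> = 0"
    and f: "f \<in> poly_over F"
  shows "\<exists>r\<in>poly_over F. degree r < n \<and> poly f \<alpha> = poly r \<alpha>"
proof -
  have "g \<noteq> 0" using g by auto
  then obtain q r where qr: "q \<in> poly_over F" "r \<in> poly_over F"
    "f = q * g + r" "r = 0 \<or> degree r < degree g"
    using poly_over_division[OF F f] g by blast
  then show ?thesis using g by (intro bexI[of _ r]) auto
qed

text \<open>The ring of all \<open>poly f \<alpha>\<close> is spanned over \<open>F\<close> by
  \<open>n\<close> powers of \<open>\<alpha>\<close>, so \<open>n + 1\<close> powers of any element
  are dependent and nonzero elements are invertible in it. This argument covers a reducible
  \<open>g\<close>, as the cyclotomic polynomial over \<open>K'\<close> may be.\<close>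

lemma gen_field_simple:
  assumes F: "subfield F" and g: "g \<in> poly_over F" "degree g = n" "n > 0" "poly g \<alpha> = 0"
  shows "gen_field (F \<union> {\<alpha>}) = {poly f \<alpha> | f. f \<in> poly_over F \<and> degree f < n}"
proof -
  define R where "R = {poly f \<alpha> | f. f \<in> poly_over F}"
  note sF = subfield_subring[OF F]
  note red = poly_reduce[OF F g]
  have R: "R = {poly f \<alpha> | f. f \<in> poly_over F \<and> degree f < n}"
    unfolding R_def using red by blast
  have memR: "poly f \<alpha> \<in> R" if "f \<in> poly_over F" for f using that by (auto simp: R_def)
  have sub: "subring R"
    unfolding subring_def
  proof (intro conjI ballI)
    show "0 \<in> R" using memR[of 0] sF by (simp add: poly_over_closed)
    show "1 \<in> R" using memR[of 1] sF by (simp add: poly_over_closed)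
    fix x y assume "x \<in> R" "y \<in> R"
    then obtain f h where "f \<in> poly_over F" "x = poly f \<alpha>" "h \<in> poly_over F" "y = poly h \<alpha>"
      by (auto simp: R_def)
    then show "x + y \<in> R" "x - y \<in> R" "x * y \<in> R"
      using memR[of "f + h"] memR[of "f - h"] memR[of "f * h"] sF by (auto simp: poly_over_closed)
  qed
  have FR: "F \<subseteq> R"
  proof
    fix x assume "x \<in> F"
    then show "x \<in> R" using memR[of "[:x:]"] sF by (simp add: poly_over_closed)
  qed
  have aR: "\<alpha> \<in> R" using memR[of "[:0, 1:]"] sF by (simp add: poly_over_closed subring_closed)
  have "inverse x \<in> R" if x: "x \<in> R" for x
  proof (cases "x = 0")
    case True then show ?thesis using x by simp
  next
    case False
    have "\<exists>c. (\<forall>j<n. c j \<in> F) \<and> x ^ i = (\<Sum>j<n. c j * \<alpha> ^ j)" if "i \<in> {..n}" for i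
    proof -
      have "x ^ i \<in> R" using x sub by (simp add: subring_closed)
      then obtain f where "f \<in> poly_over F" "degree f < n" "x ^ i = poly f \<alpha>"
        unfolding R by blast
      then show ?thesis by (intro exI[of _ "coeff f"]) (auto simp: poly_over_def poly_sum_degree_less)
    qed
    from lin_dep[OF F, of "{..n}" n "\<lambda>i. x ^ i" "\<lambda>j. \<alpha> ^ j", OF _ _ this]
    obtain c where c: "\<forall>i\<in>{..n}. c i \<in> F" "\<exists>i\<in>{..n}. c i \<noteq> 0" "(\<Sum>i\<le>n. c i * x ^ i) = 0"
      by auto
    define h where "h = (\<Sum>i<Suc n. monom (c i) i)"
    have ch: "coeff h i = (if i \<le> n then c i else 0)" for i
      by (auto simp: h_def coeff_sum coeff_monom)
    have "h \<in> poly_over F" unfolding h_def using c sF by (intro poly_over_sum_monom) auto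
    moreover have "h \<noteq> 0" using c(2) ch by (metis atMost_iff coeff_0)
    moreover have "poly h x = 0" using c(3)
      by (simp only: h_def poly_sum poly_monom lessThan_Suc_atMost)
    ultimately show ?thesis using inverse_mem_subring[OF F sub FR x False] by blast
  qed
  then have sf: "subfield R" using sub by (simp add: subfield_def)
  have "gen_field (F \<union> {\<alpha>}) = R"
  proof
    show "gen_field (F \<union> {\<alpha>}) \<subseteq> R" using sf FR aR by (intro gen_field_least) auto
    have "R \<subseteq> gen_field (F \<union> {\<alpha>})"
    proof
      fix x assume "x \<in> R"
      then obtain f where f: "f \<in> poly_over F" "x = poly f \<alpha>" by (auto simp: R_def)
      have "F \<union> {\<alpha>} \<subseteq> gen_field (F \<union> {\<alpha>})" by (rule gen_field_superset)
      then have "f \<in> poly_over (gen_field (F \<union> {\<alpha>}))" "\<alpha> \<in> gen_field (F \<union> {\<alpha>})"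
        using f by (auto simp: poly_over_def)
      then show "x \<in> gen_field (F \<union> {\<alpha>})"
        using f by (auto intro!: poly_over_poly subfield_subring subfield_gen_field)
    qed
    then show "R \<subseteq> gen_field (F \<union> {\<alpha>})" .
  qed
  then show ?thesis by (simp add: R)
qed

section \<open>Automorphism groups as sets of functions\<close>

lemma GalD:
  assumes "f \<in> Gal K L"
  shows "hom_on L f" "bij_betw f L L" "\<And>x. x \<in> L \<Longrightarrow> f x \<in> L" "\<And>x. x \<in> K \<Longrightarrow> f x = x"
    "\<And>x. x \<notin> L \<Longrightarrow> f x = x"
  using assms by (auto simp: Gal_def hom_on_def dest: bij_betwE)

lemma GalI:
  assumes "hom_on L f" "bij_betw f L L" "\<And>x. x \<in> K \<Longrightarrow> f x = x" "\<And>x. x \<notin> L \<Longrightarrow> f x = x"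
  shows "f \<in> Gal K L"
  using assms by (auto simp: Gal_def hom_on_def)

lemma Gal_mono: "K \<subseteq> M \<Longrightarrow> Gal M L \<subseteq> Gal K L"
  by (auto simp: Gal_def)

lemma Gal_id: "id \<in> Gal K L"
  by (auto simp: Gal_def)

lemma Gal_comp:
  assumes "f \<in> Gal K L" "g \<in> Gal K L"
  shows "f \<circ> g \<in> Gal K L"
proof (rule GalI)
  show "hom_on L (f \<circ> g)" using GalD(1)[OF assms(1)] GalD(1,3)[OF assms(2)]
    by (auto simp: hom_on_def)
  show "bij_betw (f \<circ> g) L L" using GalD(2)[OF assms(1)] GalD(2)[OF assms(2)] bij_betw_trans by blast
qed (use GalD(4,5)[OF assms(1)] GalD(4,5)[OF assms(2)] in auto)

lemma Gal_inverse:
  assumes L: "subfield L" and KL: "K \<subseteq> L" and f: "f \<in> Gal K L"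
  shows "\<exists>g\<in>Gal K L. g \<circ> f = id \<and> f \<circ> g = id"
proof -
  \<comment> \<open>Members of \<open>Gal\<close> are the identity off \<open>L\<close>, so that
    equal automorphisms are equal functions; the inverse has to follow this convention.\<close>
  define g where "g x = (if x \<in> L then inv_into L f x else x)" for x
  note D = GalD[OF f]
  note h = hom_add[OF L D(1)] hom_mult[OF L D(1)]
  have gf: "g (f x) = x" for x
    using D by (cases "x \<in> L") (auto simp: g_def bij_betw_inv_into_left)
  have fg: "f (g x) = x" for x
    using D by (cases "x \<in> L") (auto simp: g_def bij_betw_inv_into_right)
  have b: "bij_betw g L L"
    using bij_betw_inv_into[OF D(2)] by (rule bij_betw_cong[THEN iffD1, rotated]) (simp add: g_def)
  have gL: "g x \<in> L" if "x \<in> L" for x using b that by (auto dest: bij_betwE)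
  have "g \<in> Gal K L"
  proof (rule GalI)
    show "hom_on L g"
      unfolding hom_on_def
    proof (intro conjI ballI)
      show "g 1 = 1" using gf[of 1] hom_1[OF L D(1)] by simp
      fix x y assume xy: "x \<in> L" "y \<in> L"
      show "g (x + y) = g x + g y" using h(1)[of "g x" "g y"] gL xy fg gf by metis
      show "g (x * y) = g x * g y" using h(2)[of "g x" "g y"] gL xy fg gf by metis
    qed
    show "\<And>x. x \<in> K \<Longrightarrow> g x = x" using D(4) gf by metis
  qed (use b in \<open>auto simp: g_def\<close>)
  then show ?thesis using gf fg by (intro bexI[of _ g]) auto
qed

lemma Gal_bij:
  assumes "subfield L" "K \<subseteq> L" "\<rho> \<in> Gal K L"
  shows "bij_betw (\<lambda>\<tau>. \<rho> \<circ> \<tau>) (Gal K L) (Gal K L)"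
proof -
  obtain g where g: "g \<in> Gal K L" "g \<circ> \<rho> = id" "\<rho> \<circ> g = id"
    using Gal_inverse[OF assms] by blast
  show ?thesis
  proof (rule bij_betw_byWitness[where f' = "\<lambda>\<tau>. g \<circ> \<tau>"])
    show "\<forall>a\<in>Gal K L. g \<circ> (\<rho> \<circ> a) = a" "\<forall>a'\<in>Gal K L. \<rho> \<circ> (g \<circ> a') = a'"
      using g by (simp_all flip: comp_assoc)
  qed (use g assms Gal_comp in auto)
qed

text \<open>Gives access to Lagrange's theorem in \<open>Gal_pow_p\<close>.\<close>

lemma Gal_group:
  assumes "subfield L" "K \<subseteq> L"
  shows "group \<lparr>carrier = Gal K L, monoid.mult = (\<circ>), one = id\<rparr>"
proof (rule groupI, goal_cases)
  case (5 x)
  then show ?case using Gal_inverse[OF assms, of x] by auto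
qed (auto simp: Gal_comp Gal_id comp_assoc)

lemma Gal_funpow: "f \<in> Gal K L \<Longrightarrow> f ^^ n \<in> Gal K L"
  by (induction n) (auto simp: Gal_comp Gal_id)

text \<open>By Bezout, a period below \<open>p\<close> together with the period \<open>p\<close>
  would give the period 1. The map is arbitrary because both automorphisms and multiplication by a
  root of unity will be inserted.\<close>

lemma inj_on_prime_orbit:
  assumes p: "prime p" and fp: "(f ^^ p) y = y" and ne: "f y \<noteq> y"
  shows "inj_on (\<lambda>k. (f ^^ k) y) {..<p}"
proof -
  have mult: "(f ^^ (n * m)) y = y" if "(f ^^ m) y = y" for n m
    using that by (induction n) (auto simp: funpow_add)
  have "False" if ij: "i < j" "j < p" "(f ^^ i) y = (f ^^ j) y" for i j
  proof -
    define r where "r = j - i"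
    \<comment> \<open>As \<open>f\<close> need not be injective, the collision is not cancelled but
      carried \<open>p - i\<close> steps forward, where the orbit is back at
      \<open>y\<close>.\<close>
    have "(f ^^ (p - i + i)) y = y" using ij fp by simp
    then have "y = (f ^^ (p - i)) ((f ^^ i) y)" by (simp only: funpow_add comp_apply)
    also have "\<dots> = (f ^^ (p - i + j)) y" by (simp only: ij(3) funpow_add comp_apply)
    also have "p - i + j = r + p" using ij by (simp add: r_def)
    also have "(f ^^ (r + p)) y = (f ^^ r) y" using fp by (simp add: funpow_add)
    finally have r: "(f ^^ r) y = y" by simp
    have "0 < r" "r < p" using ij by (auto simp: r_def)
    then have "coprime r p" using p
      by (metis coprime_commute dvd_imp_le leD prime_imp_coprime_nat)
    then obtain s t where st: "r * s = p * t + 1"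
      using bezout_nat[of r p] \<open>0 < r\<close> by (auto simp: coprime_iff_gcd_eq_1)
    have "y = (f ^^ (s * r)) y" using mult[OF r] by simp
    also have "s * r = Suc (t * p)" using st by (simp add: mult.commute)
    also have "(f ^^ Suc (t * p)) y = f y" using mult[OF fp] by simp
    finally show False using ne by simp
  qed
  then show ?thesis by (intro linorder_inj_onI') auto
qed

text \<open>With \<open>y\<close>, all its \<open>n\<close> distinct iterates are zeros of a
  polynomial with fixed coefficients, too many for its degree.\<close>

lemma poly_fixed_zero:
  assumes L: "subfield L" and h: "hom_on L \<tau>" and \<tau>L: "\<And>x. x \<in> L \<Longrightarrow> \<tau> x \<in> L" and y: "y \<in> L"
    and inj: "inj_on (\<lambda>k. (\<tau> ^^ k) y) {..<n}"
    and g: "g \<in> poly_over L" "\<And>i. \<tau> (coeff g i) = coeff g i" "degree g < n" "poly g y = 0"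
  shows "g = 0"
proof (rule poly_eqI_degree[of "(\<lambda>k. (\<tau> ^^ k) y) ` {..<n}"])
  have m: "map_poly \<tau> g = g" using g(2) by (intro poly_eqI) (simp add: coeff_map_hom[OF L h])
  have "(\<tau> ^^ k) y \<in> L \<and> poly g ((\<tau> ^^ k) y) = 0" for k
  proof (induction k)
    case (Suc k)
    then show ?case using hom_poly[OF L h g(1), of "(\<tau> ^^ k) y"] m \<tau>L hom_0[OF L h] by auto
  qed (use y g in auto)
  then show "\<And>x. x \<in> (\<lambda>k. (\<tau> ^^ k) y) ` {..<n} \<Longrightarrow> poly g x = poly 0 x" by auto
qed (use g inj in \<open>auto simp: card_image\<close>)

text \<open>Adding \<open>x\<close> to the \<open>n\<close> powers of \<open>y\<close> forces a
  relation, and independence of the powers forces \<open>x\<close> to occur in it.\<close>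

lemma spanning_of_independent:
  fixes K L :: "'a::field set" and b :: "nat \<Rightarrow> 'a"
  assumes K: "subfield K" and L: "subfield L" and n: "n > 0"
    and span: "\<And>x. x \<in> L \<Longrightarrow> \<exists>c. (\<forall>j<n. c j \<in> K) \<and> x = (\<Sum>j<n. c j * b j)"
    and y: "y \<in> L" and indep: "\<And>g. g \<in> poly_over K \<Longrightarrow> degree g < n \<Longrightarrow> poly g y = 0 \<Longrightarrow> g = 0"
    and x: "x \<in> L"
  shows "\<exists>f\<in>poly_over K. degree f < n \<and> x = poly f y"
proof -
  define v where "v i = (if i < n then y ^ i else x)" for i
  have "\<exists>c. (\<forall>j<n. c j \<in> K) \<and> v i = (\<Sum>j<n. c j * b j)" if "i \<in> {..n}" for i
    by (rule span) (use x y L in \<open>auto simp: v_def subfield_closed\<close>)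
  from lin_dep[OF K, of "{..n}" n v b, OF _ _ this]
  obtain c where c: "\<forall>i\<in>{..n}. c i \<in> K" "\<exists>i\<in>{..n}. c i \<noteq> 0" "(\<Sum>i\<le>n. c i * v i) = 0"
    by auto
  have c3: "(\<Sum>i<n. c i * y ^ i) + c n * x = 0"
    using c(3) by (simp add: v_def flip: lessThan_Suc_atMost)
  have "c n \<noteq> 0"
  proof
    assume cn: "c n = 0"
    define g where "g = (\<Sum>i<n. monom (c i) i)"
    have "g = 0"
    proof (rule indep)
      show "g \<in> poly_over K" unfolding g_def using c K by (intro poly_over_sum_monom subfield_subring) auto
      show "degree g < n" unfolding g_def using n by (rule degree_sum_monom)
      show "poly g y = 0" using c3 cn by (simp add: g_def poly_sum poly_monom)
    qed
    then have "c i = 0" if "i < n" for i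
      using that coeff_sum_monom[of c n i] by (simp add: g_def)
    then show False using c(2) cn by (metis atMost_iff le_neq_implies_less)
  qed
  define f where "f = (\<Sum>i<n. monom (- c i / c n) i)"
  have "f \<in> poly_over K" unfolding f_def using c K by (intro poly_over_sum_monom subfield_subring subfield_closed) auto
  moreover have "degree f < n" unfolding f_def using n by (rule degree_sum_monom)
  moreover have "x = poly f y"
  proof -
    have "poly f y = (\<Sum>i<n. (- 1 / c n) * (c i * y ^ i))"
      by (simp add: f_def poly_sum poly_monom)
    also have "\<dots> = (- 1 / c n) * (\<Sum>i<n. c i * y ^ i)" by (simp only: sum_distrib_left)
    also have "(\<Sum>i<n. c i * y ^ i) = - (c n * x)" using c3 by (simp add: eq_neg_iff_add_eq_0)
    finally show ?thesis using \<open>c n \<noteq> 0\<close> by simp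
  qed
  ultimately show ?thesis by blast
qed

section \<open>Galois extensions of prime degree\<close>

locale prime_galois =
  fixes K' L' :: "'a::field_char_0 set" and p :: nat
  assumes p: "prime p" and gal: "galois_of_degree K' L' p"
begin

lemma K': "subfield K'" and L': "subfield L'" and K'L': "K' \<subseteq> L'"
  using gal by (auto simp: galois_of_degree_def)

lemma p_gt_0: "p > 0" and p_gt_1: "p > 1"
  using p prime_gt_0_nat prime_gt_1_nat by auto

lemma ex_nontrivial: "\<exists>\<tau>\<in>Gal K' L'. \<exists>y\<in>L'. \<tau> y \<noteq> y"
proof (rule ccontr)
  assume "\<not> ?thesis"
  then have "\<tau> = id" if "\<tau> \<in> Gal K' L'" for \<tau> using that GalD(5) by fastforce
  then have "Gal K' L' \<subseteq> {id}" by auto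
  then have "card (Gal K' L') \<le> 1" using card_mono[of "{id}"] by simp
  then show False using gal p_gt_1 by (simp add: galois_of_degree_def)
qed

text \<open>The powers of \<open>\<tau>\<close> form a subgroup whose order divides
  \<open>p\<close>.\<close>

lemma Gal_pow_p:
  assumes \<tau>: "\<tau> \<in> Gal K' L'"
  shows "\<tau> ^^ p = id"
proof (cases "\<tau> = id")
  case False
  define G where "G = \<lparr>carrier = Gal K' L', monoid.mult = (\<circ>), one = id :: 'a \<Rightarrow> 'a\<rparr>"
  interpret group G unfolding G_def by (rule Gal_group[OF L' K'L'])
  have fin: "finite (Gal K' L')" and card: "card (Gal K' L') = p"
    using gal by (auto simp: galois_of_degree_def)
  define H where "H = range (\<lambda>k. \<tau> ^^ k)"
  have HG: "H \<subseteq> Gal K' L'" using Gal_funpow[OF \<tau>] by (auto simp: H_def)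
  have "finite H" using HG fin finite_subset by blast
  have inj: "inj \<tau>"
    using Gal_inverse[OF L' K'L' \<tau>] by (metis comp_id inj_iff inj_on_imageI2 inj_on_id)
  have "\<exists>n>0. \<tau> ^^ n = id"
  proof -
    have "\<not> inj (\<lambda>k. \<tau> ^^ k)" using \<open>finite H\<close> by (auto simp: H_def finite_image_iff)
    then obtain i j where ij: "i < j" "\<tau> ^^ i = \<tau> ^^ j" by (metis linorder_injI)
    then have "\<tau> ^^ i \<circ> \<tau> ^^ (j - i) = \<tau> ^^ i"
      using funpow_add[of i "j - i" \<tau>] by simp
    then have "(\<tau> ^^ i) ((\<tau> ^^ (j - i)) x) = (\<tau> ^^ i) x" for x by (metis comp_apply)
    moreover have "inj (\<tau> ^^ i)" using inj by (simp add: inj_fn)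
    ultimately have "\<tau> ^^ (j - i) = id" by (auto simp: inj_def)
    then show ?thesis using ij by (intro exI[of _ "j - i"]) auto
  qed
  define n where "n = (LEAST n. 0 < n \<and> \<tau> ^^ n = id)"
  have n: "0 < n" "\<tau> ^^ n = id" and least: "\<And>m. 0 < m \<Longrightarrow> \<tau> ^^ m = id \<Longrightarrow> n \<le> m"
    using LeastI_ex[OF \<open>\<exists>n>0. \<tau> ^^ n = id\<close>] Least_le[of "\<lambda>n. 0 < n \<and> \<tau> ^^ n = id"]
    by (auto simp: n_def)
  have nm: "\<tau> ^^ (n * m) = id" for m by (induction m) (auto simp: funpow_add n)
  have "\<tau> ^^ k = \<tau> ^^ (k mod n)" for k
  proof -
    have "\<tau> ^^ k = \<tau> ^^ (n * (k div n) + k mod n)" by simp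
    also have "\<dots> = \<tau> ^^ (k mod n)" by (simp only: funpow_add nm id_comp)
    finally show ?thesis .
  qed
  then have Himg: "H = (\<lambda>k. \<tau> ^^ k) ` {..<n}"
    using n(1) by (force simp: H_def)
  have "inj_on (\<lambda>k. \<tau> ^^ k) {..<n}"
  proof (rule linorder_inj_onI')
    fix i j assume ij: "i \<in> {..<n}" "j \<in> {..<n}" "i < j"
    show "\<tau> ^^ i \<noteq> \<tau> ^^ j"
    proof
      assume "\<tau> ^^ i = \<tau> ^^ j"
      \<comment> \<open>Composing with \<open>\<tau> ^^ (n - j)\<close> produces a positive exponent
        below \<open>n\<close> that gives \<open>id\<close>, against minimality.\<close>
      then have "\<tau> ^^ (n - j + i) = \<tau> ^^ (n - j + j)" by (simp only: funpow_add)
      then show False using least[of "n - j + i"] ij n by auto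
    qed
  qed
  then have cH: "card H = n" by (simp add: Himg card_image)
  have "subgroup H G"
  proof (rule subgroup.intro)
    show "H \<subseteq> carrier G" using HG by (simp add: G_def)
    show "x \<otimes>\<^bsub>G\<^esub> y \<in> H" if "x \<in> H" "y \<in> H" for x y
      using that by (auto simp: G_def H_def simp flip: funpow_add)
    show "\<one>\<^bsub>G\<^esub> \<in> H" by (auto simp: G_def H_def intro: range_eqI[of _ _ 0])
    fix x assume "x \<in> H"
    then obtain k where k: "k < n" "x = \<tau> ^^ k" by (auto simp: Himg)
    have "inv\<^bsub>G\<^esub> x = \<tau> ^^ (n - k)"
      using k n Gal_funpow[OF \<tau>] by (intro inv_equality) (auto simp: G_def simp flip: funpow_add)
    then show "inv\<^bsub>G\<^esub> x \<in> H" by (simp add: H_def)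
  qed
  then have "card (rcosets\<^bsub>G\<^esub> H) * card H = p"
    using lagrange card by (simp add: order_def G_def)
  then have "n dvd p" using cH by (metis dvd_triv_right)
  moreover have "n \<noteq> 1" using n(2) False by auto
  ultimately have "n = p" using p by (metis prime_nat_iff)
  then show ?thesis using n by simp
qed simp

context
  fixes \<tau> y assumes \<tau>: "\<tau> \<in> Gal K' L'" and y: "y \<in> L'" "\<tau> y \<noteq> y"
begin

lemma fixed_poly_zero:
  assumes "g \<in> poly_over L'" "\<And>i. \<tau> (coeff g i) = coeff g i" "degree g < p" "poly g y = 0"
  shows "g = 0"
  using poly_fixed_zero[OF L' GalD(1,3)[OF \<tau>] y(1) inj_on_prime_orbit[of p \<tau> y] assms]
    Gal_pow_p[OF \<tau>] p y by simp

lemma poly_zero: "g \<in> poly_over K' \<Longrightarrow> degree g < p \<Longrightarrow> poly g y = 0 \<Longrightarrow> g = 0"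
  using GalD(4)[OF \<tau>] by (intro fixed_poly_zero) (auto simp: poly_over_def intro: subsetD[OF K'L'])

text \<open>A moved element has \<open>p\<close> distinct iterates under \<open>\<tau>\<close>, so
  its first \<open>p\<close> powers are independent: it is primitive.\<close>

lemma power_basis:
  assumes x: "x \<in> L'"
  shows "\<exists>f\<in>poly_over K'. degree f < p \<and> x = poly f y"
proof -
  obtain b where b: "L' = {x. \<exists>c. (\<forall>i<p. c i \<in> K') \<and> x = (\<Sum>i<p. c i * b i)}"
    using gal unfolding galois_of_degree_def ext_degree_is_def by blast
  show ?thesis
    by (rule spanning_of_independent[OF K' L' p_gt_0 _ y(1) poly_zero x, of b]) (use b in blast)
qed

text \<open>If \<open>x = poly f y\<close> with \<open>f\<close> over \<open>K'\<close>, then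
  \<open>f - [:x:]\<close> has fixed coefficients, degree below \<open>p\<close> and the zero
  \<open>y\<close>. It vanishes, so \<open>x\<close> is a coefficient of \<open>f\<close>.\<close>

lemma fixed_mem: "x \<in> L' \<Longrightarrow> \<tau> x = x \<Longrightarrow> x \<in> K'"
proof -
  assume x: "x \<in> L'" "\<tau> x = x"
  obtain f where f: "f \<in> poly_over K'" "degree f < p" "x = poly f y" using power_basis[OF x(1)] by blast
  have fL: "f \<in> poly_over L'" using f K'L' poly_over_mono by blast
  have "f - [:x:] = 0"
  proof (rule fixed_poly_zero)
    show "f - [:x:] \<in> poly_over L'" using fL x L' by (simp add: poly_over_closed subfield_subring)
    show "\<tau> (coeff (f - [:x:]) i) = coeff (f - [:x:]) i" for i
      using f GalD(4)[OF \<tau>] x hom_diff[OF L' GalD(1)[OF \<tau>]] hom_0[OF L' GalD(1)[OF \<tau>]] fL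
      by (auto simp: poly_over_def coeff_pCons split: nat.split)
    show "degree (f - [:x:]) < p" using f p_gt_0
      by (intro le_less_trans[OF degree_diff_le_max]) auto
  qed (use f in auto)
  then have "f = [:x:]" by simp
  then have "x = coeff f 0" by simp
  then show "x \<in> K'" using f(1) by (simp add: poly_over_def)
qed

end

end

section \<open>Adjoining a root of unity\<close>

lemma root_of_unity_inj:
  fixes \<omega> :: "'a::field"
  assumes "prime p" "\<omega> ^ p = 1" "\<omega> \<noteq> 1"
  shows "inj_on (\<lambda>k. \<omega> ^ k) {..<p}"
proof -
  have "((*) \<omega> ^^ k) 1 = \<omega> ^ k" for k by (induction k) auto
  then show ?thesis using inj_on_prime_orbit[of p "(*) \<omega>" 1] assms by simp
qed

lemma prod_roots_of_unity:
  fixes \<omega> :: "'a::field"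
  assumes p: "prime p" and w: "\<omega> ^ p = 1" "\<omega> \<noteq> 1" and a: "a \<noteq> 0"
  shows "monom 1 p - [:a ^ p:] = (\<Prod>k<p. [:- (\<omega> ^ k * a), 1:])"
proof -
  have p0: "p > 0" using p prime_gt_0_nat by simp
  have inj: "inj_on (\<lambda>k. \<omega> ^ k * a) {..<p}"
    using root_of_unity_inj[OF p w] a by (auto simp: inj_on_def)
  define S where "S = (\<lambda>k. \<omega> ^ k * a) ` {..<p}"
  have d: "degree (monom 1 p - [:a ^ p:]) = p"
  proof (rule order_antisym)
    show "degree (monom 1 p - [:a ^ p:]) \<le> p"
      by (rule degree_diff_le) (auto simp: degree_monom_le)
    show "p \<le> degree (monom 1 p - [:a ^ p:])"
      using p0 by (intro le_degree) (auto simp: coeff_pCons split: nat.split)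
  qed
  have "monom 1 p - [:a ^ p:] = (\<Prod>s\<in>S. [:- s, 1:])"
  proof (rule poly_eq_prod_roots)
    show "card S = degree (monom 1 p - [:a ^ p:])" using inj by (simp add: S_def card_image d)
    show "lead_coeff (monom 1 p - [:a ^ p:]) = 1"
      unfolding d using p0 by (auto simp: coeff_pCons split: nat.split)
    show "poly (monom 1 p - [:a ^ p:]) x = 0" if "x \<in> S" for x
      using that w by (auto simp: S_def poly_monom power_mult_distrib simp flip: power_mult)
         (metis mult.commute power_mult power_one mult_1)
  qed (simp add: S_def)
  also have "\<dots> = (\<Prod>k<p. [:- (\<omega> ^ k * a), 1:])"
    unfolding S_def using inj by (subst prod.reindex) auto
  finally show ?thesis .
qed

lemma power_diff_prod:
  fixes \<omega> :: "'a::field"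
  assumes "prime p" "\<omega> ^ p = 1" "\<omega> \<noteq> 1" "a \<noteq> 0"
  shows "x ^ p - a ^ p = (\<Prod>k<p. x - \<omega> ^ k * a)"
  using arg_cong[OF prod_roots_of_unity[OF assms], of "\<lambda>f. poly f x"]
  by (simp add: poly_monom poly_prod)

lemma root_of_unity_power:
  fixes \<omega> :: "'a::field"
  assumes "prime p" "\<omega> ^ p = 1" "\<omega> \<noteq> 1" "x ^ p = 1"
  shows "\<exists>k<p. x = \<omega> ^ k"
  using power_diff_prod[OF assms(1-3), of 1 x] assms(4) by auto

text \<open>The universal property of the ring generated by \<open>\<alpha>\<close>: by
  \<open>wd\<close>, relations of \<open>\<alpha>\<close> are carried to relations of
  \<open>\<beta>\<close>. Off \<open>M\<close> the map is the identity, to fit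
  \<open>Gal\<close>.\<close>

lemma extend_hom:
  fixes F :: "'a::field set"
  assumes F: "subfield F" and h: "hom_on F \<phi>"
    and wd: "\<And>f. f \<in> poly_over F \<Longrightarrow> poly f \<alpha> = 0 \<Longrightarrow> poly (map_poly \<phi> f) \<beta> = 0"
    and M: "M = {poly f \<alpha> | f. f \<in> poly_over F}"
  obtains \<Phi> where "hom_on M \<Phi>" "\<And>f. f \<in> poly_over F \<Longrightarrow> \<Phi> (poly f \<alpha>) = poly (map_poly \<phi> f) \<beta>"
    "\<And>x. x \<notin> M \<Longrightarrow> \<Phi> x = x"
proof
  note R = subfield_subring[OF F]
  define \<Phi> where "\<Phi> x = (if x \<in> M
    then poly (map_poly \<phi> (SOME f. f \<in> poly_over F \<and> x = poly f \<alpha>)) \<beta> else x)" for x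
  show *: "\<Phi> (poly f \<alpha>) = poly (map_poly \<phi> f) \<beta>" if f: "f \<in> poly_over F" for f
  proof -
    define g where "g = (SOME g. g \<in> poly_over F \<and> poly f \<alpha> = poly g \<alpha>)"
    have g: "g \<in> poly_over F \<and> poly f \<alpha> = poly g \<alpha>" unfolding g_def
      by (rule someI[of _ f]) (use f in simp)
    have "poly (map_poly \<phi> (f - g)) \<beta> = 0" using f g R by (intro wd) (auto simp: poly_over_closed)
    moreover have "map_poly \<phi> (f - g) + map_poly \<phi> g = map_poly \<phi> f"
      using map_hom_add[OF F h, of "f - g" g] f g R by (simp add: poly_over_closed)
    ultimately have "poly (map_poly \<phi> g) \<beta> = poly (map_poly \<phi> f) \<beta>"
      by (metis add_0 poly_add)
    moreover have "poly f \<alpha> \<in> M" using f M by auto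
    ultimately show ?thesis by (simp add: \<Phi>_def g_def)
  qed
  show "hom_on M \<Phi>"
    unfolding hom_on_def
  proof (intro conjI ballI)
    show "\<Phi> 1 = 1" using *[of 1] R by (simp add: poly_over_closed hom_1[OF F h])
    fix x y assume "x \<in> M" "y \<in> M"
    then obtain f g where "f \<in> poly_over F" "x = poly f \<alpha>" "g \<in> poly_over F" "y = poly g \<alpha>"
      using M by auto
    then show "\<Phi> (x + y) = \<Phi> x + \<Phi> y" "\<Phi> (x * y) = \<Phi> x * \<Phi> y"
      using *[of f] *[of g] *[of "f + g"] *[of "f * g"] R
      by (auto simp: poly_over_closed map_hom_add[OF F h] map_hom_mult[OF F h])
  qed
  show "\<And>x. x \<notin> M \<Longrightarrow> \<Phi> x = x" by (simp add: \<Phi>_def)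
qed

locale cyclotomic_galois = prime_galois K' L' p for K' L' :: "'a::field_char_0 set" and p +
  fixes \<zeta> :: 'a and K L :: "'a set"
  assumes z: "\<zeta> ^ p = 1" "\<zeta> \<noteq> 1"
    and K_def: "K = gen_field (K' \<union> {\<zeta>})" and L_def: "L = gen_field (L' \<union> {\<zeta>})"
begin

lemma K: "subfield K" and L: "subfield L"
  by (simp_all add: K_def L_def subfield_gen_field)

lemma K'K: "K' \<subseteq> K" and L'L: "L' \<subseteq> L" and zK: "\<zeta> \<in> K" and zL: "\<zeta> \<in> L"
  using gen_field_superset unfolding K_def L_def by blast+

lemma KL: "K \<subseteq> L"
  using L K'L' L'L zL unfolding K_def by (intro gen_field_least) auto

text \<open>The \<open>p\<close>-th cyclotomic polynomial, possibly reducible over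
  \<open>K'\<close>.\<close>

definition Phi :: "'a poly" where "Phi = (\<Sum>i<p. monom 1 i)"

lemma Phi_over: "subfield F \<Longrightarrow> Phi \<in> poly_over F"
  unfolding Phi_def by (intro poly_over_sum_monom) (auto simp: subfield_closed subfield_subring)

lemma degree_Phi: "degree Phi = p - 1"
proof (rule order_antisym)
  show "degree Phi \<le> p - 1" using degree_sum_monom[OF p_gt_0, of "\<lambda>_. 1 :: 'a"] unfolding Phi_def by linarith
  show "p - 1 \<le> degree Phi" using p_gt_0 by (intro le_degree) (simp add: Phi_def coeff_sum_monom)
qed

lemma Phi_root: "poly Phi x = 0 \<longleftrightarrow> x ^ p = 1 \<and> x \<noteq> 1"
proof -
  have "poly Phi x = (\<Sum>i<p. x ^ i)" by (simp add: Phi_def poly_sum poly_monom)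
  then have "x ^ p - 1 = (x - 1) * poly Phi x" by (simp add: power_diff_1_eq)
  moreover have "poly Phi 1 \<noteq> 0" using p_gt_0 by (simp add: Phi_def poly_sum poly_monom)
  ultimately show ?thesis by auto
qed

lemma K_poly: "K = {poly f \<zeta> | f. f \<in> poly_over K' \<and> degree f < p - 1}"
  unfolding K_def using z p_gt_1 K'
  by (intro gen_field_simple[of _ Phi]) (auto simp: Phi_over degree_Phi Phi_root)

lemma L_poly': "L = {poly f \<zeta> | f. f \<in> poly_over L' \<and> degree f < p - 1}"
  unfolding L_def using z p_gt_1 L'
  by (intro gen_field_simple[of _ Phi]) (auto simp: Phi_over degree_Phi Phi_root)

lemma L_poly: "L = {poly f \<zeta> | f. f \<in> poly_over L'}"
proof
  show "{poly f \<zeta> | f. f \<in> poly_over L'} \<subseteq> L"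
    using poly_over_poly[OF subfield_subring[OF L]] poly_over_mono[OF L'L] zL by auto
qed (auto simp: L_poly')

text \<open>An element of \<open>L'\<close> outside \<open>K'\<close> has \<open>p\<close>
  independent powers over \<open>K'\<close>, while \<open>K\<close> is spanned by
  \<open>p - 1\<close> powers of \<open>\<zeta>\<close>.\<close>

lemma L'_inter_K: "x \<in> L' \<Longrightarrow> x \<in> K \<Longrightarrow> x \<in> K'"
proof (rule ccontr)
  assume x: "x \<in> L'" "x \<in> K" "x \<notin> K'"
  obtain \<tau> y where t: "\<tau> \<in> Gal K' L'" "y \<in> L'" "\<tau> y \<noteq> y" using ex_nontrivial by blast
  have tx: "\<tau> x \<noteq> x" using fixed_mem[OF t x(1)] x by blast
  have "\<exists>c. (\<forall>j<p - 1. c j \<in> K') \<and> x ^ i = (\<Sum>j<p - 1. c j * \<zeta> ^ j)" for i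
  proof -
    have "x ^ i \<in> K" using x K by (simp add: subfield_closed)
    then obtain f where "f \<in> poly_over K'" "degree f < p - 1" "x ^ i = poly f \<zeta>"
      unfolding K_poly by blast
    then show ?thesis by (intro exI[of _ "coeff f"]) (auto simp: poly_over_def poly_sum_degree_less)
  qed
  from lin_dep[OF K', of "{..<p}" "p - 1" "\<lambda>i. x ^ i" "\<lambda>j. \<zeta> ^ j", OF _ _ this]
  obtain c where c: "\<forall>i<p. c i \<in> K'" "\<exists>i<p. c i \<noteq> 0" "(\<Sum>i<p. c i * x ^ i) = 0"
    using p_gt_0 by auto
  define g where "g = (\<Sum>i<p. monom (c i) i)"
  have "g = 0"
  proof (rule poly_zero[OF t(1) x(1) tx])
    show "g \<in> poly_over K'" unfolding g_def using c K' by (intro poly_over_sum_monom subfield_subring) auto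
    show "degree g < p" unfolding g_def using p_gt_0 by (rule degree_sum_monom)
    show "poly g x = 0" using c by (simp add: g_def poly_sum poly_monom)
  qed
  then have "c i = 0" if "i < p" for i
    using that coeff_sum_monom[of c p i] by (simp add: g_def)
  then show False using c(2) by blast
qed

text \<open>The minimal polynomial of \<open>\<zeta>\<close> over \<open>L'\<close> divides
  \<open>Phi\<close>, so its roots are powers of \<open>\<zeta>\<close> and its coefficients lie
  both in \<open>K\<close> and in \<open>L'\<close>, hence in \<open>K'\<close>. This is the linear
  disjointness that lets automorphisms of \<open>L'\<close> extend to \<open>L\<close> with
  \<open>\<zeta>\<close> fixed.\<close>

lemma ex_minpoly:
  "\<exists>q. q \<in> poly_over K' \<and> lead_coeff q = 1 \<and> degree q > 0 \<and> poly q \<zeta> = 0 \<and>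
    (\<forall>f\<in>poly_over L'. poly f \<zeta> = 0 \<longrightarrow> (\<exists>g\<in>poly_over L'. f = q * g)) \<and>
    card {x. poly q x = 0} = degree q \<and> degree q < p \<and> (\<forall>x. poly q x = 0 \<longrightarrow> x ^ p = 1 \<and> x \<noteq> 1)"
proof -
  define P where "P q \<longleftrightarrow> q \<in> poly_over L' \<and> q \<noteq> 0 \<and> poly q \<zeta> = 0" for q
  have "P Phi" using Phi_over[OF L'] degree_Phi p_gt_1 z by (auto simp: P_def Phi_root)
  then obtain q0 where q0: "P q0" and min: "\<And>g. P g \<Longrightarrow> degree q0 \<le> degree g"
    using ex_has_least_nat[of P Phi degree] by blast
  define q where "q = smult (inverse (lead_coeff q0)) q0"
  have "lead_coeff q0 \<in> L'" using q0 by (auto simp: P_def poly_over_def)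
  then have Pq: "P q" and dq: "degree q = degree q0" and lq: "lead_coeff q = 1"
    using q0 L' by (auto simp: P_def q_def poly_over_closed subfield_closed subfield_subring)
  have q: "q \<in> poly_over L'" "q \<noteq> 0" "poly q \<zeta> = 0" using Pq by (auto simp: P_def)
  have dvd: "\<exists>g\<in>poly_over L'. f = q * g" if f: "f \<in> poly_over L'" "poly f \<zeta> = 0" for f
  proof -
    obtain g r where gr: "g \<in> poly_over L'" "r \<in> poly_over L'" "f = g * q + r"
      "r = 0 \<or> degree r < degree q"
      using poly_over_division[OF L' f(1) q(1,2)] by blast
    then have "poly r \<zeta> = 0" using f q by simp
    then have "r = 0" using gr(2,4) min[of r] dq unfolding P_def by linarith
    then show ?thesis using gr by (auto simp: mult.commute)
  qed
  obtain g where g: "g \<in> poly_over L'" "Phi = q * g" using dvd[OF Phi_over[OF L']] z Phi_root by blast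
  have "Phi \<noteq> 0" using degree_Phi p_gt_1 by auto
  then have g0: "g \<noteq> 0" using g by auto
  have roots: "poly q x = 0 \<Longrightarrow> x ^ p = 1 \<and> x \<noteq> 1" for x using Phi_root[of x] g by simp
  have dd: "degree q + degree g = p - 1" using degree_Phi g g0 q by (simp add: degree_mult_eq)
  have pos: "degree q > 0"
  proof (rule ccontr)
    assume "\<not> 0 < degree q"
    then obtain c where "q = [:c:]" by (metis degree_eq_zeroE gr_zeroI)
    then show False using q by auto
  qed
  \<comment> \<open>The \<open>p - 1\<close> zeros of \<open>Phi\<close> are shared between
    \<open>q\<close> and \<open>g\<close>, whose degrees add up to \<open>p - 1\<close>, so each has
    as many zeros as its degree.\<close>
  have card: "card {x. poly q x = 0} = degree q"
  proof -
    have "(\<lambda>k. \<zeta> ^ k) ` {1..<p} \<subseteq> {x. poly Phi x = 0}"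
    proof clarify
      fix k assume k: "k \<in> {1..<p}"
      have "\<zeta> ^ k \<noteq> \<zeta> ^ 0" using inj_onD[OF root_of_unity_inj[OF p z], of k 0] k by auto
      moreover have "(\<zeta> ^ k) ^ p = 1" using z by (metis mult.commute power_mult power_one)
      ultimately show "poly Phi (\<zeta> ^ k) = 0" by (simp add: Phi_root)
    qed
    moreover have "inj_on (\<lambda>k. \<zeta> ^ k) {1..<p}"
      by (rule inj_on_subset[OF root_of_unity_inj[OF p z]]) auto
    ultimately have "card {1..<p} \<le> card {x. poly Phi x = 0}"
      by (intro card_inj_on_le poly_roots_finite \<open>Phi \<noteq> 0\<close>)
    also have "{x. poly Phi x = 0} = {x. poly q x = 0} \<union> {x. poly g x = 0}" using g by auto
    also have "card \<dots> \<le> card {x. poly q x = 0} + card {x. poly g x = 0}" by (rule card_Un_le)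
    finally show ?thesis using card_poly_roots_bound[OF q(2)] card_poly_roots_bound[OF g0] dd by simp
  qed
  have qprod: "q = (\<Prod>s\<in>{x. poly q x = 0}. [:- s, 1:])"
    using q by (intro poly_eq_prod_roots) (auto simp: poly_roots_finite card lq)
  have "s \<in> K" if "poly q s = 0" for s
    using root_of_unity_power[OF p z, of s] roots[OF that] zK K by (auto simp: subfield_closed)
  then have "(\<Prod>s\<in>{x. poly q x = 0}. [:- s, 1:]) \<in> poly_over K"
    by (intro poly_over_prod poly_over_closed(1,7) subring_1 subring_uminus subfield_subring[OF K]) auto
  then have "q \<in> poly_over K" using qprod by simp
  then have "q \<in> poly_over K'" using q L'_inter_K by (auto simp: poly_over_def)
  then show ?thesis using lq pos q dvd card roots dd p_gt_0 by (intro exI[of _ q]) auto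
qed

definition q :: "'a poly" where
  "q = (SOME q. q \<in> poly_over K' \<and> lead_coeff q = 1 \<and> degree q > 0 \<and> poly q \<zeta> = 0 \<and>
    (\<forall>f\<in>poly_over L'. poly f \<zeta> = 0 \<longrightarrow> (\<exists>g\<in>poly_over L'. f = q * g)) \<and>
    card {x. poly q x = 0} = degree q \<and> degree q < p \<and> (\<forall>x. poly q x = 0 \<longrightarrow> x ^ p = 1 \<and> x \<noteq> 1))"

lemma q: "q \<in> poly_over K'" "degree q > 0" "poly q \<zeta> = 0"
    "\<And>f. f \<in> poly_over L' \<Longrightarrow> poly f \<zeta> = 0 \<Longrightarrow> \<exists>g\<in>poly_over L'. f = q * g"
    "card {x. poly q x = 0} = degree q" "degree q < p" "\<And>x. poly q x = 0 \<Longrightarrow> x ^ p = 1"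
    "\<And>x. poly q x = 0 \<Longrightarrow> x \<noteq> 1"
  using someI_ex[OF ex_minpoly, folded q_def] by auto

lemma q_L': "q \<in> poly_over L'"
  using q(1) poly_over_mono[OF K'L'] by blast

lemma map_poly_fixed: "(\<And>x. x \<in> F \<Longrightarrow> \<phi> x = x) \<Longrightarrow> subfield F \<Longrightarrow> f \<in> poly_over F \<Longrightarrow> map_poly \<phi> f = f"
  by (intro poly_eqI) (auto simp: poly_over_def coeff_map_poly subfield_closed)

lemma hom_eq_on_L:
  assumes "hom_on L f" "hom_on L g" "\<And>x. x \<in> L' \<Longrightarrow> f x = g x" "f \<zeta> = g \<zeta>" "x \<in> L"
  shows "f x = g x"
proof -
  obtain h where h: "h \<in> poly_over L'" "x = poly h \<zeta>" using assms(5) L_poly by auto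
  have hL: "h \<in> poly_over L" using h poly_over_mono[OF L'L] by blast
  have "map_poly f h = map_poly g h"
    using h assms by (intro poly_eqI) (auto simp: coeff_map_hom[OF L] poly_over_def)
  then show ?thesis using h hom_poly[OF L assms(1) hL zL] hom_poly[OF L assms(2) hL zL] assms(4) by simp
qed

text \<open>Since \<open>q\<close> is over \<open>K'\<close>, applying \<open>\<tau>\<close> to a
  multiple of \<open>q\<close> gives a multiple of \<open>q\<close>; relations of
  \<open>\<zeta>\<close> over \<open>L'\<close> are preserved.\<close>

lemma extend_to_L:
  assumes "\<tau> \<in> Gal K' L'"
  shows "\<exists>\<rho>\<in>Gal K L. \<forall>x\<in>L'. \<rho> x = \<tau> x"
proof -
  note t = GalD[OF assms]
  have qt: "map_poly \<tau> q = q" using map_poly_fixed[OF t(4) K' q(1)] .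
  have "poly (map_poly \<tau> f) \<zeta> = 0" if f: "f \<in> poly_over L'" "poly f \<zeta> = 0" for f
  proof -
    obtain g where "g \<in> poly_over L'" "f = q * g" using q(4)[OF f] by blast
    then show ?thesis using q(3) by (simp add: map_hom_mult[OF L' t(1) q_L'] qt)
  qed
  from extend_hom[OF L' t(1) this L_poly] obtain \<rho> where r: "hom_on L \<rho>"
    "\<And>f. f \<in> poly_over L' \<Longrightarrow> \<rho> (poly f \<zeta>) = poly (map_poly \<tau> f) \<zeta>" "\<And>x. x \<notin> L \<Longrightarrow> \<rho> x = x"
    by blast
  have r1: "\<rho> x = \<tau> x" if "x \<in> L'" for x
    using r(2)[of "[:x:]"] that L' hom_0[OF L' t(1)] by (simp add: poly_over_closed subfield_subring map_poly_pCons)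
  have rz: "\<rho> \<zeta> = \<zeta>"
    using r(2)[of "[:0, 1:]"] L' hom_0[OF L' t(1)] hom_1[OF L' t(1)]
    by (simp add: poly_over_closed subfield_subring map_poly_pCons subfield_closed)
  have rK: "\<rho> x = x" if xK: "x \<in> K" for x
  proof -
    obtain f where f: "f \<in> poly_over K'" "x = poly f \<zeta>" using xK unfolding K_poly by blast
    then have "\<rho> x = poly (map_poly \<tau> f) \<zeta>" using r(2)[of f] poly_over_mono[OF K'L'] by blast
    also have "map_poly \<tau> f = f" using map_poly_fixed[OF t(4) K'] f by blast
    finally show ?thesis using f by simp
  qed
  have "\<rho> ` L = L"
  proof
    have "map_poly \<tau> f \<in> poly_over L'" if "f \<in> poly_over L'" for f
      using that t(3) by (simp add: poly_over_def coeff_map_hom[OF L' t(1)])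
    then show "\<rho> ` L \<subseteq> L" using r(2) by (auto simp: L_poly)
    obtain g where g: "g \<in> Gal K' L'" "\<tau> \<circ> g = id" using Gal_inverse[OF L' K'L' assms] by blast
    note g' = GalD[OF g(1)]
    show "L \<subseteq> \<rho> ` L"
    proof
      fix x assume "x \<in> L"
      then obtain f where f: "f \<in> poly_over L'" "x = poly f \<zeta>" by (auto simp: L_poly)
      have gf: "map_poly g f \<in> poly_over L'" using f g'(3) by (auto simp: poly_over_def coeff_map_hom[OF L' g'(1)])
      have "map_poly \<tau> (map_poly g f) = f"
        using g(2) by (intro poly_eqI) (simp add: coeff_map_hom[OF L' g'(1)] coeff_map_hom[OF L' t(1)] pointfree_idE)
      then have "x = \<rho> (poly (map_poly g f) \<zeta>)" using r(2)[OF gf] f by simp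
      then show "x \<in> \<rho> ` L" using gf by (auto simp: L_poly)
    qed
  qed
  then have "bij_betw \<rho> L L" using hom_inj[OF L r(1)] by (simp add: bij_betw_def)
  then have "\<rho> \<in> Gal K L" using r rK by (intro GalI) auto
  then show ?thesis using r1 by blast
qed

lemma ex_conj:
  assumes b: "poly q \<beta> = 0"
  shows "\<exists>l\<in>Gal L' L. l \<zeta> = \<beta>"
proof -
  have h: "hom_on L' id" by (simp add: hom_on_def)
  have "poly (map_poly id f) \<beta> = 0" if f: "f \<in> poly_over L'" "poly f \<zeta> = 0" for f
    using q(4)[OF f] b by auto
  from extend_hom[OF L' h this L_poly] obtain \<rho> where r: "hom_on L \<rho>"
    "\<And>f. f \<in> poly_over L' \<Longrightarrow> \<rho> (poly f \<zeta>) = poly f \<beta>" "\<And>x. x \<notin> L \<Longrightarrow> \<rho> x = x"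
    by (metis map_poly_id)
  have rz: "\<rho> \<zeta> = \<beta>"
    using r(2)[of "[:0, 1:]"] L' by (simp add: poly_over_closed subfield_subring subfield_closed)
  have r1: "\<rho> x = x" if "x \<in> L'" for x
    using r(2)[of "[:x:]"] that L' by (simp add: poly_over_closed subfield_subring)
  have bK: "\<beta> \<in> K" using root_of_unity_power[OF p z q(7)[OF b]] zK K by (auto simp: subfield_closed)
  have "\<rho> ` L = L"
  proof
    show "\<rho> ` L \<subseteq> L" using r(2) bK KL poly_over_mono[OF L'L] L
      by (auto simp: L_poly[THEN equalityD1, THEN subsetD] intro!: poly_over_poly subfield_subring
          dest!: L_poly[THEN equalityD1, THEN subsetD])
    \<comment> \<open>For surjectivity: \<open>\<zeta>\<close> is a power of \<open>\<beta>\<close>,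
      so substituting this power of the variable into \<open>f\<close> gives a preimage of
      \<open>poly f \<zeta>\<close>.\<close>
    obtain k where k: "\<zeta> = \<beta> ^ k"
      using root_of_unity_power[OF p q(7)[OF b] q(8)[OF b] z(1)] by blast
    show "L \<subseteq> \<rho> ` L"
    proof
      fix x assume "x \<in> L"
      then obtain f where f: "f \<in> poly_over L'" "x = poly f \<zeta>" by (auto simp: L_poly)
      define g where "g = pcompose f (monom 1 k)"
      have g: "g \<in> poly_over L'" unfolding g_def using f L'
        by (intro poly_over_pcompose poly_over_closed subfield_closed subfield_subring) auto
      have "x = \<rho> (poly g \<zeta>)" using r(2)[OF g] f k by (simp add: g_def poly_pcompose poly_monom)
      then show "x \<in> \<rho> ` L" using g by (auto simp: L_poly)
    qed
  qed
  then have "bij_betw \<rho> L L" using hom_inj[OF L r(1)] by (simp add: bij_betw_def)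
  then have "\<rho> \<in> Gal L' L" using r r1 by (intro GalI) auto
  then show ?thesis using rz by blast
qed

lemma Gal_zeta: "\<rho> \<in> Gal K' L \<Longrightarrow> (\<rho> \<zeta>) ^ p = 1"
  using hom_power[OF L GalD(1) zL, of \<rho> K' p] z hom_1[OF L GalD(1), of \<rho> K'] by simp

lemma Gal_L'_zeta:
  assumes "l \<in> Gal L' L"
  shows "poly q (l \<zeta>) = 0"
  using hom_poly[OF L GalD(1)[OF assms] poly_over_mono[OF L'L q_L'] zL] q(3)
    map_poly_fixed[OF GalD(4)[OF assms] L' q_L'] hom_0[OF L GalD(1)[OF assms]] by simp

text \<open>An automorphism over \<open>L'\<close> is determined by the root of \<open>q\<close> to
  which it sends \<open>\<zeta>\<close>. The bound makes the number of terms of the trace a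
  unit.\<close>

lemma card_Gal_L': "card (Gal L' L) < p" "card (Gal L' L) > 0"
proof -
  have inj: "inj_on (\<lambda>l. l \<zeta>) (Gal L' L)"
  proof (rule inj_onI, rule ext)
    fix l m x assume lm: "l \<in> Gal L' L" "m \<in> Gal L' L" "l \<zeta> = m \<zeta>"
    show "l x = m x"
    proof (cases "x \<in> L")
      case True
      then show ?thesis
        using lm GalD(4)[OF lm(1)] GalD(4)[OF lm(2)]
        by - (rule hom_eq_on_L[OF GalD(1)[OF lm(1)] GalD(1)[OF lm(2)]]; auto)
    qed (simp add: GalD(5)[OF lm(1)] GalD(5)[OF lm(2)])
  qed
  have fin: "finite {x. poly q x = 0}" using q(2) by (intro poly_roots_finite) auto
  have sub: "(\<lambda>l. l \<zeta>) ` Gal L' L \<subseteq> {x. poly q x = 0}" using Gal_L'_zeta by auto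
  have f: "finite (Gal L' L)" using inj sub fin by (meson finite_imageD finite_subset)
  show "card (Gal L' L) < p" using card_inj_on_le[OF inj sub fin] q(5,6) by simp
  show "card (Gal L' L) > 0" using f Gal_id by (auto simp: card_gt_0_iff)
qed

text \<open>Write \<open>x = poly f \<zeta>\<close> with \<open>degree f < degree q\<close>. By
  invariance \<open>f\<close> takes the value \<open>x\<close> at all roots of \<open>q\<close>, so
  it is constant.\<close>

lemma fixed_Gal_L':
  assumes x: "x \<in> L" "\<And>l. l \<in> Gal L' L \<Longrightarrow> l x = x"
  shows "x \<in> L'"
proof -
  obtain f0 where "f0 \<in> poly_over L'" "x = poly f0 \<zeta>" using x by (auto simp: L_poly)
  then obtain f where f: "f \<in> poly_over L'" "degree f < degree q" "x = poly f \<zeta>"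
    using poly_reduce[OF L' q_L' refl q(2,3)] by metis
  have fL: "f \<in> poly_over L" using f poly_over_mono[OF L'L] by blast
  have "f = [:x:]"
  proof (rule poly_eqI_degree[of "{x. poly q x = 0}"])
    fix \<beta> assume "\<beta> \<in> {x. poly q x = 0}"
    then obtain l where l: "l \<in> Gal L' L" "l \<zeta> = \<beta>" using ex_conj by blast
    then have "x = poly (map_poly l f) \<beta>" using hom_poly[OF L GalD(1)[OF l(1)] fL zL] f(3) x(2)[OF l(1)] by simp
    also have "map_poly l f = f" using map_poly_fixed[OF GalD(4)[OF l(1)] L' f(1)] .
    finally show "poly f \<beta> = poly [:x:] \<beta>" by simp
  qed (use f q in auto)
  then have "x = coeff f 0" by simp
  then show ?thesis using f(1) by (simp add: poly_over_def)
qed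

text \<open>The polynomial with the roots \<open>\<tau> x\<close> has coefficients in
  \<open>K'\<close>, so \<open>\<rho>\<close> sends its root \<open>x\<close> to another of its
  roots. Thus \<open>L'\<close> is stable under \<open>Gal K' L\<close>.\<close>

lemma Gal_conj_L':
  assumes r: "\<rho> \<in> Gal K' L" and x: "x \<in> L'"
  shows "\<exists>\<tau>\<in>Gal K' L'. \<rho> x = \<tau> x"
proof -
  have fin: "finite (Gal K' L')" using gal by (simp add: galois_of_degree_def)
  define f where "f = (\<Prod>\<tau>\<in>Gal K' L'. [:- \<tau> x, 1:])"
  have fL': "f \<in> poly_over L'" unfolding f_def using L' GalD(3) x
    by (intro poly_over_prod poly_over_closed subfield_closed subfield_subring) auto
  obtain \<tau> y where t: "\<tau> \<in> Gal K' L'" "y \<in> L'" "\<tau> y \<noteq> y" using ex_nontrivial by blast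
  have "\<tau> (coeff f n) = coeff f n" for n
    unfolding f_def using t x GalD(3)
    by (intro hom_fix_coeff_prod[OF L' GalD(1)[OF t(1)] _ Gal_bij[OF L' K'L' t(1)]]) auto
  then have "f \<in> poly_over K'" using fL' fixed_mem[OF t] by (auto simp: poly_over_def)
  then have m: "map_poly \<rho> f = f" using map_poly_fixed[OF GalD(4)[OF r] K'] by blast
  have "poly f x = 0" using fin Gal_id by (force simp: f_def poly_prod intro: bexI[of _ id])
  then have "poly f (\<rho> x) = 0"
    using hom_poly[OF L GalD(1)[OF r] poly_over_mono[OF L'L fL'], of x] x L'L m
      hom_0[OF L GalD(1)[OF r]] by auto
  then show ?thesis using fin by (auto simp: f_def poly_prod)
qed

lemma Gal_L'_closed: "\<rho> \<in> Gal K' L \<Longrightarrow> x \<in> L' \<Longrightarrow> \<rho> x \<in> L'"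
  using Gal_conj_L' GalD(3) by metis

lemma finite_Gal: "finite (Gal K' L)"
proof -
  have fin: "finite (Gal K' L')" using gal by (simp add: galois_of_degree_def)
  obtain \<tau> y where t: "\<tau> \<in> Gal K' L'" "y \<in> L'" "\<tau> y \<noteq> y" using ex_nontrivial by blast
  have "inj_on (\<lambda>\<rho>. (\<rho> \<zeta>, \<rho> y)) (Gal K' L)"
  proof (rule inj_onI, rule ext)
    fix l m x assume lm: "l \<in> Gal K' L" "m \<in> Gal K' L" "(l \<zeta>, l y) = (m \<zeta>, m y)"
    have L'eq: "l x = m x" if x: "x \<in> L'" for x
    proof -
      obtain f where f: "f \<in> poly_over K'" "x = poly f y" using power_basis[OF t x] by blast
      have fL: "f \<in> poly_over L" using f K'L' L'L poly_over_mono by blast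
      have "y \<in> L" using t L'L by blast
      then show ?thesis
        using hom_poly[OF L GalD(1)[OF lm(1)] fL] hom_poly[OF L GalD(1)[OF lm(2)] fL] lm(3) f(2)
          map_poly_fixed[OF GalD(4)[OF lm(1)] K' f(1)] map_poly_fixed[OF GalD(4)[OF lm(2)] K' f(1)] by simp
    qed
    show "l x = m x"
    proof (cases "x \<in> L")
      case True
      then show ?thesis using lm L'eq
        by - (rule hom_eq_on_L[OF GalD(1)[OF lm(1)] GalD(1)[OF lm(2)]]; auto)
    qed (simp add: GalD(5)[OF lm(1)] GalD(5)[OF lm(2)])
  qed
  moreover have "(\<lambda>\<rho>. (\<rho> \<zeta>, \<rho> y)) ` Gal K' L \<subseteq> ((\<lambda>k. \<zeta> ^ k) ` {..<p}) \<times> ((\<lambda>\<tau>. \<tau> y) ` Gal K' L')"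
    using root_of_unity_power[OF p z Gal_zeta] Gal_conj_L'[OF _ t(2)] by (fastforce simp: image_iff)
  then have "finite ((\<lambda>\<rho>. (\<rho> \<zeta>, \<rho> y)) ` Gal K' L)"
    by (rule finite_subset) (use fin in auto)
  ultimately show ?thesis using finite_imageD by blast
qed

text \<open>With \<open>finite_Gal\<close>, this is the sense in which \<open>L\<close> is Galois
  over \<open>K'\<close> that \<open>henselian_galois\<close> requires.\<close>

lemma fixed_Gal:
  assumes x: "x \<in> L" "\<And>\<rho>. \<rho> \<in> Gal K' L \<Longrightarrow> \<rho> x = x"
  shows "x \<in> K'"
proof -
  have xL': "x \<in> L'" using x Gal_mono[OF K'L', of L] by (intro fixed_Gal_L') auto
  obtain \<tau> y where t: "\<tau> \<in> Gal K' L'" "y \<in> L'" "\<tau> y \<noteq> y" using ex_nontrivial by blast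
  obtain \<rho> where "\<rho> \<in> Gal K L" "\<forall>x\<in>L'. \<rho> x = \<tau> x" using extend_to_L[OF t(1)] by blast
  then have "\<tau> x = x" using x(2)[of \<rho>] xL' Gal_mono[OF K'K, of L] by auto
  then show ?thesis using fixed_mem[OF t xL'] by blast
qed

end

section \<open>Valuations over a henselian field\<close>

locale valued_field =
  fixes F V :: "'a::field set"
  assumes vr: "valuation_ring F V"
begin

lemma F: "subfield F" and V: "subring V" and VF: "V \<subseteq> F"
  and V_cases: "x \<in> F \<Longrightarrow> x \<in> V \<or> inverse x \<in> V"
  using vr subring_0[of V] by (auto simp: valuation_ring_def)

text \<open>\<open>le x y\<close> says that the value of \<open>x\<close> is at least the value of \<open>y\<close>, that is, \<open>|x| \<le> |y|\<close>.\<close>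

definition le :: "'a \<Rightarrow> 'a \<Rightarrow> bool" where
  "le x y \<longleftrightarrow> (\<exists>t\<in>V. x = t * y)"

lemma le_refl: "le x x"
  unfolding le_def using V subring_1 by (intro bexI[of _ 1]) auto

lemma le_trans: "le x y \<Longrightarrow> le y w \<Longrightarrow> le x w"
  unfolding le_def using subring_mult[OF V] by (metis mult.assoc)

lemma le_0: "le 0 x"
  unfolding le_def using V subring_0 by (intro bexI[of _ 0]) auto

lemma le_0_iff: "le x 0 \<longleftrightarrow> x = 0"
  using le_0 by (auto simp: le_def)

lemma le_1_iff: "le x 1 \<longleftrightarrow> x \<in> V"
  by (auto simp: le_def)

lemma le_total: "x \<in> F \<Longrightarrow> y \<in> F \<Longrightarrow> le x y \<or> le y x"
proof -
  assume xy: "x \<in> F" "y \<in> F"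
  show ?thesis
  proof (cases "x = 0 \<or> y = 0")
    case False
    have "x / y \<in> V \<or> y / x \<in> V"
      using V_cases[of "x / y"] xy F by (simp add: subfield_closed)
    moreover have "x = (x / y) * y" "y = (y / x) * x" using False by auto
    ultimately show ?thesis unfolding le_def by blast
  qed (use le_0 in blast)
qed

lemma le_mult: "le x y \<Longrightarrow> le x' y' \<Longrightarrow> le (x * x') (y * y')"
proof -
  assume "le x y" "le x' y'"
  then obtain s t where "s \<in> V" "t \<in> V" "x = s * y" "x' = t * y'" by (auto simp: le_def)
  then show ?thesis unfolding le_def using V
    by (intro bexI[of _ "s * t"]) (auto simp: subring_mult)
qed

lemma le_add: "le x w \<Longrightarrow> le y w \<Longrightarrow> le (x + y) w"
  unfolding le_def using subring_add[OF V] by (metis distrib_right)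

lemma le_uminus: "le x w \<Longrightarrow> le (- x) w"
  unfolding le_def using subring_uminus[OF V] by (metis mult_minus_left)

lemma le_uminus_right: "le w x \<Longrightarrow> le w (- x)"
  unfolding le_def using subring_uminus[OF V] by (metis minus_mult_minus)

lemma le_diff: "le x w \<Longrightarrow> le y w \<Longrightarrow> le (x - y) w"
  using le_add[of x w "- y"] le_uminus by simp

lemma le_sum: "(\<And>i. i \<in> I \<Longrightarrow> le (f i) w) \<Longrightarrow> le (sum f I) w"
  by (induction I rule: infinite_finite_induct) (auto simp: le_0 le_add)

lemma le_prod: "(\<And>i. i \<in> I \<Longrightarrow> le (f i) (g i)) \<Longrightarrow> le (prod f I) (prod g I)"
  by (induction I rule: infinite_finite_induct) (auto simp: le_refl le_mult)

lemma le_power: "le x y \<Longrightarrow> le (x ^ n) (y ^ n)"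
  by (induction n) (auto simp: le_refl le_mult)

lemma le_cancel: "c \<noteq> 0 \<Longrightarrow> le (c * x) (c * y) \<longleftrightarrow> le x y"
  by (auto simp: le_def mult.left_commute)

lemma le_mult_V: "t \<in> V \<Longrightarrow> le (t * x) x"
  by (auto simp: le_def)

lemma le_divide: "y \<noteq> 0 \<Longrightarrow> le (x / y) w \<longleftrightarrow> le x (w * y)"
  using le_cancel[of y "x / y" w] by (simp add: mult.commute)

lemma le_divide_right: "y \<noteq> 0 \<Longrightarrow> le w (x / y) \<longleftrightarrow> le (w * y) x"
  using le_cancel[of y w "x / y"] by (simp add: mult.commute)

lemma lt_add:
  assumes "x \<in> F" "y \<in> F" "\<not> le w x" "\<not> le w y"
  shows "\<not> le w (x + y)"
  using le_total[OF assms(1,2)] le_add le_refl le_trans assms(3,4) by blast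

lemma lt_diff:
  assumes "x \<in> F" "y \<in> F" "\<not> le w x" "\<not> le w y"
  shows "\<not> le w (x - y)"
  using lt_add[of x "- y" w] assms F le_uminus_right[of w "- y"] by (auto simp: subfield_closed)

lemma lt_sum:
  assumes "w \<noteq> 0" "\<And>i. i \<in> I \<Longrightarrow> f i \<in> F \<and> \<not> le w (f i)"
  shows "\<not> le w (sum f I)"
proof -
  have "sum f I \<in> F \<and> \<not> le w (sum f I)"
    using assms(2) by (induction I rule: infinite_finite_induct)
      (use assms(1) F in \<open>auto simp: le_0_iff lt_add subfield_closed\<close>)
  then show ?thesis by blast
qed

lemma ex_max:
  assumes "finite I" "I \<noteq> {}" "\<And>i. i \<in> I \<Longrightarrow> e i \<in> F"
  shows "\<exists>i\<in>I. \<forall>j\<in>I. le (e j) (e i)"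
  using assms
proof (induction I rule: finite_ne_induct)
  case (insert i I)
  then obtain k where k: "k \<in> I" "\<forall>j\<in>I. le (e j) (e k)" by auto
  then show ?case using le_total[of "e i" "e k"] insert.prems le_refl le_trans by blast
qed (simp add: le_refl)

lemma max_ideal_iff: "x \<in> max_ideal V \<longleftrightarrow> x \<in> V \<and> \<not> le 1 x"
proof -
  have "le 1 x \<longleftrightarrow> x \<noteq> 0 \<and> inverse x \<in> V"
    unfolding le_def by (metis inverse_unique mult.commute mult_zero_right right_inverse zero_neq_one)
  then show ?thesis by (auto simp: max_ideal_def)
qed

lemma max_ideal_restrict:
  assumes "subfield K" "V \<inter> K = A"
  shows "x \<in> max_ideal A \<longleftrightarrow> x \<in> K \<and> x \<in> max_ideal V"
  using assms subfield_inverse[of K x] by (auto simp: max_ideal_def)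

text \<open>If \<open>x\<close> is not in \<open>V\<close>, its inverse is; dividing the equation by
  \<open>x ^ (n - 1)\<close> expresses \<open>x\<close> as a polynomial in that inverse.\<close>

lemma integrally_closed:
  assumes x: "x \<in> F" and f: "f \<in> poly_over V" "lead_coeff f = 1" "poly f x = 0"
  shows "x \<in> V"
proof (rule ccontr)
  assume nx: "x \<notin> V"
  define n where "n = degree f"
  have w: "inverse x \<in> V" "x \<noteq> 0" using V_cases[OF x] nx subring_0[OF V] by auto
  have "n \<noteq> 0"
  proof
    assume "n = 0"
    then have "f = 1" using f(2) by (metis degree_0_id n_def one_pCons)
    then show False using f by simp
  qed
  then obtain m where m: "n = Suc m" using not0_implies_Suc by blast
  have "0 = (\<Sum>i\<le>n. coeff f i * x ^ i)" using f(3) by (simp add: poly_altdef n_def)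
  also have "\<dots> = (\<Sum>i\<le>m. coeff f i * x ^ i) + x ^ n" using f(2) m by (simp add: n_def)
  finally have "x ^ n = - (\<Sum>i\<le>m. coeff f i * x ^ i)" by (simp add: eq_neg_iff_add_eq_0 add.commute)
  then have "x * x ^ m * inverse x ^ m = - (\<Sum>i\<le>m. coeff f i * x ^ i) * inverse x ^ m"
    by (simp add: m)
  also have "\<dots> = - (\<Sum>i\<le>m. coeff f i * inverse x ^ (m - i))"
  proof -
    have "x ^ i * inverse x ^ m = inverse x ^ (m - i)" if "i \<le> m" for i
    proof -
      have "inverse x ^ m = inverse x ^ i * inverse x ^ (m - i)" using that by (simp flip: power_add)
      then show ?thesis using w(2) by (simp add: field_simps)
    qed
    then show ?thesis by (simp add: sum_distrib_right mult.assoc)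
  qed
  also have "x * x ^ m * inverse x ^ m = x" using w(2) by (simp add: mult.assoc flip: power_mult_distrib)
  finally have "x = - (\<Sum>i\<le>m. coeff f i * inverse x ^ (m - i))" .
  moreover have "- (\<Sum>i\<le>m. coeff f i * inverse x ^ (m - i)) \<in> V"
    using f(1) w(1) by (intro subring_closed V) (auto simp: poly_over_def)
  ultimately show False using nx by simp
qed

lemma small_coeff_prod:
  assumes "finite I" "\<And>i. i \<in> I \<Longrightarrow> e i \<in> V \<and> \<not> le 1 (e i)" "k < card I"
  shows "\<not> le 1 (coeff (\<Prod>i\<in>I. [:- e i, 1:]) k)"
  using assms
proof (induction I arbitrary: k rule: finite_induct)
  case (insert i I)
  define f where "f = (\<Prod>i\<in>I. [:- e i, 1:])"
  have fV: "f \<in> poly_over V" unfolding f_def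
    using insert by (intro poly_over_prod poly_over_closed V subring_closed) auto
  have cV: "coeff f j \<in> V" for j using fV by (simp add: poly_over_def)
  have "le (- e i * coeff f k) (e i)" using cV[of k] le_mult_V[of "- coeff f k" "e i"]
    by (simp add: subring_closed V mult.commute)
  then have a: "\<not> le 1 (- e i * coeff f k)" using insert.prems le_trans by blast
  have b: "\<not> le 1 (coeff (pCons 0 f) k)"
  proof (cases k)
    case 0 then show ?thesis by (simp add: le_0_iff)
  next
    case (Suc j)
    then show ?thesis using insert.IH[of j] insert.prems insert.hyps by (simp add: f_def)
  qed
  have "(\<Prod>i\<in>insert i I. [:- e i, 1:]) = smult (- e i) f + pCons 0 f"
    using insert.hyps by (simp add: f_def)
  moreover have "- e i * coeff f k \<in> F" "coeff (pCons 0 f) k \<in> F"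
    using insert.prems cV VF V by (auto simp: coeff_pCons subring_closed split: nat.split)
  ultimately show ?case using lt_add[OF _ _ a b] by simp
qed simp

end

text \<open>Lets a Galois group act on its subsets of a given size in
  \<open>conj_le\<close>.\<close>

lemma bij_betw_subsets_card:
  assumes "finite G" "bij_betw g G G"
  shows "bij_betw (\<lambda>S. g ` S) {S. S \<subseteq> G \<and> card S = l} {S. S \<subseteq> G \<and> card S = l}"
proof -
  have inj: "inj_on (\<lambda>S. g ` S) {S. S \<subseteq> G \<and> card S = l}"
    using inj_on_image_Pow[OF bij_betw_imp_inj_on[OF assms(2)]] by (auto simp: inj_on_def)
  have "(\<lambda>S. g ` S) ` {S. S \<subseteq> G \<and> card S = l} \<subseteq> {S. S \<subseteq> G \<and> card S = l}"
    using assms(2) by (auto simp: bij_betw_def card_image inj_on_subset)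
  then show ?thesis using inj assms(1) by (simp add: bij_betw_def endo_inj_surj)
qed

locale henselian_galois = valued_field L V for L V :: "'a::field_char_0 set" +
  fixes F' A :: "'a set"
  assumes hens: "henselian F' A" and F'L: "F' \<subseteq> L" and VA: "V \<inter> F' = A"
    and fin: "finite (Gal F' L)"
    and fixed: "\<And>x. x \<in> L \<Longrightarrow> (\<And>\<rho>. \<rho> \<in> Gal F' L \<Longrightarrow> \<rho> x = x) \<Longrightarrow> x \<in> F'"
begin

lemma F': "subfield F'"
  using hens by (auto simp: henselian_def valuation_ring_def)

lemma max_ideal_A: "x \<in> max_ideal A \<longleftrightarrow> x \<in> F' \<and> x \<in> V \<and> \<not> le 1 x"
  using max_ideal_restrict[OF F' VA] max_ideal_iff by blast

text \<open>If the conjugates of \<open>x\<close> had different values, let \<open>U\<close> be the set of automorphisms \<open>\<tau>\<close> with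
  \<open>|\<tau> x|\<close> maximal. Among the products of \<open>card U\<close> conjugates, the one over \<open>U\<close> strictly dominates, so after
  division by the sum \<open>T\<close> of all of them it is a simple root modulo the maximal ideal and lies in \<open>F'\<close> by
  Hensel's lemma. Hence \<open>U\<close> is stable under left multiplication.\<close>

lemma conj_le:
  assumes x: "x \<in> L" and \<rho>: "\<rho> \<in> Gal F' L"
  shows "le (\<rho> x) x"
proof (cases "x = 0")
  case True
  then show ?thesis using hom_0[OF F GalD(1)[OF \<rho>]] by (simp add: le_refl)
next
  case x0: False
  define G where "G = Gal F' L"
  have finG: "finite G" using fin by (simp add: G_def)
  have GL: "\<tau> x \<in> L" "\<tau> x \<noteq> 0" if "\<tau> \<in> G" for \<tau>
    using that GalD[of \<tau> F' L] x x0 hom_eq_0_iff[OF F, of \<tau> x] by (auto simp: G_def)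
  have idG: "id \<in> G" by (simp add: G_def Gal_id)
  obtain \<tau>0 where t0: "\<tau>0 \<in> G" and mx: "\<And>\<tau>. \<tau> \<in> G \<Longrightarrow> le (\<tau> x) (\<tau>0 x)"
    using ex_max[OF finG, of "\<lambda>\<tau>. \<tau> x"] idG GL by blast
  define m where "m = \<tau>0 x"
  have m: "m \<in> L" "m \<noteq> 0" using GL t0 by (auto simp: m_def)
  define U where "U = {\<tau>\<in>G. le m (\<tau> x)}"
  define l where "l = card U"
  define SS where "SS = {S. S \<subseteq> G \<and> card S = l}"
  define pr where "pr S = (\<Prod>\<tau>\<in>S. \<tau> x)" for S :: "('a \<Rightarrow> 'a) set"
  have US: "U \<in> SS" by (auto simp: SS_def U_def l_def)
  have finS: "finite SS" unfolding SS_def using finG by simp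
  have finE: "finite S" if "S \<in> SS" for S using that finG finite_subset by (auto simp: SS_def)
  have ml: "m ^ l \<noteq> 0" "m ^ l \<in> L" using m F by (auto simp: subfield_closed)
  have pL: "pr S \<in> L" if "S \<in> SS" for S
    unfolding pr_def using that GL F by (intro subfield_closed) (auto simp: SS_def)
  have up: "le (pr S) (m ^ l)" if "S \<in> SS" for S
    using le_prod[of S "\<lambda>\<tau>. \<tau> x" "\<lambda>_. m"] mx that by (auto simp: SS_def pr_def m_def)
  have lowU: "le (m ^ l) (pr U)"
    using le_prod[of U "\<lambda>_. m" "\<lambda>\<tau>. \<tau> x"] by (auto simp: U_def pr_def l_def)
  \<comment> \<open>A set of the same size as \<open>U\<close> but different from it contains some
    \<open>\<tau>\<close> outside \<open>U\<close>, and the factor \<open>\<tau> x\<close> is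
    strictly below \<open>m\<close>.\<close>
  have low: "\<not> le (m ^ l) (pr S)" if S: "S \<in> SS" "S \<noteq> U" for S
  proof
    assume a: "le (m ^ l) (pr S)"
    have "\<not> S \<subseteq> U"
      using S card_subset_eq[of U S] finE[OF US] by (auto simp: SS_def l_def)
    then obtain \<tau> where \<tau>: "\<tau> \<in> S" "\<tau> \<notin> U" by blast
    have c: "card (S - {\<tau>}) = l - 1" "l > 0"
      using \<tau> S finE[OF S(1)] by (auto simp: SS_def card_gt_0_iff)
    have "le (pr (S - {\<tau>})) (m ^ (l - 1))"
      using le_prod[of "S - {\<tau>}" "\<lambda>\<tau>. \<tau> x" "\<lambda>_. m"] mx S c by (auto simp: SS_def pr_def m_def)
    moreover have "pr S = \<tau> x * pr (S - {\<tau>})"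
      using \<tau> finE[OF S(1)] by (simp add: pr_def prod.remove)
    ultimately have "le (m ^ l) (\<tau> x * m ^ (l - 1))" using a le_trans le_mult le_refl by metis
    then have "le (m ^ (l - 1) * m) (m ^ (l - 1) * \<tau> x)"
      using c by (simp add: mult.commute flip: power_Suc)
    then have "le m (\<tau> x)" using m by (simp add: le_cancel)
    then show False using \<tau> S by (auto simp: U_def SS_def)
  qed
  define rest where "rest = (\<Sum>S\<in>SS - {U}. pr S)"
  define T where "T = (\<Sum>S\<in>SS. pr S)"
  have T: "T = pr U + rest" using US finS by (simp add: T_def rest_def sum.remove)
  have restL: "rest \<in> L" unfolding rest_def using pL F by (intro subfield_closed) auto
  have rest: "\<not> le (m ^ l) rest"
    unfolding rest_def using low pL ml by (intro lt_sum) auto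
  have TL: "T \<in> L" unfolding T_def using pL F by (intro subfield_closed) auto
  have lowT: "le (m ^ l) T"
    using lt_diff[OF TL restL _ rest] lowU T by (metis add_diff_cancel_right')
  have T0: "T \<noteq> 0" using lowT ml by (auto simp: le_0_iff)
  have act: "\<sigma> (pr S) = pr ((\<lambda>\<tau>. \<sigma> \<circ> \<tau>) ` S) \<and> (\<lambda>\<tau>. \<sigma> \<circ> \<tau>) ` S \<in> SS" if "\<sigma> \<in> G" "S \<in> SS" for \<sigma> S
  proof -
    have bij: "bij_betw (\<lambda>\<tau>. \<sigma> \<circ> \<tau>) G G" unfolding G_def
      using that by (intro Gal_bij F F'L) (simp add: G_def)
    have SG: "S \<subseteq> G" using that by (simp add: SS_def)
    have "\<sigma> (pr S) = (\<Prod>\<tau>\<in>S. \<sigma> (\<tau> x))" unfolding pr_def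
      using that SG GL by (intro hom_prod[OF F GalD(1)[of \<sigma> F']]) (auto simp: G_def)
    also have "\<dots> = pr ((\<lambda>\<tau>. \<sigma> \<circ> \<tau>) ` S)" unfolding pr_def
      using bij SG by (subst prod.reindex) (auto simp: bij_betw_def intro: inj_on_subset)
    finally show ?thesis
      using bij_betwE[OF bij_betw_subsets_card[OF finG bij, of l]] that(2) by (auto simp: SS_def)
  qed
  have bijS: "bij_betw (\<lambda>S. (\<lambda>\<tau>. \<sigma> \<circ> \<tau>) ` S) SS SS" if "\<sigma> \<in> G" for \<sigma>
    unfolding SS_def using that unfolding G_def
    by (intro bij_betw_subsets_card fin Gal_bij F F'L)
  have fixT: "\<sigma> T = T" if s: "\<sigma> \<in> G" for \<sigma>
  proof -
    have "\<sigma> T = (\<Sum>S\<in>SS. \<sigma> (pr S))" unfolding T_def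
      using s pL by (intro hom_sum[OF F GalD(1)[of \<sigma> F']]) (auto simp: G_def)
    also have "\<dots> = (\<Sum>S\<in>SS. pr ((\<lambda>\<tau>. \<sigma> \<circ> \<tau>) ` S))" using act[OF s] by simp
    also have "\<dots> = T" unfolding T_def by (rule sum.reindex_bij_betw[OF bijS[OF s]])
    finally show ?thesis .
  qed
  have TF: "T \<in> F'" using fixed[OF TL] fixT by (simp add: G_def)
  \<comment> \<open>The sum \<open>T\<close> is invariant and has the value of \<open>pr U\<close>.
    So every \<open>e S\<close> is integral, \<open>e U\<close> is congruent to 1 and the others to
    0: this is why 1 is a simple root of \<open>Q\<close> modulo the maximal ideal.\<close>
  define e where "e S = pr S / T" for S
  have eL: "e S \<in> L" if "S \<in> SS" for S using pL[OF that] TL F by (simp add: e_def subfield_closed)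
  have eV: "e S \<in> V" if "S \<in> SS" for S
    using le_trans[OF up[OF that] lowT] T0 by (simp add: e_def le_divide flip: le_1_iff)
  define Q where "Q = (\<Prod>S\<in>SS. [:- e S, 1:])"
  define R where "R = (\<Prod>S\<in>SS - {U}. [:- e S, 1:])"
  have QV: "Q \<in> poly_over V" and RV: "R \<in> poly_over V"
    unfolding Q_def R_def using eV by (auto intro!: poly_over_prod poly_over_closed V subring_closed)
  have "\<sigma> (coeff Q i) = coeff Q i" if s: "\<sigma> \<in> G" for \<sigma> i
  proof -
    have "\<sigma> (e S) = e ((\<lambda>\<tau>. \<sigma> \<circ> \<tau>) ` S)" if "S \<in> SS" for S
      using hom_divide[OF F GalD(1)[of \<sigma> F'] pL[OF that] TL] act[OF s that] fixT[OF s] s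
      by (simp add: e_def G_def)
    then show ?thesis unfolding Q_def
      using s eL by (intro hom_fix_coeff_prod[OF F GalD(1)[of \<sigma> F'] _ bijS[OF s]]) (auto simp: G_def)
  qed
  then have "coeff Q i \<in> F'" for i
    using QV VF by (intro fixed) (auto simp: poly_over_def G_def)
  then have QA: "\<forall>i. coeff Q i \<in> A" using QV VA by (auto simp: poly_over_def)
  have small: "\<not> le 1 (e S)" if "S \<in> SS" "S \<noteq> U" for S
    using low[OF that] le_trans[OF lowT, of "pr S"] T0 by (auto simp: e_def le_divide_right)
  have U1: "\<not> le 1 (1 - e U)"
  proof -
    have "1 - e U = rest / T" using T0 by (simp add: e_def T field_simps)
    then show ?thesis using rest le_trans[OF lowT, of rest] T0 by (auto simp: le_divide_right)
  qed
  have U1V: "1 - e U \<in> V" using eV[OF US] V by (simp add: subring_closed)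
  have QR: "Q = [:- e U, 1:] * R" using US finS by (simp add: Q_def R_def prod.remove)
  have R1: "le 1 (poly R 1)"
  proof -
    have "le 1 (1 - e S)" if "S \<in> SS - {U}" for S
    proof (rule ccontr)
      assume "\<not> ?thesis"
      then have "\<not> le 1 ((1 - e S) + e S)" using small eL that F
        by (intro lt_add) (auto simp: subfield_closed)
      then show False by (simp add: le_refl)
    qed
    then have "le (\<Prod>S\<in>SS - {U}. 1) (\<Prod>S\<in>SS - {U}. 1 - e S)" by (intro le_prod) auto
    then show ?thesis by (simp add: R_def poly_prod)
  qed
  have RV1: "poly R 1 \<in> V" using RV V by (intro poly_over_poly) (auto simp: subring_closed)
  have RV2: "poly (pderiv R) 1 \<in> V"
    using RV V by (intro poly_over_poly) (auto simp: poly_over_def coeff_pderiv subring_closed simp del: of_nat_Suc)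
  have smallmult: "\<not> le 1 ((1 - e U) * t)" if "t \<in> V" for t
    using le_mult_V[OF that, of "1 - e U"] U1 le_trans by (metis mult.commute)
  have AF: "A = V \<inter> F'" using VA by simp
  have A: "subring A" using hens by (simp add: henselian_def valuation_ring_def)
  have Q1: "poly Q 1 = (1 - e U) * poly R 1" by (simp add: QR left_diff_distrib)
  have "poly Q 1 \<in> A" using QA A by (intro poly_over_poly) (auto simp: poly_over_def subring_closed)
  then have p1: "poly Q 1 \<in> max_ideal A"
    using smallmult[OF RV1] AF unfolding max_ideal_A Q1 by blast
  have "poly (pderiv Q) 1 = poly R 1 + (1 - e U) * poly (pderiv R) 1"
    unfolding QR pderiv_mult by (simp add: pderiv_pCons algebra_simps)
  then have "poly R 1 = poly (pderiv Q) 1 - (1 - e U) * poly (pderiv R) 1" by simp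
  then have "le 1 (poly (pderiv Q) 1)"
    using R1 smallmult[OF RV2] lt_diff[of "poly (pderiv Q) 1" "(1 - e U) * poly (pderiv R) 1" 1]
      U1V RV2 RV1 VF F
    by (metis \<open>poly (pderiv Q) 1 = poly R 1 + (1 - e U) * poly (pderiv R) 1\<close> subring_add subring_mult subsetD V)
  then have p2: "poly (pderiv Q) 1 \<notin> max_ideal A" by (simp add: max_ideal_A)
  have "lead_coeff Q = 1" by (simp add: Q_def lead_coeff_prod)
  moreover have "1 \<in> A" using A by (rule subring_1)
  ultimately obtain b where b: "b \<in> A" "poly Q b = 0" "b - 1 \<in> max_ideal A"
    using hens QA p1 p2 unfolding henselian_def by blast
  \<comment> \<open>The root found by Hensel's lemma is congruent to 1, which excludes all
    \<open>e S\<close> other than \<open>e U\<close>.\<close>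
  obtain S where S: "S \<in> SS" "b = e S" using b(2) finS by (auto simp: Q_def poly_prod)
  have "S = U"
  proof (rule ccontr)
    assume "S \<noteq> U"
    have "b - 1 \<in> L" "\<not> le 1 (b - 1)" using b(3) VF by (auto simp: max_ideal_A)
    then have "\<not> le 1 (e S - (b - 1))"
      using lt_diff[OF eL[OF S(1)], of "b - 1" 1] small[OF S(1)] \<open>S \<noteq> U\<close> by blast
    moreover have "e S - (b - 1) = 1" using S by simp
    ultimately show False using le_refl by metis
  qed
  then have "pr U = b * T" using S T0 by (simp add: e_def)
  then have prU: "pr U \<in> F'" using b TF F' AF by (simp add: subfield_closed)
  have stab: "(\<lambda>\<tau>. \<sigma> \<circ> \<tau>) ` U = U" if "\<sigma> \<in> G" for \<sigma>
  proof (rule ccontr)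
    assume "\<not> ?thesis"
    then have "\<not> le (m ^ l) (pr ((\<lambda>\<tau>. \<sigma> \<circ> \<tau>) ` U))" using low act[OF that US] by blast
    moreover have "\<sigma> (pr U) = pr U" using prU that GalD(4) by (metis G_def)
    ultimately show False using act[OF that US] lowU by simp
  qed
  obtain g where g: "g \<in> G" "g \<circ> \<tau>0 = id" using Gal_inverse[OF F F'L] t0 by (metis G_def)
  \<comment> \<open>Left multiplication by the inverse of \<open>\<tau>0\<close> keeps
    \<open>U\<close> and sends \<open>\<tau>0\<close> to \<open>id\<close>, so \<open>x\<close>
    itself has maximal absolute value.\<close>
  have "\<tau>0 \<in> U" using t0 by (simp add: U_def m_def le_refl)
  then have "id \<in> U" using stab[OF g(1)] g(2) by (metis imageI)
  then have "le m x" by (simp add: U_def)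
  then show ?thesis using mx[of \<rho>] \<rho> le_trans by (auto simp: m_def G_def)
qed

lemma conj_le':
  assumes x: "x \<in> L" and \<rho>: "\<rho> \<in> Gal F' L"
  shows "le x (\<rho> x)"
proof -
  obtain g where g: "g \<in> Gal F' L" "g \<circ> \<rho> = id" using Gal_inverse[OF F F'L \<rho>] by blast
  then have "le (g (\<rho> x)) (\<rho> x)" using conj_le GalD(3)[OF \<rho> x] by blast
  then show ?thesis using g by (metis comp_apply id_apply)
qed

lemma char_poly_F':
  assumes "x \<in> L"
  shows "coeff (\<Prod>\<rho>\<in>Gal F' L. [:- \<rho> x, 1:]) i \<in> F'"
proof (rule fixed)
  show "coeff (\<Prod>\<rho>\<in>Gal F' L. [:- \<rho> x, 1:]) i \<in> L"
  proof -
    have "(\<Prod>\<rho>\<in>Gal F' L. [:- \<rho> x, 1:]) \<in> poly_over L"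
      using assms GalD(3)[of _ F' L] F
      by (intro poly_over_prod poly_over_closed(1,7) subring_uminus subring_1 subfield_subring) auto
    then show ?thesis by (simp add: poly_over_def)
  qed
  fix \<sigma> assume s: "\<sigma> \<in> Gal F' L"
  show "\<sigma> (coeff (\<Prod>\<rho>\<in>Gal F' L. [:- \<rho> x, 1:]) i) = coeff (\<Prod>\<rho>\<in>Gal F' L. [:- \<rho> x, 1:]) i"
    using assms GalD(3)
    by (intro hom_fix_coeff_prod[OF F GalD(1)[OF s] _ Gal_bij[OF F F'L s]]) auto
qed

text \<open>Conjugates of an element of \<open>V\<close> lie in \<open>V\<close>, so elements of
  \<open>V \<inter> M\<close> are integral over \<open>A\<close>. Conversely, for \<open>x\<close>
  in \<open>W\<close> but not in \<open>V\<close>, the lower coefficients of the characteristic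
  polynomial of \<open>inverse x\<close> lie in the maximal ideal of \<open>A\<close>; multiplied by
  \<open>x ^ n\<close>, the equation puts 1 into the maximal ideal of \<open>W\<close>.\<close>

lemma valuation_ring_unique:
  assumes M: "F' \<subseteq> M" "M \<subseteq> L" and W: "valuation_ring M W" "W \<inter> F' = A"
  shows "W = V \<inter> M"
proof -
  interpret W: valued_field M W by unfold_locales (rule W)
  have root: "poly (\<Prod>\<rho>\<in>Gal F' L. [:- \<rho> x, 1:]) x = 0" for x
    using fin Gal_id by (force simp: poly_prod intro: bexI[of _ id])
  have monic: "lead_coeff (\<Prod>\<rho>\<in>Gal F' L. [:- \<rho> x, 1:]) = 1" for x
    by (simp add: lead_coeff_prod)
  have deg: "degree (\<Prod>\<rho>\<in>Gal F' L. [:- \<rho> x, 1:]) = card (Gal F' L)" for x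
    by (subst degree_prod_sum_eq) auto
  have poly_V: "(\<Prod>\<rho>\<in>Gal F' L. [:- \<rho> x, 1:]) \<in> poly_over V" if "x \<in> V" for x
  proof -
    have "\<rho> x \<in> V" if "\<rho> \<in> Gal F' L" for \<rho>
      using conj_le[OF _ that, of x] \<open>x \<in> V\<close> VF le_trans[of "\<rho> x" x 1] le_1_iff by blast
    then show ?thesis by (intro poly_over_prod poly_over_closed(1,7) subring_uminus subring_1 V) auto
  qed
  have poly_A: "coeff (\<Prod>\<rho>\<in>Gal F' L. [:- \<rho> x, 1:]) i \<in> A" if "x \<in> V" for x i
    using poly_V[OF that] char_poly_F'[of x i] that VF VA by (auto simp: poly_over_def)
  show ?thesis
  proof
    show "V \<inter> M \<subseteq> W"
    proof
      fix x assume x: "x \<in> V \<inter> M"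
      show "x \<in> W"
        using poly_A[of x] x W(2) root monic
        by (intro W.integrally_closed[of x "\<Prod>\<rho>\<in>Gal F' L. [:- \<rho> x, 1:]"]) (auto simp: poly_over_def)
    qed
    show "W \<subseteq> V \<inter> M"
    proof
      fix x assume x: "x \<in> W"
      then have xM: "x \<in> M" using W.VF by blast
      have "x \<in> V"
      proof (rule ccontr)
        assume nx: "x \<notin> V"
        define w where "w = inverse x"
        have w: "w \<in> V" "x \<noteq> 0" using V_cases[of x] nx xM M V by (auto simp: w_def subring_closed)
        have sw: "\<not> le 1 w"
        proof
          assume "le 1 w"
          then obtain t where "t \<in> V" "1 = t * w" by (auto simp: le_def)
          then show False using nx w(2) by (simp add: w_def field_simps)
        qed
        define f where "f = (\<Prod>\<rho>\<in>Gal F' L. [:- \<rho> w, 1:])"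
        define n where "n = card (Gal F' L)"
        have ci: "coeff f i \<in> A" for i using poly_A[OF w(1)] by (simp add: f_def)
        have small: "\<not> le 1 (coeff f i)" if "i < n" for i
          unfolding f_def
        proof (rule small_coeff_prod[OF fin _ that[unfolded n_def]])
          fix \<rho> assume r: "\<rho> \<in> Gal F' L"
          have "le (\<rho> w) w" using conj_le[OF _ r] w VF by blast
          then show "\<rho> w \<in> V \<and> \<not> le 1 (\<rho> w)" using sw w(1) le_trans le_1_iff by blast
        qed
        have smallW: "\<not> W.le 1 (coeff f i * x ^ (n - i))" if "i < n" for i
        proof
          assume a: "W.le 1 (coeff f i * x ^ (n - i))"
          have "x ^ (n - i) \<in> W" using x W.V by (simp add: subring_closed)
          then have "W.le 1 (coeff f i)" using a W.le_trans W.le_mult_V by (metis mult.commute)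
          then have "coeff f i \<notin> max_ideal W" by (simp add: W.max_ideal_iff)
          moreover have "coeff f i \<in> max_ideal A"
            using ci[of i] small[OF that] VA by (auto simp: max_ideal_A)
          ultimately show False using W.max_ideal_restrict[OF F' W(2)] by blast
        qed
        have "0 = (\<Sum>i\<le>n. coeff f i * w ^ i)"
          using root[of w] by (simp add: poly_altdef f_def n_def deg)
        also have "\<dots> = (\<Sum>i<n. coeff f i * w ^ i) + w ^ n"
          using monic[of w] by (simp add: deg f_def n_def flip: lessThan_Suc_atMost)
        finally have "0 = ((\<Sum>i<n. coeff f i * w ^ i) + w ^ n) * x ^ n" by simp
        also have "\<dots> = (\<Sum>i<n. coeff f i * x ^ (n - i)) + 1"
        proof -
          have "w ^ i * x ^ n = x ^ (n - i)" if "i \<le> n" for i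
          proof -
            have "x ^ n = x ^ i * x ^ (n - i)" using that by (simp flip: power_add)
            then show ?thesis using w(2) by (simp add: w_def field_simps)
          qed
          from this[of n] this show ?thesis by (simp add: distrib_right sum_distrib_right mult.assoc)
        qed
        finally have eq: "1 = - (\<Sum>i<n. coeff f i * x ^ (n - i))"
          by (simp add: eq_neg_iff_add_eq_0 add.commute)
        have "\<not> W.le 1 (\<Sum>i<n. coeff f i * x ^ (n - i))"
        proof (rule W.lt_sum)
          fix i assume "i \<in> {..<n}"
          moreover have "coeff f i \<in> M" using ci[of i] VA M by auto
          ultimately show "coeff f i * x ^ (n - i) \<in> M \<and> \<not> W.le 1 (coeff f i * x ^ (n - i))"
            using smallW xM W.F by (auto simp: subfield_closed)
        qed simp
        then show False using eq W.le_refl W.le_uminus_right by (metis minus_minus)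
      qed
      then show "x \<in> V \<inter> M" using xM by blast
    qed
  qed
qed

end

section \<open>Counting zeros in a ball\<close>

context valued_field
begin

text \<open>The top index of \<open>P(a + e X)\<close> is the number of zeros of \<open>P\<close>, in an algebraic closure, in the closed
  ball around \<open>a\<close> of radius \<open>|e|\<close>.\<close>

definition top_index :: "'a poly \<Rightarrow> nat \<Rightarrow> bool" where
  "top_index P k \<longleftrightarrow> coeff P k \<noteq> 0 \<and> (\<forall>j. le (coeff P j) (coeff P k)) \<and>
    (\<forall>j>k. \<not> le (coeff P k) (coeff P j))"

lemma top_index_unique: "top_index P k \<Longrightarrow> top_index P l \<Longrightarrow> k = l"
  unfolding top_index_def by (metis linorder_neqE_nat)

lemma top_index_exists:
  assumes P: "P \<in> poly_over F" "P \<noteq> 0"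
  shows "\<exists>k. top_index P k"
proof -
  obtain i where i: "\<And>j. j \<le> degree P \<Longrightarrow> le (coeff P j) (coeff P i)"
    using ex_max[of "{..degree P}" "coeff P"] P by (auto simp: poly_over_def)
  have i': "le (coeff P j) (coeff P i)" for j
    using i[of j] le_0 by (cases "j \<le> degree P") (auto simp: coeff_eq_0)
  have i0: "coeff P i \<noteq> 0" using i[of "degree P"] P by (auto simp: le_0_iff)
  define J where "J = {j. j \<le> degree P \<and> le (coeff P i) (coeff P j)}"
  have "i \<in> J" using i0 le_refl by (auto simp: J_def le_degree)
  then have M: "Max J \<in> J" by (intro Max_in) (auto simp: J_def)
  define k where "k = Max J"
  have k: "le (coeff P i) (coeff P k)" using M by (auto simp: k_def J_def)
  have "\<not> le (coeff P k) (coeff P j)" if "j > k" for j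
  proof
    assume "le (coeff P k) (coeff P j)"
    then have "le (coeff P i) (coeff P j)" using k le_trans by blast
    moreover have "j \<le> degree P" using calculation i0 by (auto intro!: le_degree simp: le_0_iff)
    ultimately have "j \<in> J" by (simp add: J_def)
    then have "j \<le> k" unfolding k_def by (intro Max_ge) (auto simp: J_def)
    then show False using that by simp
  qed
  moreover have "coeff P k \<noteq> 0" using k i0 by (auto simp: le_0_iff)
  ultimately show ?thesis using k i' le_trans unfolding top_index_def by blast
qed

text \<open>As in Gauss's lemma: in position \<open>k + l\<close> the product of the two top
  coefficients strictly dominates all other terms, and beyond it every term has a factor past its
  top index.\<close>

lemma top_index_mult:
  assumes P: "P \<in> poly_over F" "top_index P k" and Q: "Q \<in> poly_over F" "top_index Q l"
  shows "top_index (P * Q) (k + l)"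
proof -
  define M where "M = coeff P k * coeff Q l"
  have cF: "coeff P i \<in> F" "coeff Q i \<in> F" for i using P Q by (auto simp: poly_over_def)
  have M: "M \<noteq> 0" "M \<in> F" using P Q cF F by (auto simp: M_def top_index_def subfield_closed)
  have up: "le (coeff P i * coeff Q j) M" for i j
    unfolding M_def using P Q by (intro le_mult) (auto simp: top_index_def)
  have low: "\<not> le M (coeff P i * coeff Q j)" if "i > k \<or> j > l" for i j
  proof
    assume a: "le M (coeff P i * coeff Q j)"
    have nz: "coeff P k \<noteq> 0" "coeff Q l \<noteq> 0" using P Q by (auto simp: top_index_def)
    have "le (coeff P i * coeff Q j) (coeff P i * coeff Q l)" "le (coeff P i * coeff Q j) (coeff P k * coeff Q j)"
      using P Q le_refl by (auto intro!: le_mult simp: top_index_def)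
    then have "le (coeff Q l * coeff P k) (coeff Q l * coeff P i)" "le (coeff P k * coeff Q l) (coeff P k * coeff Q j)"
      using a le_trans unfolding M_def by (metis mult.commute)+
    then have "le (coeff P k) (coeff P i)" "le (coeff Q l) (coeff Q j)" using nz by (simp_all add: le_cancel)
    then show False using that P Q by (auto simp: top_index_def)
  qed
  define C where "C = coeff (P * Q) (k + l)"
  define R where "R = (\<Sum>i\<in>{..k + l} - {k}. coeff P i * coeff Q (k + l - i))"
  have C: "C = M + R" unfolding C_def R_def M_def coeff_mult by (subst sum.remove[of _ k]) auto
  have "\<not> le M R" unfolding R_def
  proof (rule lt_sum)
    fix i assume "i \<in> {..k + l} - {k}"
    then have "i > k \<or> k + l - i > l" by auto
    then show "coeff P i * coeff Q (k + l - i) \<in> F \<and> \<not> le M (coeff P i * coeff Q (k + l - i))"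
      using low cF F by (auto simp: subfield_closed)
  qed (rule M)
  moreover have "R \<in> F" unfolding R_def using cF F by (intro subfield_closed) auto
  moreover have "C \<in> F" using calculation M F by (simp add: C subfield_closed)
  moreover have "M = C - R" by (simp add: C)
  ultimately have MC: "le M C" using lt_diff[of C R M] le_refl by metis
  then have "C \<noteq> 0" using M by (auto simp: le_0_iff)
  moreover have "le (coeff (P * Q) j) C" for j
    unfolding coeff_mult using up MC le_trans by (intro le_sum) blast
  moreover have "\<not> le C (coeff (P * Q) j)" if "j > k + l" for j
  proof -
    have "\<not> le M (coeff (P * Q) j)" unfolding coeff_mult
    proof (rule lt_sum)
      fix i assume "i \<in> {..j}"
      then have "i > k \<or> j - i > l" using that by auto
      then show "coeff P i * coeff Q (j - i) \<in> F \<and> \<not> le M (coeff P i * coeff Q (j - i))"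
        using low cF F by (auto simp: subfield_closed)
    qed (rule M)
    then show ?thesis using MC le_trans by blast
  qed
  ultimately show ?thesis unfolding top_index_def C_def by blast
qed

lemma top_index_add_dominated:
  assumes P: "P \<in> poly_over F" "top_index P k" and Q: "Q \<in> poly_over F"
    and le: "\<And>j. le (coeff Q j) (coeff P k)" and lt: "\<And>j. j \<ge> k \<Longrightarrow> \<not> le (coeff P k) (coeff Q j)"
  shows "top_index (P + Q) k"
proof -
  define c where "c = coeff (P + Q) k"
  have cF: "coeff P i \<in> F" "coeff Q i \<in> F" for i using P Q by (auto simp: poly_over_def)
  have c: "le (coeff P k) c"
    using lt_diff[of c "coeff Q k" "coeff P k"] lt[of k] cF F le_refl[of "coeff P k"]
    by (auto simp: c_def subfield_closed)
  then have "c \<noteq> 0" using P by (auto simp: top_index_def le_0_iff)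
  moreover have "le (coeff (P + Q) j) c" for j
    using le_add[of "coeff P j" c "coeff Q j"] le[of j] c le_trans P by (simp add: top_index_def) blast
  moreover have "\<not> le c (coeff (P + Q) j)" if "j > k" for j
    using lt_add[OF cF(1)[of j] cF(2)[of j], of "coeff P k"] lt[of j] P that c le_trans
    by (simp add: top_index_def) blast
  ultimately show ?thesis unfolding top_index_def c_def by blast
qed

text \<open>The larger maximum wins. At a tie the larger index \<open>k\<close> does, because from
  there on the coefficients of \<open>Q\<close> are strictly below their maximum.\<close>

lemma top_index_add_less:
  assumes P: "P \<in> poly_over F" "top_index P k" and Q: "Q \<in> poly_over F" "top_index Q l" and kl: "l < k"
  shows "top_index (P + Q) k \<or> top_index (P + Q) l"
proof (cases "le (coeff Q l) (coeff P k)")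
  case True
  have "top_index (P + Q) k"
  proof (rule top_index_add_dominated[OF P Q(1)])
    show "le (coeff Q j) (coeff P k)" for j using True Q le_trans by (auto simp: top_index_def)
    show "\<not> le (coeff P k) (coeff Q j)" if "j \<ge> k" for j
      using True Q le_trans that kl unfolding top_index_def by (meson less_le_trans)
  qed
  then show ?thesis ..
next
  case False
  then have le: "le (coeff P k) (coeff Q l)" using le_total P Q by (auto simp: poly_over_def)
  have "top_index (Q + P) l"
  proof (rule top_index_add_dominated[OF Q P(1)])
    show "le (coeff P j) (coeff Q l)" for j using le P le_trans by (auto simp: top_index_def)
    show "\<not> le (coeff Q l) (coeff P j)" for j
      using False P le_trans unfolding top_index_def by blast
  qed
  then show ?thesis by (simp add: add.commute)
qed

lemma top_index_add:
  assumes "P \<in> poly_over F" "top_index P k" "Q \<in> poly_over F" "top_index Q l" "k \<noteq> l"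
  shows "top_index (P + Q) k \<or> top_index (P + Q) l"
  using assms top_index_add_less[of P k Q l] top_index_add_less[of Q l P k]
  by (metis add.commute linorder_neqE_nat)

lemma top_index_const: "c \<noteq> 0 \<Longrightarrow> top_index [:c:] 0"
  by (auto simp: top_index_def coeff_pCons le_refl le_0 le_0_iff split: nat.split)

lemma top_index_linear: "d \<noteq> 0 \<Longrightarrow> le c d \<Longrightarrow> top_index [:c, d:] 1"
  by (auto simp: top_index_def coeff_pCons le_refl le_0 le_0_iff split: nat.split)

text \<open>The zero of the polynomial, if any, lies outside the unit ball.\<close>

lemma top_index_linear_0:
  assumes "c \<in> F" "d \<in> F" "\<not> le d c"
  shows "top_index [:d, c:] 0"
proof -
  have "d \<noteq> 0" "le c d" using assms le_0 le_total by blast+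
  then show ?thesis using assms
    by (auto simp: top_index_def coeff_pCons le_refl le_0 le_0_iff split: nat.split)
qed

lemma top_index_prod:
  assumes "finite I" "\<And>i. i \<in> I \<Longrightarrow> f i \<in> poly_over F" "\<And>i. i \<in> I \<Longrightarrow> top_index (f i) 1"
  shows "top_index (prod f I) (card I)"
  using assms
proof (induction I rule: finite_induct)
  case empty
  then show ?case using top_index_const[of 1] by (simp add: one_pCons)
next
  case (insert i I)
  then have "top_index (f i * prod f I) (1 + card I)"
    by (intro top_index_mult poly_over_prod subfield_subring F) auto
  then show ?case using insert by simp
qed

lemma top_index_le_degree: "top_index P k \<Longrightarrow> k \<le> degree P"
  by (auto simp: top_index_def intro: le_degree)

text \<open>Substituting \<open>[:a, e:]\<close> turns the ball into the unit ball.
  \<open>P0\<close> will be the polynomial of the Kummer generator, whose \<open>p\<close> zeros are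
  all in the ball.\<close>

lemma top_index_zero_of_degree_less:
  assumes K: "subfield K" "K \<subseteq> F" and a: "a \<in> F" and e: "e \<in> F" "e \<noteq> 0"
    and far: "\<And>c. c \<in> K \<Longrightarrow> \<not> le (a - c) e"
    and p: "prime p" and P0: "P0 \<in> poly_over K" "degree P0 = p" "top_index (pcompose P0 [:a, e:]) p"
    and f: "f \<in> poly_over K" "f \<noteq> 0" "degree f < p"
  shows "top_index (pcompose f [:a, e:]) 0"
proof (rule ccontr)
  define C where "C f = pcompose f [:a, e:]" for f
  define bad where "bad f \<longleftrightarrow> f \<in> poly_over K \<and> f \<noteq> 0 \<and> degree f < p \<and> \<not> top_index (C f) 0" for f
  have CF: "C f \<in> poly_over F" if "f \<in> poly_over K" for f
    unfolding C_def using that K a e poly_over_mono[OF K(2)] subfield_subring[OF F]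
    by (intro poly_over_pcompose poly_over_closed(1,7)) auto
  assume "\<not> top_index (pcompose f [:a, e:]) 0"
  then have "bad f" using f by (simp add: bad_def C_def)
  then obtain g where g: "bad g" and min: "\<And>h. bad h \<Longrightarrow> degree g \<le> degree h"
    using ex_has_least_nat[of bad f degree] by blast
  define n where "n = degree g"
  have gK: "g \<in> poly_over K" "g \<noteq> 0" "n < p" "\<not> top_index (C g) 0" using g by (auto simp: bad_def n_def)
  have small: "top_index (C h) 0" if "h \<in> poly_over K" "h \<noteq> 0" "degree h < n" for h
    using min[of h] that gK by (auto simp: bad_def n_def)
  have C0: "C h = 0 \<longleftrightarrow> h = 0" for h
    unfolding C_def by (subst pcompose_eq_0_iff) (use e in auto)
  obtain D where D: "top_index (C g) D" using top_index_exists[OF CF[OF gK(1)]] C0 gK by blast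
  have D0: "D > 0" using D gK by (cases D) auto
  have "degree (C g) = n" unfolding C_def n_def using e by (simp add: degree_pcompose)
  then have Dn: "D \<le> n" using top_index_le_degree[OF D] by simp
  \<comment> \<open>The zero of a linear \<open>g\<close> is in \<open>K\<close> and hence outside
    the ball by \<open>far\<close>.\<close>
  have n1: "n \<noteq> 1"
  proof
    assume "n = 1"
    then obtain g0 g1 where gg: "g = [:g0, g1:]" "g1 \<noteq> 0"
      by (metis degree1_coeffs n_def)
    then have gi: "g0 \<in> K" "g1 \<in> K" using gK(1) poly_over_tail by blast+
    define c where "c = - g0 / g1"
    have "\<not> le (a - c) e" using gi K by (intro far) (simp add: c_def subfield_closed)
    moreover have "g0 + a * g1 = g1 * (a - c)" using gg by (simp add: c_def field_simps)
    ultimately have "\<not> le (g0 + a * g1) (e * g1)" using gg(2) by (simp add: le_cancel mult.commute[of e])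
    moreover have "C g = [:g0 + a * g1, e * g1:]" by (simp add: C_def gg pcompose_pCons)
    moreover have "g0 + a * g1 \<in> F" "e * g1 \<in> F"
      using gi K(2) a e F by (auto intro!: subfield_closed)
    ultimately have "top_index (C g) 0" using top_index_linear_0 by simp
    then show False using gK by simp
  qed
  \<comment> \<open>By minimality the remainder has index 0. Adding it to \<open>Q * g\<close> keeps
    the index or drops it to 0, and the latter is the case \<open>j = 0\<close> of the
    claim.\<close>
  have key: "\<exists>j. top_index (C P) (j * D) \<and> j * n \<le> degree P" if "P \<in> poly_over K" "P \<noteq> 0" for P
    using that
  proof (induction "degree P" arbitrary: P rule: less_induct)
    case less
    obtain Q r where Q: "Q \<in> poly_over K" "r \<in> poly_over K" "P = Q * g + r" "r = 0 \<or> degree r < n"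
      using poly_over_division[OF K(1) less.prems(1) gK(1,2)] by (auto simp: n_def)
    show ?case
    proof (cases "Q = 0")
      case True
      then have "top_index (C P) 0" using small[OF less.prems] Q less.prems by auto
      then show ?thesis by (intro exI[of _ 0]) auto
    next
      case False
      have d1: "degree (Q * g) = degree Q + n" using False gK by (simp add: degree_mult_eq n_def)
      have dP: "degree P = degree Q + n"
        using Q(3,4) d1 by (cases "r = 0") (auto simp: degree_add_eq_left)
      obtain j where j: "top_index (C Q) (j * D)" "j * n \<le> degree Q"
        using less.hyps[of Q] dP D0 Dn Q(1) False by auto
      have t: "top_index (C (Q * g)) (Suc j * D)"
        using top_index_mult[OF CF[OF Q(1)] j(1) CF[OF gK(1)] D]
        by (simp add: C_def pcompose_mult add.commute)
      have jn: "Suc j * n \<le> degree P" using j dP by simp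
      show ?thesis
      proof (cases "r = 0")
        case True
        then show ?thesis using t jn Q by (intro exI[of _ "Suc j"]) auto
      next
        case False
        then have "top_index (C r) 0" using small Q by blast
        moreover have "C P = C (Q * g) + C r" by (simp add: Q C_def pcompose_add)
        ultimately have "top_index (C P) (Suc j * D) \<or> top_index (C P) 0"
          using top_index_add[OF CF t CF[OF Q(2)], of 0] Q gK D0 K
          by (simp add: poly_over_closed subfield_subring)
        then show ?thesis using jn by (metis mult_zero_left zero_le)
      qed
    qed
  qed
  have "P0 \<noteq> 0" using P0 p by auto
  then obtain j where j: "top_index (C P0) (j * D)" "j * n \<le> p" using key[OF P0(1)] P0(2) by auto
  then have "p = j * D" using top_index_unique P0(3) by (auto simp: C_def)
  \<comment> \<open>The first case contradicts \<open>D \<le> n < p\<close>; the second gives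
    \<open>n \<le> 1\<close>, the linear case.\<close>
  then consider "j = 1" "D = p" | "j = p" "D = 1"
    using p by (metis prime_product mult.right_neutral mult_1 nat_mult_eq_1_iff prime_nat_iff dvd_triv_left
        mult_cancel_left mult_eq_self_implies_10)
  then show False
  proof cases
    case 1 then show ?thesis using Dn gK by simp
  next
    case 2
    then have "n \<le> 1" using j p by (cases n) (auto simp: prime_gt_0_nat)
    then show ?thesis using n1 D0 Dn by simp
  qed
qed

end

section \<open>Kummer generators\<close>

locale cyclic_galois = cyclotomic_galois K' L' p \<zeta> K L
  for K' L' :: "'a::field_char_0 set" and p \<zeta> K L +
  fixes \<sigma> :: "'a \<Rightarrow> 'a"
  assumes sigma: "\<sigma> \<in> Gal K L" and Gal_cyclic: "Gal K L = {\<sigma> ^^ k | k. True}"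
begin

lemma sigma': "\<sigma> \<in> Gal K' L"
  using sigma Gal_mono[OF K'K] by blast

lemmas s_hom = GalD(1)[OF sigma] and s_K = GalD(4)[OF sigma] and s_L = GalD(3)[OF sigma]
lemmas s_hom_simps = hom_add[OF L s_hom] hom_mult[OF L s_hom] hom_1[OF L s_hom] hom_0[OF L s_hom]
  hom_diff[OF L s_hom] hom_uminus[OF L s_hom] hom_inverse[OF L s_hom] hom_divide[OF L s_hom]
  hom_power[OF L s_hom]

lemma s_L': "x \<in> L' \<Longrightarrow> \<sigma> x \<in> L'"
  using Gal_L'_closed[OF sigma'] .

text \<open>If \<open>\<sigma>\<close> fixed \<open>L'\<close>, so would all its powers; but a
  nontrivial automorphism of \<open>L'\<close> extends to one of them.\<close>

lemma sigma_nontrivial: "\<exists>y\<in>L'. \<sigma> y \<noteq> y"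
proof (rule ccontr)
  assume a: "\<not> ?thesis"
  obtain \<tau> y where t: "\<tau> \<in> Gal K' L'" "y \<in> L'" "\<tau> y \<noteq> y" using ex_nontrivial by blast
  obtain \<rho> where r: "\<rho> \<in> Gal K L" "\<forall>x\<in>L'. \<rho> x = \<tau> x" using extend_to_L[OF t(1)] by blast
  then obtain k where "\<rho> = \<sigma> ^^ k" using Gal_cyclic by auto
  moreover have "(\<sigma> ^^ k) y = y" using a t by (induction k) auto
  ultimately show False using t r by auto
qed

text \<open>Through \<open>s'\<close>, the results on prime degree apply to \<open>\<sigma>\<close>;
  the identity off \<open>L'\<close> is what \<open>Gal K' L'\<close> demands.\<close>

definition s' :: "'a \<Rightarrow> 'a" where "s' x = (if x \<in> L' then \<sigma> x else x)"

lemma s'_Gal: "s' \<in> Gal K' L'"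
proof (rule GalI)
  show "hom_on L' s'"
    unfolding hom_on_def s'_def using subsetD[OF L'L] L'
    by (auto simp: subfield_closed s_hom_simps)
  obtain g where g: "g \<in> Gal K' L" "\<sigma> \<circ> g = id"
    using Gal_inverse[OF L _ sigma'] K'K KL by blast
  have "s' ` L' = L'"
  proof
    show "s' ` L' \<subseteq> L'" using s_L' by (auto simp: s'_def)
    show "L' \<subseteq> s' ` L'"
    proof
      fix x assume "x \<in> L'"
      then have "g x \<in> L'" "x = s' (g x)"
        using Gal_L'_closed[OF g(1)] g(2) by (auto simp: s'_def pointfree_idE)
      then show "x \<in> s' ` L'" by blast
    qed
  qed
  moreover have "inj_on s' L'"
    using hom_inj[OF L s_hom] L'L by (auto simp: s'_def inj_on_def)
  ultimately show "bij_betw s' L' L'" by (simp add: bij_betw_def)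
  show "\<And>x. x \<in> K' \<Longrightarrow> s' x = x" using s_K K'K by (auto simp: s'_def)
qed (simp add: s'_def)

lemma sigma_fixed_L': "x \<in> L' \<Longrightarrow> \<sigma> x = x \<Longrightarrow> x \<in> K'"
  using sigma_nontrivial fixed_mem[OF s'_Gal] by (auto simp: s'_def)

lemma sigma_pow_p: "x \<in> L' \<Longrightarrow> (\<sigma> ^^ p) x = x"
proof -
  assume x: "x \<in> L'"
  have "(\<sigma> ^^ k) x = (s' ^^ k) x \<and> (s' ^^ k) x \<in> L'" for k
    by (induction k) (use x s_L' in \<open>auto simp: s'_def\<close>)
  then show ?thesis using Gal_pow_p[OF s'_Gal] by simp
qed

text \<open>The coordinates of \<open>x\<close> over \<open>L'\<close> in powers of
  \<open>\<zeta>\<close> below \<open>degree q\<close> are unique and \<open>\<sigma>\<close> fixes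
  \<open>\<zeta>\<close>, so it fixes each coordinate.\<close>

lemma sigma_fixed:
  assumes x: "x \<in> L" "\<sigma> x = x"
  shows "x \<in> K"
proof -
  obtain f0 where "f0 \<in> poly_over L'" "x = poly f0 \<zeta>" using x by (auto simp: L_poly)
  then obtain f where f: "f \<in> poly_over L'" "degree f < degree q" "x = poly f \<zeta>"
    using poly_reduce[OF L' q_L' refl q(2,3)] by metis
  have fL: "f \<in> poly_over L" using f poly_over_mono[OF L'L] by blast
  define g where "g = map_poly \<sigma> f - f"
  have g: "g \<in> poly_over L'"
    using f s_L' L' by (auto simp: g_def poly_over_def coeff_map_hom[OF L s_hom] subfield_closed)
  have "poly g \<zeta> = 0"
    using hom_poly[OF L s_hom fL zL] x f s_K[OF zK] by (simp add: g_def)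
  then obtain h where h: "h \<in> poly_over L'" "g = q * h" using q(4)[OF g] by blast
  have "degree g < degree q"
    unfolding g_def using f map_poly_degree_leq[of \<sigma> f]
    by (intro le_less_trans[OF degree_diff_le_max]) (auto simp: hom_0[OF L s_hom])
  moreover have "q \<noteq> 0" using q(2) by auto
  ultimately have "h = 0" using h by (cases "h = 0") (auto simp: degree_mult_eq)
  then have "map_poly \<sigma> f = f" using h by (simp add: g_def)
  then have "\<sigma> (coeff f i) = coeff f i" for i by (metis coeff_map_hom[OF L s_hom])
  then have "f \<in> poly_over K" using f sigma_fixed_L' K'K by (auto simp: poly_over_def)
  then show ?thesis using f zK K by (auto intro: poly_over_poly subfield_subring)
qed

text \<open>On \<open>L'\<close> the map \<open>l\<close> is trivial, and on \<open>\<zeta>\<close>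
  and its powers \<open>\<sigma>\<close> is; these generate \<open>L\<close>.\<close>

lemma sigma_comm:
  assumes l: "l \<in> Gal L' L" and x: "x \<in> L"
  shows "\<sigma> (l x) = l (\<sigma> x)"
proof -
  have l': "l \<in> Gal K' L" using l Gal_mono[OF K'L'] by blast
  have "(\<sigma> \<circ> l) x = (l \<circ> \<sigma>) x"
  proof (rule hom_eq_on_L[OF GalD(1)[OF Gal_comp[OF sigma' l']] GalD(1)[OF Gal_comp[OF l' sigma']] _ _ x])
    show "(\<sigma> \<circ> l) y = (l \<circ> \<sigma>) y" if "y \<in> L'" for y using that GalD(4)[OF l] s_L' by simp
    have "l \<zeta> \<in> K" using root_of_unity_power[OF p z Gal_zeta[OF l']] zK K by (auto simp: subfield_closed)
    then show "(\<sigma> \<circ> l) \<zeta> = (l \<circ> \<sigma>) \<zeta>" using s_K zK by simp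
  qed
  then show ?thesis by simp
qed

text \<open>Expand in powers of \<open>\<zeta>\<close> over \<open>L'\<close>, then every
  coefficient in powers of \<open>y\<close> over \<open>K'\<close>, and exchange the sums.\<close>

lemma L_span:
  assumes "y \<in> L'" "\<sigma> y \<noteq> y" "x \<in> L"
  shows "\<exists>c. (\<forall>j<p. c j \<in> K) \<and> x = (\<Sum>j<p. c j * y ^ j)"
proof -
  have y: "s' y \<noteq> y" using assms by (simp add: s'_def)
  obtain f where f: "f \<in> poly_over L'" "degree f < p - 1" "x = poly f \<zeta>"
    using assms(3) unfolding L_poly' by blast
  have "\<exists>g. g \<in> poly_over K' \<and> degree g < p \<and> coeff f i = poly g y" for i
    using power_basis[OF s'_Gal assms(1) y, of "coeff f i"] f(1) by (auto simp: poly_over_def)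
  then obtain g where g: "\<And>i. g i \<in> poly_over K'" "\<And>i. degree (g i) < p" "\<And>i. coeff f i = poly (g i) y"
    by metis
  have "x = (\<Sum>i<p - 1. (\<Sum>j<p. coeff (g i) j * y ^ j) * \<zeta> ^ i)"
    unfolding f(3) poly_sum_degree_less[OF f(2)] g(3) using poly_sum_degree_less[OF g(2)] by simp
  also have "\<dots> = (\<Sum>j<p. (\<Sum>i<p - 1. coeff (g i) j * \<zeta> ^ i) * y ^ j)"
    unfolding sum_distrib_right by (subst sum.swap) (simp add: mult_ac)
  finally show ?thesis using g(1) zK K K'K
    by (intro exI[of _ "\<lambda>j. \<Sum>i<p - 1. coeff (g i) j * \<zeta> ^ i"])
      (auto simp: poly_over_def subset_iff intro!: subfield_closed)
qed

lemma root_of_unity_K: "\<omega> ^ p = 1 \<Longrightarrow> \<omega> \<in> K"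
  using root_of_unity_power[OF p z, of \<omega>] zK K by (auto simp: subfield_closed)

context
  fixes e \<omega> assumes e: "e \<in> L" "e \<noteq> 0" "\<sigma> e = \<omega> * e" and w: "\<omega> ^ p = 1" "\<omega> \<noteq> 1"
begin

lemma kummer_power: "e ^ p \<in> K"
  using e w L KL root_of_unity_K[OF w(1)]
  by (intro sigma_fixed) (auto simp: s_hom_simps subfield_closed power_mult_distrib)

text \<open>The conjugates \<open>\<omega> ^ k * e\<close> are distinct, so the first
  \<open>p\<close> powers of \<open>e\<close> are independent over \<open>K\<close>;
  \<open>L_span\<close> bounds the dimension.\<close>

lemma kummer_basis:
  assumes "x \<in> L"
  shows "\<exists>f\<in>poly_over K. degree f < p \<and> x = poly f e"
proof -
  obtain y where y: "y \<in> L'" "\<sigma> y \<noteq> y" using sigma_nontrivial by blast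
  have wL: "\<omega> \<in> L" using root_of_unity_K[OF w(1)] KL by blast
  have pow: "(\<sigma> ^^ k) e = \<omega> ^ k * e" for k
    by (induction k) (use e wL L s_K[OF root_of_unity_K[OF w(1)]] in
        \<open>auto simp: s_hom_simps subfield_closed\<close>)
  have "inj_on (\<lambda>k. (\<sigma> ^^ k) e) {..<p}"
    using e w pow p by (intro inj_on_prime_orbit) auto
  from poly_fixed_zero[OF L s_hom s_L e(1) this] KL s_K
  have "g = 0" if "g \<in> poly_over K" "degree g < p" "poly g e = 0" for g
    using that by (auto simp: poly_over_def subset_iff)
  from spanning_of_independent[OF K L p_gt_0 L_span[OF y] e(1) this assms] show ?thesis by blast
qed

lemma kummer_gen: "gen_field (K \<union> {x. x ^ p = e ^ p}) = L"
proof
  show "gen_field (K \<union> {x. x ^ p = e ^ p}) \<subseteq> L"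
  proof (rule gen_field_least[OF L])
    have "x \<in> L" if "x ^ p = e ^ p" for x
    proof -
      have "(x / e) ^ p = 1" using that e by (simp add: power_divide)
      then have "x / e \<in> L" using root_of_unity_K KL by blast
      then have "x / e * e \<in> L" using e subring_mult[OF subfield_subring[OF L]] by blast
      then show ?thesis using e by simp
    qed
    then show "K \<union> {x. x ^ p = e ^ p} \<subseteq> L" using KL by auto
  qed
  show "L \<subseteq> gen_field (K \<union> {x. x ^ p = e ^ p})"
  proof
    fix x assume "x \<in> L"
    then obtain f where f: "f \<in> poly_over K" "x = poly f e" using kummer_basis by blast
    have "K \<union> {x. x ^ p = e ^ p} \<subseteq> gen_field (K \<union> {x. x ^ p = e ^ p})"
      by (rule gen_field_superset)
    then have "f \<in> poly_over (gen_field (K \<union> {x. x ^ p = e ^ p}))"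
      "e \<in> gen_field (K \<union> {x. x ^ p = e ^ p})"
      using f by (auto simp: poly_over_def)
    then show "x \<in> gen_field (K \<union> {x. x ^ p = e ^ p})"
      using f by (auto intro!: poly_over_poly subfield_subring subfield_gen_field)
  qed
qed

end

text \<open>If \<open>\<sigma>\<close> fixed all \<open>p\<close>-th roots of \<open>h\<close>, they
  would generate only \<open>K\<close>. For a root \<open>a\<close> that is moved,
  \<open>\<sigma> a / a\<close> is the required \<open>\<omega>\<close>.\<close>

lemma kummer_root:
  assumes h: "h \<in> K" "gen_field (K \<union> {x. x ^ p = h}) = L"
  obtains a \<omega> where "a \<in> L" "a \<noteq> 0" "a ^ p = h" "\<sigma> a = \<omega> * a" "\<omega> ^ p = 1" "\<omega> \<noteq> 1"
proof -
  have sub: "{x. x ^ p = h} \<subseteq> L" using gen_field_superset[of "K \<union> {x. x ^ p = h}"] unfolding h(2) by simp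
  have "\<exists>a. a ^ p = h \<and> \<sigma> a \<noteq> a"
  proof (rule ccontr)
    assume "\<not> ?thesis"
    then have "{x. x ^ p = h} \<subseteq> K" using sub sigma_fixed by auto
    then have "L \<subseteq> K" using gen_field_least[OF K, of "K \<union> {x. x ^ p = h}"] h(2) by auto
    then show False using sigma_nontrivial s_K L'L by blast
  qed
  then obtain a where a: "a ^ p = h" "\<sigma> a \<noteq> a" by blast
  have aL: "a \<in> L" using a sub by auto
  have a0: "a \<noteq> 0" using a s_hom_simps by auto
  have "\<sigma> a ^ p = h" using a s_K[OF h(1)] s_hom_simps(9)[OF aL] by metis
  moreover have "h \<noteq> 0" using a(1) a0 by force
  ultimately have "(\<sigma> a / a) ^ p = 1" using a by (simp add: power_divide)
  then show ?thesis using that[of a "\<sigma> a / a"] a a0 aL by auto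
qed

text \<open>The \<open>R j\<close> are Lagrange resolvents: eigenvectors of \<open>\<sigma>\<close>
  with sum \<open>p\<close> times \<open>y\<close>. If all with \<open>0 < j < p\<close> vanished,
  \<open>R 0\<close> would be that multiple of \<open>y\<close>, but it is fixed by
  \<open>\<sigma>\<close>.\<close>

lemma ex_kummer:
  obtains a \<omega> where "a \<in> L" "a \<noteq> 0" "\<sigma> a = \<omega> * a" "\<omega> ^ p = 1" "\<omega> \<noteq> 1"
proof -
  obtain y where y: "y \<in> L'" "\<sigma> y \<noteq> y" using sigma_nontrivial by blast
  define R where "R j = (\<Sum>i<p. \<zeta> ^ (j * i) * (\<sigma> ^^ i) y)" for j
  have syL: "(\<sigma> ^^ i) y \<in> L" for i by (induction i) (use y L'L s_L in auto)
  have zc: "\<zeta> ^ i \<in> K" for i using zK K by (simp add: subfield_closed)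
  have tm: "\<zeta> ^ i * (\<sigma> ^^ k) y \<in> L" for i k
    using syL zc KL by (intro subring_mult subfield_subring[OF L]) blast+
  have RL: "R j \<in> L" for j unfolding R_def by (rule subring_sum[OF subfield_subring[OF L] tm])
  have eig: "\<zeta> ^ j * \<sigma> (R j) = R j" for j
  proof -
    define t where "t i = \<zeta> ^ (j * i) * (\<sigma> ^^ i) y" for i
    have "\<sigma> (R j) = (\<Sum>i<p. \<sigma> (\<zeta> ^ (j * i) * (\<sigma> ^^ i) y))"
      unfolding R_def by (rule hom_sum[OF L s_hom tm])
    also have "\<dots> = (\<Sum>i<p. \<zeta> ^ (j * i) * (\<sigma> ^^ Suc i) y)"
      using syL zc KL s_K by (intro sum.cong) (auto simp: s_hom_simps subset_iff)
    finally have "\<zeta> ^ j * \<sigma> (R j) = (\<Sum>i<p. t (Suc i))"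
      by (simp add: t_def sum_distrib_left power_add mult.assoc)
    also have "\<dots> = (\<Sum>i<p. t i) + t p - t 0"
      using sum.lessThan_Suc_shift[of t p] by (simp add: algebra_simps)
    also have "t p = t 0" using sigma_pow_p[OF y(1)] z by (simp add: t_def mult.commute[of j] power_mult)
    finally show ?thesis by (simp add: R_def t_def)
  qed
  have "\<exists>j. 0 < j \<and> j < p \<and> R j \<noteq> 0"
  proof (rule ccontr)
    assume "\<not> ?thesis"
    then have "(\<Sum>j\<in>{..<p} - {0}. R j) = 0" by (intro sum.neutral) auto
    then have "R 0 = (\<Sum>j<p. R j)" using p_gt_0 by (subst sum.remove[of _ 0]) auto
    also have "\<dots> = (\<Sum>i<p. (\<Sum>j<p. (\<zeta> ^ i) ^ j) * (\<sigma> ^^ i) y)"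
      unfolding R_def sum_distrib_right by (subst sum.swap) (simp add: mult.commute flip: power_mult)
    also have "\<dots> = (\<Sum>i<p. if i = 0 then of_nat p * y else 0)"
    proof (rule sum.cong[OF refl])
      fix i assume i: "i \<in> {..<p}"
      have "(\<Sum>j<p. (\<zeta> ^ i) ^ j) = 0" if "i \<noteq> 0"
      proof -
        have "\<zeta> ^ i \<noteq> \<zeta> ^ 0" using inj_onD[OF root_of_unity_inj[OF p z], of i 0] i that p_gt_0 by auto
        moreover have "(\<zeta> ^ i) ^ p = 1" using z by (metis mult.commute power_mult power_one)
        then have "(\<zeta> ^ i - 1) * (\<Sum>j<p. (\<zeta> ^ i) ^ j) = 0" by (simp flip: power_diff_1_eq)
        ultimately show ?thesis by simp
      qed
      then show "(\<Sum>j<p. (\<zeta> ^ i) ^ j) * (\<sigma> ^^ i) y = (if i = 0 then of_nat p * y else 0)" by simp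
    qed
    also have "\<dots> = of_nat p * y" using p_gt_0 by (simp add: sum.delta)
    finally have R0: "R 0 = of_nat p * y" .
    have "\<sigma> (of_nat p * y) = of_nat p * y" using eig[of 0] R0 by simp
    moreover have "\<sigma> (of_nat p * y) = of_nat p * \<sigma> y"
      using s_K[of "of_nat p"] K y L'L KL by (subst s_hom_simps) (auto simp: subfield_closed)
    ultimately show False using y p_gt_0 by simp
  qed
  then obtain j where j: "0 < j" "j < p" "R j \<noteq> 0" by blast
  have "\<zeta> \<noteq> 0" using z p_gt_0 by (auto simp: zero_power)
  show ?thesis
  proof (rule that[of "R j" "inverse (\<zeta> ^ j)"])
    show "\<sigma> (R j) = inverse (\<zeta> ^ j) * R j" using eig[of j] \<open>\<zeta> \<noteq> 0\<close> by (simp add: field_simps)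
    show "inverse (\<zeta> ^ j) ^ p = 1" using z
      by (metis inverse_1 mult.commute power_inverse power_mult power_one)
    show "inverse (\<zeta> ^ j) \<noteq> 1"
      using inj_onD[OF root_of_unity_inj[OF p z], of j 0] j by auto
  qed (use RL j in auto)
qed

end

section \<open>Comparison of the two ideals\<close>

lemma gen_ideal_single: "c \<in> R \<Longrightarrow> s \<in> S \<Longrightarrow> c * s \<in> gen_ideal R S"
  unfolding gen_ideal_def mem_Collect_eq
  by (rule exI[of _ 1], rule exI[of _ "\<lambda>_. c"], rule exI[of _ "\<lambda>_. s"]) simp

lemma gen_ideal_0: "0 \<in> gen_ideal R S"
  unfolding gen_ideal_def by (auto intro!: exI[of _ "0 :: nat"])

lemma gen_ideal_subset:
  assumes "subring M" "R \<subseteq> M" "S \<subseteq> M"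
  shows "gen_ideal R S \<subseteq> M"
  using assms unfolding gen_ideal_def by (auto intro!: subring_sum subring_mult)

text \<open>The largest generator in a finite sum dominates it. This reduces inclusions of ideals to
  comparisons of single generators.\<close>

lemma (in valued_field) gen_ideal_dominated:
  assumes "R \<subseteq> V" "S \<subseteq> F" and x: "x \<in> gen_ideal R S" "x \<noteq> 0"
  shows "\<exists>s\<in>S. le x s"
proof -
  obtain n :: nat and c s where cs: "\<forall>i<n. c i \<in> R \<and> s i \<in> S" "x = (\<Sum>i<n. c i * s i)"
    using x(1) by (auto simp: gen_ideal_def)
  have "n \<noteq> 0" using x(2) cs(2) by (cases n) auto
  then obtain k where k: "k < n" "\<And>j. j < n \<Longrightarrow> le (s j) (s k)"
    using ex_max[of "{..<n}" s] cs(1) assms(2) by fastforce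
  have "le (c i * s i) (s k)" if "i < n" for i
  proof -
    have "c i \<in> V" using cs(1) that assms(1) by blast
    then show ?thesis using k(2)[OF that] le_mult_V le_trans by blast
  qed
  then have "le x (s k)" unfolding cs(2) by (intro le_sum) auto
  then show ?thesis using k cs(1) by blast
qed

lemma pascal_sum:
  "(\<Sum>k\<le>n. of_nat (n choose k) * (a k + a (Suc k))) =
   (\<Sum>k\<le>Suc n. of_nat (Suc n choose k) * (a k :: 'a::comm_semiring_1))"
proof -
  have "(\<Sum>k\<le>Suc n. of_nat (Suc n choose k) * a k) =
      a 0 + (\<Sum>k\<le>n. of_nat (n choose Suc k) * a (Suc k)) + (\<Sum>k\<le>n. of_nat (n choose k) * a (Suc k))"
    unfolding sum.atMost_Suc_shift[of _ n] by (simp add: algebra_simps sum.distrib)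
  also have "a 0 + (\<Sum>k\<le>n. of_nat (n choose Suc k) * a (Suc k)) = (\<Sum>k\<le>Suc n. of_nat (n choose k) * a k)"
    unfolding sum.atMost_Suc_shift[of _ n] by simp
  also have "\<dots> = (\<Sum>k\<le>n. of_nat (n choose k) * a k)" by (simp add: binomial_eq_0)
  finally show ?thesis by (simp add: sum.distrib algebra_simps)
qed

locale henselian_cyclic = cyclic_galois K' L' p \<zeta> K L \<sigma>
  for K' L' :: "'a::field_char_0 set" and p \<zeta> K L \<sigma> +
  fixes A' B :: "'a set"
  assumes hens': "henselian K' A'" and vB: "valuation_ring L B" and BA': "B \<inter> K' = A'"
    and pA': "of_nat p \<in> max_ideal A'"
begin

sublocale henselian_galois L B K' A'
  using hens' vB BA' finite_Gal fixed_Gal K'K KL by unfold_locales auto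

abbreviation \<zz> where "\<zz> \<equiv> \<zeta> - 1"

lemma zz: "\<zz> \<in> L" "\<zz> \<noteq> 0" "\<zz> \<in> K"
  using zK K z KL by (auto simp: subfield_closed)

section \<open>Values of integers and of roots of unity\<close>

lemma p_small: "\<not> le 1 (of_nat p)"
  using pA' max_ideal_A by blast

text \<open>By Bezout, 1 is a multiple of \<open>n\<close> minus a multiple of \<open>p\<close>;
  both cannot lie in the maximal ideal.\<close>

lemma nat_unit:
  assumes "0 < n" "n < p"
  shows "le 1 (of_nat n)"
proof (rule ccontr)
  assume a: "\<not> ?thesis"
  have "coprime n p" using assms p by (metis coprime_commute dvd_imp_le leD prime_imp_coprime_nat)
  then obtain s t where st: "n * s = p * t + 1"
    using bezout_nat[of n p] assms by (auto simp: coprime_iff_gcd_eq_1)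
  have nV: "of_nat k \<in> B" for k using V by (simp add: subring_closed)
  have nL: "of_nat k \<in> L" for k using nV VF by blast
  have "\<not> le 1 (of_nat (n * s))" "\<not> le 1 (of_nat (p * t))"
    using a p_small le_mult_V[OF nV[of s], of "of_nat n"] le_mult_V[OF nV[of t], of "of_nat p"] le_trans
    by (metis mult.commute of_nat_mult)+
  then have "\<not> le 1 (of_nat (n * s) - of_nat (p * t))" using nL by (intro lt_diff)
  moreover have "of_nat (n * s) - of_nat (p * t) = (1::'a)" unfolding st by simp
  ultimately show False using le_refl by metis
qed

text \<open>Either \<open>\<omega>\<close> or its inverse lies in \<open>B\<close>, and
  \<open>\<omega>\<close> is a power of its inverse.\<close>

lemma root_of_unity_B: "\<omega> ^ p = 1 \<Longrightarrow> \<omega> \<in> B"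
proof -
  assume w: "\<omega> ^ p = 1"
  have "\<omega> \<in> L" using root_of_unity_K[OF w] KL by blast
  moreover have "\<omega> = inverse \<omega> ^ (p - 1)"
  proof -
    have "\<omega> ^ (p - 1) * \<omega> = 1" using w p_gt_0 by (simp flip: power_Suc2)
    then have "inverse (\<omega> ^ (p - 1)) = \<omega>" by (rule inverse_unique)
    then show ?thesis by (simp add: power_inverse)
  qed
  ultimately show ?thesis using V_cases V by (metis subring_power)
qed

text \<open>As \<open>\<omega>'\<close> is a power of \<open>\<omega>\<close>, the quotient is a
  geometric sum. By symmetry, \<open>\<omega> - 1\<close> has the same value for all nontrivial
  roots.\<close>

lemma root_diff_le:
  assumes "\<omega> ^ p = 1" "\<omega> \<noteq> 1" "\<omega>' ^ p = 1"
  shows "le (\<omega>' - 1) (\<omega> - 1)"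
proof -
  obtain k where "\<omega>' = \<omega> ^ k" using root_of_unity_power[OF p assms] by blast
  then have "\<omega>' - 1 = (\<Sum>i<k. \<omega> ^ i) * (\<omega> - 1)" by (simp add: power_diff_1_eq)
  moreover have "(\<Sum>i<k. \<omega> ^ i) \<in> B"
    using root_of_unity_B[OF assms(1)] V by (auto intro!: subring_sum subring_power)
  ultimately show ?thesis by (simp add: le_mult_V)
qed

lemma p_eq_prod: "of_nat p = (\<Prod>k\<in>{1..<p}. 1 - \<zeta> ^ k)"
proof -
  have inj: "inj_on (\<lambda>k. \<zeta> ^ k) {1..<p}"
    by (rule inj_on_subset[OF root_of_unity_inj[OF p z]]) auto
  have "Phi = (\<Prod>s\<in>(\<lambda>k. \<zeta> ^ k) ` {1..<p}. [:- s, 1:])"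
  proof (rule poly_eq_prod_roots)
    show "card ((\<lambda>k. \<zeta> ^ k) ` {1..<p}) = degree Phi" using inj by (simp add: card_image degree_Phi)
    show "lead_coeff Phi = 1" unfolding degree_Phi using p_gt_0 by (simp add: Phi_def coeff_sum_monom)
    fix x assume "x \<in> (\<lambda>k. \<zeta> ^ k) ` {1..<p}"
    then obtain k where k: "k \<in> {1..<p}" "x = \<zeta> ^ k" by blast
    have "\<zeta> ^ k \<noteq> \<zeta> ^ 0" using inj_onD[OF root_of_unity_inj[OF p z], of k 0] k by auto
    moreover have "(\<zeta> ^ k) ^ p = 1" using z by (metis mult.commute power_mult power_one)
    ultimately show "poly Phi x = 0" by (simp add: Phi_root k)
  qed simp
  then have "poly Phi 1 = (\<Prod>k\<in>{1..<p}. 1 - \<zeta> ^ k)"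
    using inj by (simp add: prod.reindex poly_prod)
  then show ?thesis by (simp add: Phi_def poly_sum poly_monom)
qed

text \<open>Evaluating \<open>Phi\<close> at 1 writes \<open>p\<close> as a product of
  \<open>p - 1\<close> factors of the value of \<open>\<zz>\<close>. The bound controls the last
  term of the expansion in \<open>ex_sigma_diff_ge\<close>.\<close>

lemma zz_power_le_p: "le (\<zz> ^ (p - 1)) (of_nat p)"
proof -
  have "le \<zz> (1 - \<zeta> ^ k)" if "k \<in> {1..<p}" for k
  proof -
    have "\<zeta> ^ k \<noteq> \<zeta> ^ 0" using inj_onD[OF root_of_unity_inj[OF p z], of k 0] that by auto
    moreover have "(\<zeta> ^ k) ^ p = 1" using z by (metis mult.commute power_mult power_one)
    ultimately show ?thesis using root_diff_le[of "\<zeta> ^ k" \<zeta>] z le_uminus_right[of \<zz> "\<zeta> ^ k - 1"] by simp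
  qed
  then have "le (\<Prod>k\<in>{1..<p}. \<zz>) (\<Prod>k\<in>{1..<p}. 1 - \<zeta> ^ k)" by (rule le_prod)
  then show ?thesis by (simp add: p_eq_prod)
qed

lemma sigma_pow_binomial:
  assumes y: "y \<in> L"
  defines "s \<equiv> \<lambda>x. \<sigma> x - x"
  shows "(\<sigma> ^^ n) y = (\<Sum>k\<le>n. of_nat (n choose k) * (s ^^ k) y)"
proof (induction n)
  case (Suc n)
  have sL: "(s ^^ k) y \<in> L" for k
    by (induction k) (use y s_L L in \<open>auto simp: s_def subfield_closed\<close>)
  have nK: "of_nat k \<in> K" for k using K by (simp add: subfield_closed)
  have nL: "of_nat k \<in> L" for k using nK KL by blast
  have "(\<sigma> ^^ Suc n) y = (\<Sum>k\<le>n. \<sigma> (of_nat (n choose k) * (s ^^ k) y))"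
    using Suc sL nL L by (simp add: hom_sum[OF L s_hom] subring_mult subfield_subring)
  also have "\<dots> = (\<Sum>k\<le>n. of_nat (n choose k) * ((s ^^ k) y + (s ^^ Suc k) y))"
    using s_K[OF nK] sL nL by (simp add: hom_mult[OF L s_hom] s_def)
  also have "\<dots> = (\<Sum>k\<le>Suc n. of_nat (Suc n choose k) * (s ^^ k) y)" by (rule pascal_sum)
  finally show ?case .
qed simp

text \<open>If \<open>s = \<sigma> - 1\<close> shrank every element of \<open>L'\<close> strictly more than multiplication by
  \<open>\<zeta> - 1\<close>, then in \<open>0 = (1 + s)^p - 1\<close> the term \<open>p s\<close> would strictly dominate all others.\<close>

lemma ex_sigma_diff_ge:
  "\<exists>b\<in>L'. b \<noteq> 0 \<and> le (b * \<zz>) (\<sigma> b - b)"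
proof (rule ccontr)
  assume "\<not> ?thesis"
  then have small: "\<not> le (b * \<zz>) (\<sigma> b - b)" if "b \<in> L'" "b \<noteq> 0" for b using that by blast
  define s where "s = (\<lambda>x. \<sigma> x - x)"
  obtain y where y: "y \<in> L'" "\<sigma> y \<noteq> y" using sigma_nontrivial by blast
  define w where "w = s y"
  have sL': "(s ^^ k) x \<in> L'" if "x \<in> L'" for k x
    by (induction k) (use that s_L' L' in \<open>auto simp: s_def subfield_closed\<close>)
  have wL': "w \<in> L'" and w0: "w \<noteq> 0" using sL'[OF y(1), of 1] y by (auto simp: w_def s_def)
  \<comment> \<open>Strictness starts at \<open>k = 1\<close>; counting from \<open>w = s y\<close>
    makes it available for all terms of the expansion after the one with
    \<open>p * w\<close>.\<close>
  have iter: "le ((s ^^ k) w) (w * \<zz> ^ k) \<and> (k > 0 \<longrightarrow> \<not> le (w * \<zz> ^ k) ((s ^^ k) w))" for k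
  proof (induction k)
    case (Suc k)
    define v where "v = (s ^^ k) w"
    have v: "v \<in> L'" "le v (w * \<zz> ^ k)" using sL'[OF wL'] Suc by (auto simp: v_def)
    have vz: "le (v * \<zz>) (w * \<zz> ^ Suc k)"
      using le_mult[OF v(2) le_refl[of \<zz>]] by (simp add: mult_ac)
    show ?case
    proof (cases "v = 0")
      case True
      have "(s ^^ Suc k) w = s v" by (simp add: v_def)
      also have "s v = 0" using True s_hom_simps(4) by (simp add: s_def)
      finally show ?thesis using w0 zz by (simp add: le_0 le_0_iff)
    next
      case False
      have nl: "\<not> le (v * \<zz>) (s v)" using small[OF v(1) False] by (simp add: s_def)
      have "v \<in> L" "s v \<in> L" using v sL'[OF v(1), of 1] L'L by auto
      then have "le (s v) (v * \<zz>)" using nl le_total[of "s v" "v * \<zz>"] zz L by (auto simp: subfield_closed)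
      then have "le (s v) (w * \<zz> ^ Suc k)" using vz le_trans by blast
      moreover have "\<not> le (w * \<zz> ^ Suc k) (s v)" using nl vz le_trans by blast
      ultimately show ?thesis by (simp add: v_def)
    qed
  qed (simp add: le_refl)
  define t where "t k = of_nat (p choose k) * (s ^^ k) y" for k
  have tS: "t (Suc k) = of_nat (p choose Suc k) * (s ^^ k) w" for k
    by (simp add: t_def w_def funpow_Suc_right del: funpow.simps)
  have yL: "y \<in> L" using y L'L by blast
  have "(\<Sum>k\<le>p. t k) = y"
    using sigma_pow_binomial[OF yL, of p] sigma_pow_p[OF y(1)] by (simp add: t_def s_def)
  moreover have "{..p} = insert 0 (insert 1 {2..p})" using p_gt_1 by auto
  ultimately have "t 0 + (t 1 + (\<Sum>k\<in>{2..p}. t k)) = y" by simp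
  then have eq: "of_nat p * w = - (\<Sum>k\<in>{2..p}. t k)"
    by (simp add: t_def w_def eq_neg_iff_add_eq_0)
  have p0: "(of_nat p :: 'a) \<noteq> 0" using p_gt_0 by simp
  have BL: "x \<in> B \<Longrightarrow> x \<in> L" for x using VF by blast
  have nB: "of_nat k \<in> B" for k using V by (simp add: subring_closed)
  have "\<not> le (of_nat p * w) (\<Sum>k\<in>{2..p}. t k)"
  proof (rule lt_sum)
    fix k assume "k \<in> {2..p}"
    then obtain j where j: "k = Suc j" "j > 0" "j < p" by (cases k) auto
    define v where "v = (s ^^ j) w"
    have v: "le v (w * \<zz> ^ j)" "\<not> le (w * \<zz> ^ j) v" using iter[of j] j by (auto simp: v_def)
    have vL: "v \<in> L" using sL'[OF wL', of j] L'L by (auto simp: v_def)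
    have tk: "t k = of_nat (p choose k) * v" by (simp add: j tS v_def)
    have "\<not> le (of_nat p * w) (t k)"
    \<comment> \<open>The last binomial coefficient is 1; there \<open>zz_power_le_p\<close>
      replaces the divisibility by \<open>p\<close> used for the others.\<close>
    proof (cases "k = p")
      case True
      then have "j = p - 1" using j by simp
      then have "le (w * \<zz> ^ j) (of_nat p * w)"
        using le_mult[OF zz_power_le_p le_refl[of w]] by (simp add: mult.commute)
      then show ?thesis using v True tk le_trans by auto
    next
      case False
      then have "p dvd (p choose k)" using j p by (intro dvd_choose_prime) auto
      then obtain m where m: "p choose k = p * m" by (auto elim: dvdE)
      have "\<not> le w (of_nat m * v)"
      proof
        assume "le w (of_nat m * v)"
        then have "le w v" using le_mult_V[OF nB] le_trans by blast
        moreover have "\<zz> ^ j \<in> B" using root_of_unity_B[OF z(1)] V by (auto intro!: subring_closed)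
        then have "le (w * \<zz> ^ j) w" using le_mult_V by (metis mult.commute)
        ultimately show False using v le_trans by blast
      qed
      then show ?thesis using p0 by (simp add: tk m mult.assoc le_cancel)
    qed
    moreover have "t k \<in> L" using vL BL[OF nB] L by (simp add: tk subfield_closed)
    ultimately show "t k \<in> L \<and> \<not> le (of_nat p * w) (t k)" by blast
  qed (use p0 w0 in simp)
  then show False using eq le_refl[of "of_nat p * w"] le_uminus_right by (metis minus_minus)
qed

lemma trace_L':
  assumes x: "x \<in> L"
  shows "(\<Sum>l\<in>Gal L' L. l x) \<in> L'"
proof (rule fixed_Gal_L')
  have lL: "\<And>l. l \<in> Gal L' L \<Longrightarrow> l x \<in> L" using GalD(3) x by blast
  then show "(\<Sum>l\<in>Gal L' L. l x) \<in> L" by (rule subring_sum[OF subfield_subring[OF L]])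
  fix m assume m: "m \<in> Gal L' L"
  have "m (\<Sum>l\<in>Gal L' L. l x) = (\<Sum>l\<in>Gal L' L. (m \<circ> l) x)"
    using hom_sum[OF L GalD(1)[OF m] lL] by simp
  also have "\<dots> = (\<Sum>l\<in>Gal L' L. l x)"
    by (rule sum.reindex_bij_betw[OF Gal_bij[OF L L'L m], of "\<lambda>l. l x"])
  finally show "m (\<Sum>l\<in>Gal L' L. l x) = (\<Sum>l\<in>Gal L' L. l x)" .
qed

lemma Gal_L'_sub: "l \<in> Gal L' L \<Longrightarrow> l \<in> Gal K' L"
  using Gal_mono[OF K'L'] by blast

text \<open>The witness is the trace to \<open>L'\<close> of \<open>(a - 1) / (\<omega> - 1)\<close>: applying \<open>\<sigma> - 1\<close> to it
  yields the trace of \<open>a\<close>, which is a unit because \<open>a\<close> is congruent to \<open>1\<close> and \<open>[L : L'] < p\<close>.\<close>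

lemma descend_one_unit:
  assumes a: "a \<in> L" "\<sigma> a = \<omega> * a" and w: "\<omega> ^ p = 1" "\<omega> \<noteq> 1" and a1: "\<not> le 1 (a - 1)"
  shows "\<exists>b\<in>L'. b \<noteq> 0 \<and> le (b * \<zz>) ((\<sigma> b - b) * (a - 1))"
proof -
  define c where "c = (a - 1) / (\<omega> - 1)"
  define T where "T x = (\<Sum>l\<in>Gal L' L. l x)" for x
  have wK: "\<omega> \<in> K" using root_of_unity_K[OF w(1)] .
  have wL: "\<omega> \<in> L" using wK KL by blast
  have a1L: "a - 1 \<in> L" and cL: "c \<in> L" using a wL L by (auto simp: c_def subfield_closed)
  have "\<sigma> c = (\<omega> * a - 1) / (\<omega> - 1)"
    using a wL L s_K[OF wK] by (simp add: c_def s_hom_simps subfield_closed)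
  \<comment> \<open>The denominator \<open>\<omega> - 1\<close> is chosen because
    \<open>\<sigma> a - a = (\<omega> - 1) * a\<close>.\<close>
  then have sc: "\<sigma> c - c = a" using w by (simp add: c_def field_simps)
  have lL: "\<And>l x. l \<in> Gal L' L \<Longrightarrow> x \<in> L \<Longrightarrow> l x \<in> L" using GalD(3) by blast
  have "\<sigma> (T c) = (\<Sum>l\<in>Gal L' L. l (\<sigma> c))"
    unfolding T_def using lL cL sigma_comm by (subst hom_sum[OF L s_hom]) auto
  then have sT: "\<sigma> (T c) - T c = T a"
    using hom_diff[OF L GalD(1), of _ L' "\<sigma> c" c] cL s_L
    by (simp add: T_def sc flip: sum_subtractf)
  have unit: "le 1 (T a)"
  proof -
    have "l a = 1 + l (a - 1)" if l: "l \<in> Gal L' L" for l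
      using hom_diff[OF L GalD(1)[OF l] a(1), of 1] hom_1[OF L GalD(1)[OF l]] L
      by (simp add: subfield_closed)
    then have "T a = (\<Sum>l\<in>Gal L' L. 1 + l (a - 1))" unfolding T_def by (rule sum.cong[OF refl])
    then have Ta: "T a = of_nat (card (Gal L' L)) + T (a - 1)" by (simp add: T_def sum.distrib)
    have n: "le 1 (of_nat (card (Gal L' L)))" using nat_unit card_Gal_L' by blast
    have "\<not> le 1 (T (a - 1))" unfolding T_def
    proof (rule lt_sum)
      fix l assume l: "l \<in> Gal L' L"
      then show "l (a - 1) \<in> L \<and> \<not> le 1 (l (a - 1))"
        using conj_le[OF a1L Gal_L'_sub[OF l]] a1 le_trans lL a1L by blast
    qed simp
    moreover have "T (a - 1) \<in> L" "T a \<in> L" using trace_L' a1L a L'L by (auto simp: T_def)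
    moreover have "of_nat (card (Gal L' L)) = T a - T (a - 1)" using Ta by simp
    ultimately show ?thesis using n lt_diff[of "T a" "T (a - 1)" 1] by metis
  qed
  define b where "b = T c"
  have "b \<in> L'" using trace_L'[OF cL] by (simp add: b_def T_def)
  moreover have "b \<noteq> 0"
  proof
    assume "b = 0"
    then have "T a = 0" using sT s_hom_simps by (simp add: b_def)
    then show False using unit by (simp add: le_0_iff)
  qed
  moreover have "le (b * \<zz>) ((\<sigma> b - b) * (a - 1))"
  proof -
    \<comment> \<open>Conjugates of \<open>c\<close> have its value, so the trace is no larger than
      \<open>c\<close>.\<close>
    have "le b c" unfolding b_def T_def
      using conj_le[OF cL Gal_L'_sub] by (intro le_sum) auto
    then have "le (b * \<zz>) (c * (\<omega> - 1))"
      using root_diff_le[OF w z(1)] by (rule le_mult)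
    moreover have "c * (\<omega> - 1) = 1 * (a - 1)" using w by (simp add: c_def)
    moreover have "le (1 * (a - 1)) (T a * (a - 1))" using unit le_refl by (rule le_mult)
    ultimately show ?thesis using le_trans by (simp add: b_def sT)
  qed
  ultimately show ?thesis by blast
qed

lemma kummer_to_L':
  assumes h: "h \<in> K" "gen_field (K \<union> {x. x ^ p = h}) = L" "h \<noteq> 1"
  shows "\<exists>b\<in>L'. b \<noteq> 0 \<and> le (\<zz> ^ p / (h - 1)) ((\<sigma> b / b - 1) ^ p)"
proof -
  obtain a \<omega> where a: "a \<in> L" "a \<noteq> 0" "a ^ p = h" "\<sigma> a = \<omega> * a" and w: "\<omega> ^ p = 1" "\<omega> \<noteq> 1"
    using kummer_root[OF h(1,2)] by metis
  have wK: "\<omega> \<in> K" using root_of_unity_K[OF w(1)] .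
  have wL: "\<omega> \<in> L" using wK KL by blast
  have a1L: "a - 1 \<in> L" using a L by (auto simp: subfield_closed)
  have pow: "(\<sigma> ^^ k) (a - 1) = \<omega> ^ k * a - 1" for k
    by (induction k) (use a wL L s_K[OF wK] in \<open>auto simp: s_hom_simps subfield_closed\<close>)
  \<comment> \<open>Up to the unit \<open>\<omega> ^ (p - k)\<close>, the element
    \<open>a - \<omega> ^ k\<close> is the conjugate of \<open>a - 1\<close> under
    \<open>\<sigma> ^^ (p - k)\<close>.\<close>
  have "le (a - 1) (a - \<omega> ^ k)" if "k < p" for k
  proof -
    have "le (a - 1) (\<omega> ^ (p - k) * a - 1)"
      using conj_le'[OF a1L Gal_funpow[OF sigma', of "p - k"]] by (simp add: pow)
    also have "\<omega> ^ (p - k) * a - 1 = \<omega> ^ (p - k) * (a - \<omega> ^ k)"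
      using w that by (simp add: right_diff_distrib flip: power_add)
    finally have "le (a - 1) (\<omega> ^ (p - k) * (a - \<omega> ^ k))" .
    moreover have "\<omega> ^ (p - k) \<in> B" using root_of_unity_B[OF w(1)] V by (simp add: subring_closed)
    ultimately show ?thesis using le_mult_V le_trans by blast
  qed
  then have "le (\<Prod>k<p. a - 1) (\<Prod>k<p. a - \<omega> ^ k)" by (intro le_prod) auto
  then have ah: "le ((a - 1) ^ p) (h - 1)"
    using power_diff_prod[OF p w, of 1 a] by (simp add: a)
  show ?thesis
  proof (cases "le 1 (a - 1)")
    case False
    then obtain b where b: "b \<in> L'" "b \<noteq> 0" "le (b * \<zz>) ((\<sigma> b - b) * (a - 1))"
      using descend_one_unit[OF a(1,4) w] by blast
    have "\<sigma> b - b = b * (\<sigma> b / b - 1)" using b by (simp add: field_simps)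
    then have "(\<sigma> b - b) * (a - 1) = b * ((\<sigma> b / b - 1) * (a - 1))" by (simp only: mult.assoc)
    then have "le \<zz> ((\<sigma> b / b - 1) * (a - 1))" using b le_cancel by metis
    then have "le (\<zz> ^ p) ((\<sigma> b / b - 1) ^ p * (a - 1) ^ p)"
      unfolding power_mult_distrib[symmetric] by (rule le_power)
    moreover have "le ((\<sigma> b / b - 1) ^ p * (a - 1) ^ p) ((\<sigma> b / b - 1) ^ p * (h - 1))"
      using le_refl ah by (rule le_mult)
    ultimately have "le (\<zz> ^ p) ((\<sigma> b / b - 1) ^ p * (h - 1))" by (rule le_trans)
    then have "le (\<zz> ^ p / (h - 1)) ((\<sigma> b / b - 1) ^ p)" using h(3) by (simp add: le_divide)
    then show ?thesis using b by blast
  next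
    case True
    obtain b where b: "b \<in> L'" "b \<noteq> 0" "le (b * \<zz>) (\<sigma> b - b)" using ex_sigma_diff_ge by blast
    have "\<sigma> b - b = b * (\<sigma> b / b - 1)" using b by (simp add: field_simps)
    then have "le \<zz> (\<sigma> b / b - 1)" using b le_cancel by metis
    then have "le (\<zz> ^ p) ((\<sigma> b / b - 1) ^ p)" by (rule le_power)
    moreover have "le 1 (h - 1)" using le_power[OF True, of p] ah le_trans by simp
    ultimately have "le (\<zz> ^ p * 1) ((\<sigma> b / b - 1) ^ p * (h - 1))" by (rule le_mult)
    then have "le (\<zz> ^ p / (h - 1)) ((\<sigma> b / b - 1) ^ p)" using h(3) by (simp add: le_divide)
    then show ?thesis using b by blast
  qed
qed

section \<open>From elements of \<open>L\<close> back to Kummer generators\<close>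

lemma kummer_approx:
  assumes a: "a \<in> L" "a \<noteq> 0" "\<sigma> a = \<omega> * a" and w: "\<omega> ^ p = 1" "\<omega> \<noteq> 1"
    and b: "b \<in> L" "b \<noteq> 0" and u: "u = \<sigma> b / b - 1" "u \<noteq> 0" "u \<in> B"
  shows "\<exists>c\<in>K. le (a - c) ((\<omega> - 1) * a / u)"
proof (rule ccontr)
  assume "\<not> ?thesis"
  then have far: "\<And>c. c \<in> K \<Longrightarrow> \<not> le (a - c) ((\<omega> - 1) * a / u)" by blast
  \<comment> \<open>The radius is chosen so that \<open>e * u = \<sigma> a - a\<close>. As
    \<open>u\<close> is integral, the ball contains \<open>\<sigma> a\<close> and, by
    \<open>root_diff_le\<close>, all \<open>\<omega> ^ k * a\<close>.\<close>
  define e where "e = (\<omega> - 1) * a / u"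
  have wL: "\<omega> \<in> L" using root_of_unity_K[OF w(1)] KL by blast
  have uL: "u \<in> L" using u VF by blast
  have e: "e \<in> L" "e \<noteq> 0" using a w u wL uL L by (auto simp: e_def intro!: subring_mult subring_diff subring_1 subfield_subring subfield_divide)
  have lin: "pcompose [:- c, 1:] [:a, e:] = [:a - c, e:]" for c by (simp add: pcompose_pCons)
  have "top_index (\<Prod>k\<in>{..<p}. pcompose [:- (\<omega> ^ k * a), 1:] [:a, e:]) (card {..<p})"
  proof (rule top_index_prod)
    fix k
    have wk: "(\<omega> ^ k) ^ p = 1" using w by (metis mult.commute power_mult power_one)
    have wkL: "\<omega> ^ k * a \<in> L" using wL a L by (auto intro!: subring_mult subring_power subfield_subring)
    show "pcompose [:- (\<omega> ^ k * a), 1:] [:a, e:] \<in> poly_over L"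
      unfolding lin using a e wkL subfield_subring[OF L]
      by (intro poly_over_closed(1,7) subring_diff)
    have "le ((\<omega> ^ k - 1) * (- a)) ((\<omega> - 1) * a)"
      using root_diff_le[OF w wk] le_uminus[OF le_refl[of a]] by (rule le_mult)
    moreover have "le ((\<omega> - 1) * a) e"
      using u(2) le_mult_V[OF u(3), of e] by (simp add: e_def)
    moreover have "a - \<omega> ^ k * a = (\<omega> ^ k - 1) * (- a)" by (simp add: algebra_simps)
    ultimately have "le (a - \<omega> ^ k * a) e" using le_trans by metis
    then show "top_index (pcompose [:- (\<omega> ^ k * a), 1:] [:a, e:]) 1"
      unfolding lin using e by (intro top_index_linear)
  qed simp
  then have tp: "top_index (pcompose (monom 1 p - [:a ^ p:]) [:a, e:]) p"
    by (simp add: prod_roots_of_unity[OF p w a(2)] pcompose_prod)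
  have P0: "monom 1 p - [:a ^ p:] \<in> poly_over K"
    using kummer_power[OF a w] subfield_subring[OF K]
    by (intro poly_over_closed(1,4,6,7) subring_1)
  have dP0: "degree (monom 1 p - [:a ^ p:]) = p"
    unfolding prod_roots_of_unity[OF p w a(2)] by (subst degree_prod_sum_eq) auto
  obtain f where f: "f \<in> poly_over K" "degree f < p" "b = poly f a"
    using kummer_basis[OF a w b(1)] by blast
  define C where "C = pcompose f [:a, e:]"
  have "f \<noteq> 0" using f b by auto
  then have "top_index C 0"
    unfolding C_def using top_index_zero_of_degree_less[OF K KL a(1) e _ p P0 dP0 tp f(1) _ f(2)] far
    by (simp add: e_def)
  moreover have "coeff C 0 = b" by (simp add: C_def pcompose_coeff_0 f(3))
  ultimately have low: "\<not> le b (coeff C k)" if "k > 0" for k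
    using that unfolding top_index_def by metis
  have CL: "coeff C k \<in> L" for k
  proof -
    have "C \<in> poly_over L" unfolding C_def
      using f(1) a e poly_over_mono[OF KL] subfield_subring[OF L]
      by (intro poly_over_pcompose poly_over_closed(1,7)) auto
    then show ?thesis by (simp add: poly_over_def)
  qed
  have fL: "f \<in> poly_over L" using f poly_over_mono[OF KL] by blast
  have sb: "\<sigma> b = poly f (\<sigma> a)"
    using hom_poly[OF L s_hom fL a(1)] f(3) map_poly_fixed[OF s_K K f(1)] by simp
  have "e * u = (\<omega> - 1) * a" using u(2) by (simp add: e_def)
  then have "\<sigma> a = a + e * u" by (simp add: a algebra_simps)
  with sb have "\<sigma> b = poly f (a + e * u)" by simp
  also have "\<dots> = poly C u" by (simp add: C_def poly_pcompose mult.commute)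
  also have "\<dots> = (\<Sum>k\<le>degree C. coeff C k * u ^ k)" by (rule poly_altdef)
  also have "{..degree C} = insert 0 {1..degree C}" by auto
  finally have "\<sigma> b - b = (\<Sum>k\<in>{1..degree C}. coeff C k * u ^ k)"
    using \<open>coeff C 0 = b\<close> by simp
  moreover have "\<not> le (b * u) (\<Sum>k\<in>{1..degree C}. coeff C k * u ^ k)"
  proof (rule lt_sum)
    fix k assume "k \<in> {1..degree C}"
    then obtain j where j: "k = Suc j" by (cases k) auto
    \<comment> \<open>One factor \<open>u\<close> is set aside: every term of
      \<open>\<sigma> b - b\<close> is then strictly below \<open>b * u\<close>, which equals the
      whole sum.\<close>
    have "\<not> le b (coeff C k * u ^ j)"
    proof
      assume a: "le b (coeff C k * u ^ j)"
      have "u ^ j \<in> B" using u V by (simp add: subring_closed)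
      then have "le b (coeff C k)" using a le_mult_V le_trans by (metis mult.commute)
      then show False using low j by simp
    qed
    then have "\<not> le (u * b) (u * (coeff C k * u ^ j))" using u(2) by (simp add: le_cancel)
    then have "\<not> le (b * u) (coeff C k * u ^ k)" by (simp add: j mult_ac)
    moreover have "coeff C k * u ^ k \<in> L" using CL uL L by (intro subring_mult subring_power subfield_subring)
    ultimately show "coeff C k * u ^ k \<in> L \<and> \<not> le (b * u) (coeff C k * u ^ k)" by blast
  qed (use b u in simp)
  moreover have "\<sigma> b - b = b * u" using b u by (simp add: field_simps)
  ultimately show False using le_refl by metis
qed

lemma kummer_of_L:
  assumes b: "b \<in> L" "b \<noteq> 0" and u: "u = \<sigma> b / b - 1" "u \<noteq> 0"
  shows "\<exists>h\<in>K. gen_field (K \<union> {x. x ^ p = h}) = L \<and> le (u ^ p) (\<zz> ^ p / (h - 1))"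
proof -
  obtain a0 \<omega>0 where a0: "a0 \<in> L" "a0 \<noteq> 0" "\<sigma> a0 = \<omega>0 * a0" "\<omega>0 ^ p = 1" "\<omega>0 \<noteq> 1"
    by (rule ex_kummer)
  \<comment> \<open>Inverting an eigenvector gives an eigenvector, so \<open>a\<close> may be taken
    integral; then \<open>a\<close> itself serves when \<open>le u \<zz>\<close> holds.\<close>
  have "\<exists>a \<omega>. a \<in> B \<and> a \<noteq> 0 \<and> \<sigma> a = \<omega> * a \<and> \<omega> ^ p = 1 \<and> \<omega> \<noteq> 1"
  proof (cases "a0 \<in> B")
    case False
    then have "inverse a0 \<in> B" using V_cases a0 by blast
    moreover have "\<sigma> (inverse a0) = inverse \<omega>0 * inverse a0" using a0 by (simp add: s_hom_simps)
    moreover have "inverse \<omega>0 ^ p = 1" "inverse \<omega>0 \<noteq> 1" using a0 by (auto simp: power_inverse)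
    ultimately show ?thesis using a0 by (intro exI[of _ "inverse a0"] exI[of _ "inverse \<omega>0"]) auto
  qed (use a0 in blast)
  then obtain a \<omega> where a: "a \<in> B" "a \<noteq> 0" "\<sigma> a = \<omega> * a" and w: "\<omega> ^ p = 1" "\<omega> \<noteq> 1" by blast
  have aL: "a \<in> L" using a VF by blast
  have wL: "\<omega> \<in> L" using root_of_unity_K[OF w(1)] KL by blast
  have le_sb: "le (\<sigma> b) b" using conj_le[OF b(1) sigma'] .
  have sbL: "\<sigma> b \<in> L" using b s_L by blast
  have uB: "u \<in> B"
    using le_diff[of "\<sigma> b / b" 1 1] le_sb b by (simp add: u le_divide le_refl flip: le_1_iff)
  \<comment> \<open>Factoring \<open>e ^ p - 1\<close> into the \<open>e - \<omega> ^ k\<close>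
    turns \<open>p\<close> separate bounds into the one required.\<close>
  have main: "le (u ^ p) (\<zz> ^ p / (e ^ p - 1)) \<and> e ^ p \<in> K \<and> gen_field (K \<union> {x. x ^ p = e ^ p}) = L"
    if e: "e \<in> L" "e \<noteq> 0" "\<sigma> e = \<omega> * e" and le: "\<And>k. le ((e - \<omega> ^ k) * u) \<zz>" for e
  proof -
    have "e ^ p \<noteq> 1"
    proof
      assume "e ^ p = 1"
      then have "e \<in> K" by (rule root_of_unity_K)
      then show False using s_K[of e] e w by simp
    qed
    have "le (\<Prod>k<p. (e - \<omega> ^ k) * u) (\<Prod>k<p. \<zz>)" using le by (intro le_prod) auto
    then have "le ((e ^ p - 1) * u ^ p) (\<zz> ^ p)"
      using power_diff_prod[OF p w, of 1 e] by (simp add: prod.distrib)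
    then show ?thesis
      using kummer_power[OF e w] kummer_gen[OF e w] \<open>e ^ p \<noteq> 1\<close> by (simp add: le_divide_right mult.commute)
  qed
  show ?thesis
  proof (cases "le u \<zz>")
    case True
    have "le ((a - \<omega> ^ k) * u) \<zz>" for k
    proof -
      have "a - \<omega> ^ k \<in> B" using a root_of_unity_B[OF w(1)] V by (intro subring_diff subring_power)
      then show ?thesis using le_mult_V True le_trans by blast
    qed
    then show ?thesis using main[OF aL a(2,3)] by blast
  next
    case False
    obtain c where c: "c \<in> K" "le (a - c) ((\<omega> - 1) * a / u)"
      using kummer_approx[OF aL a(2,3) w b u uB] by blast
    have cL: "c \<in> L" using c KL by blast
    have "le ((\<omega> - 1) * a) (\<zz> * a)" using root_diff_le[OF z w(1)] le_refl by (rule le_mult)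
    then have ac: "le ((a - c) * u) (\<zz> * a)"
      using c(2) u(2) le_trans by (simp add: le_divide_right)
    have "c \<noteq> 0"
    proof
      assume "c = 0"
      then have "le (a * u) (a * \<zz>)" using ac by (simp add: mult.commute)
      then show False using False a by (simp add: le_cancel)
    qed
    \<comment> \<open>Otherwise \<open>a - c\<close> would be as large as \<open>a\<close>, and
      \<open>ac\<close> would give \<open>le u \<zz>\<close>. Only now does dividing by
      \<open>c\<close> give an element close to 1.\<close>
    have "le a c"
    proof (rule ccontr)
      assume n: "\<not> le a c"
      then have "\<not> le a (a - c) \<Longrightarrow> False"
        using lt_add[of "a - c" c a] aL cL L le_refl by (auto simp: subring_diff subfield_subring)
      then have "le a (a - c)" by blast
      then have "le (a * u) (a * \<zz>)" using ac le_mult[OF _ le_refl[of u]] le_trans by (metis mult.commute)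
      then show False using False a by (simp add: le_cancel)
    qed
    define e where "e = a / c"
    have "\<sigma> e = \<omega> * e" using aL cL s_K[OF c(1)] a by (simp add: e_def s_hom_simps)
    moreover have "e \<in> L" using aL cL L by (simp add: e_def subfield_divide)
    moreover have "e \<noteq> 0" using a \<open>c \<noteq> 0\<close> by (simp add: e_def)
    moreover have "le ((e - \<omega> ^ k) * u) \<zz>" for k
    proof -
      have "le ((a - c) * u) (\<zz> * c)" using ac le_mult[OF le_refl \<open>le a c\<close>] le_trans by blast
      moreover have "(e - 1) * u = ((a - c) * u) / c" using \<open>c \<noteq> 0\<close> by (simp add: e_def field_simps)
      ultimately have "le ((e - 1) * u) \<zz>" using \<open>c \<noteq> 0\<close> by (simp add: le_divide)
      moreover have "(\<omega> ^ k) ^ p = 1" using w by (metis mult.commute power_mult power_one)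
      then have "le (u * (\<omega> ^ k - 1)) \<zz>"
        using root_diff_le[OF z] le_mult_V[OF uB] le_trans by blast
      ultimately have "le ((e - 1) * u - u * (\<omega> ^ k - 1)) \<zz>" by (rule le_diff)
      then show ?thesis by (simp add: algebra_simps)
    qed
    ultimately show ?thesis using main[of e] by blast
  qed
qed

text \<open>All conjugates of \<open>x\<close> have its value. For membership in \<open>K'\<close>,
  invariance under the single map \<open>s'\<close> is enough.\<close>

lemma norm_props:
  assumes x: "x \<in> L'"
  shows "field_norm K' L' x \<in> K'" "le (field_norm K' L' x) (x ^ p)" "le (x ^ p) (field_norm K' L' x)"
proof -
  have card: "card (Gal K' L') = p" using gal by (simp add: galois_of_degree_def)
  have tL': "\<And>\<tau>. \<tau> \<in> Gal K' L' \<Longrightarrow> \<tau> x \<in> L'" using GalD(3) x by blast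
  have tle: "le (\<tau> x) x \<and> le x (\<tau> x)" if t: "\<tau> \<in> Gal K' L'" for \<tau>
  proof -
    obtain \<rho> where "\<rho> \<in> Gal K L" "\<rho> x = \<tau> x" using extend_to_L[OF t] x by blast
    then show ?thesis using conj_le[of x \<rho>] conj_le'[of x \<rho>] Gal_mono[OF K'K] x L'L by auto
  qed
  show "le (field_norm K' L' x) (x ^ p)"
    using le_prod[of "Gal K' L'" "\<lambda>\<tau>. \<tau> x" "\<lambda>_. x"] tle by (simp add: field_norm_def card)
  show "le (x ^ p) (field_norm K' L' x)"
    using le_prod[of "Gal K' L'" "\<lambda>_. x" "\<lambda>\<tau>. \<tau> x"] tle by (simp add: field_norm_def card)
  have NL': "field_norm K' L' x \<in> L'"
    unfolding field_norm_def by (rule subring_prod[OF subfield_subring[OF L'] tL'])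
  obtain y where y: "y \<in> L'" "\<sigma> y \<noteq> y" using sigma_nontrivial by blast
  have "s' (field_norm K' L' x) = (\<Prod>\<tau>\<in>Gal K' L'. (s' \<circ> \<tau>) x)"
    unfolding field_norm_def using hom_prod[OF L' GalD(1)[OF s'_Gal] tL'] by simp
  also have "\<dots> = field_norm K' L' x" unfolding field_norm_def
    by (rule prod.reindex_bij_betw[OF Gal_bij[OF L' K'L' s'_Gal], of "\<lambda>\<tau>. \<tau> x"])
  finally show "field_norm K' L' x \<in> K'"
    using NL' sigma_fixed_L' by (simp add: s'_def)
qed

text \<open>A nonzero element of either ideal is dominated by a generator, which the comparison
  lemmas replace by a generator of the other ideal. The quotient by it is then integral and lies in
  the smaller field, hence in \<open>A'\<close> or \<open>A\<close>.\<close>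

theorem ideals_eq:
  assumes A: "valuation_ring K A" "A \<inter> K' = A'" and B': "valuation_ring L' B'" "B' \<inter> K' = A'"
  defines "\<AA> \<equiv> {h\<in>K. gen_field (K \<union> {x. x ^ p = h}) = L}"
  defines "J' \<equiv> gen_ideal B' {\<sigma> b / b - 1 | b. b \<in> L' \<and> b \<noteq> 0}"
  shows "{x\<in>gen_ideal A {\<zz> ^ p / (h - 1) | h. h \<in> \<AA>}. \<forall>l\<in>Gal L' L. l x = x} =
    gen_ideal A' (field_norm K' L' ` J')" (is "?H = ?N")
proof
  have AB: "A = B \<inter> K" using valuation_ring_unique[OF K'K KL A] .
  have B'B: "B' = B \<inter> L'" using valuation_ring_unique[OF K'L' L'L B'] .
  have gK: "{\<zz> ^ p / (h - 1) | h. h \<in> \<AA>} \<subseteq> K"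
    using zz(3) K by (auto simp: \<AA>_def intro!: subfield_divide subring_diff subring_power subring_1 subfield_subring)
  have uL': "{\<sigma> b / b - 1 | b. b \<in> L' \<and> b \<noteq> 0} \<subseteq> L'"
    using s_L' L' by (auto intro!: subfield_divide subring_diff subring_1 subfield_subring)
  have J'L': "J' \<subseteq> L'"
    unfolding J'_def using uL' B'B subfield_subring[OF L'] by (intro gen_ideal_subset) auto
  have N: "?N \<subseteq> K'"
    using J'L' norm_props(1) BA' subfield_subring[OF K'] by (intro gen_ideal_subset) auto
  show "?H \<subseteq> ?N"
  proof
    fix x assume "x \<in> ?H"
    then have x: "x \<in> gen_ideal A {\<zz> ^ p / (h - 1) | h. h \<in> \<AA>}" "\<And>l. l \<in> Gal L' L \<Longrightarrow> l x = x"
      by auto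
    have xK: "x \<in> K" using gen_ideal_subset[OF subfield_subring[OF K] _ gK] x(1) AB by blast
    \<comment> \<open>Invariance puts \<open>x\<close> into \<open>L'\<close>, and \<open>L'\<close>
      meets \<open>K\<close> only in \<open>K'\<close>.\<close>
    then have xK': "x \<in> K'" using fixed_Gal_L' x(2) KL L'_inter_K by blast
    show "x \<in> ?N"
    proof (cases "x = 0")
      case False
      have "{\<zz> ^ p / (h - 1) | h. h \<in> \<AA>} \<subseteq> L" using gK KL by blast
      then obtain h where h: "h \<in> \<AA>" "le x (\<zz> ^ p / (h - 1))"
        using gen_ideal_dominated[OF _ _ x(1) False] AB by blast
      have "h \<noteq> 1" using h(2) False by (auto simp: le_0_iff)
      then obtain b where b: "b \<in> L'" "b \<noteq> 0" "le (\<zz> ^ p / (h - 1)) ((\<sigma> b / b - 1) ^ p)"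
        using kummer_to_L' h(1) by (auto simp: \<AA>_def)
      define u where "u = \<sigma> b / b - 1"
      have "1 * u \<in> J'" unfolding J'_def u_def
        using b subring_1[OF V] B'B subring_1[OF subfield_subring[OF L']] by (intro gen_ideal_single) auto
      then have uJ: "u \<in> J'" "u \<in> L'" using J'L' by auto
      define n where "n = field_norm K' L' u"
      have n: "n \<in> K'" "le x n"
        using norm_props[OF uJ(2)] h(2) b(3) le_trans unfolding n_def u_def by blast+
      then have n0: "n \<noteq> 0" using False by (auto simp: le_0_iff)
      then have "x / n \<in> B" using n by (simp add: le_divide flip: le_1_iff)
      then have "x / n \<in> A'" using xK' n K' BA' subfield_divide by blast
      then have "x / n * n \<in> ?N" using uJ by (intro gen_ideal_single) (auto simp: n_def)
      then show ?thesis using n0 by simp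
    qed (simp add: gen_ideal_0)
  qed
  show "?N \<subseteq> ?H"
  proof
    fix x assume x: "x \<in> ?N"
    then have xK': "x \<in> K'" using N by blast
    have "x \<in> gen_ideal A {\<zz> ^ p / (h - 1) | h. h \<in> \<AA>}"
    proof (cases "x = 0")
      case False
      have "field_norm K' L' ` J' \<subseteq> L" using J'L' norm_props(1) K'K KL by blast
      then obtain j where j: "j \<in> J'" "le x (field_norm K' L' j)"
        using gen_ideal_dominated[OF _ _ x False] BA' by blast
      \<comment> \<open>The norm is that of an arbitrary element of \<open>J'\<close>; a second
        domination step is needed to reach some \<open>\<sigma> b / b - 1\<close>.\<close>
      then have xj: "le x (j ^ p)" using norm_props(2)[of j] J'L' le_trans by blast
      then have "j \<noteq> 0" using False p_gt_0 by (auto simp: le_0_iff zero_power)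
      moreover have "{\<sigma> b / b - 1 | b. b \<in> L' \<and> b \<noteq> 0} \<subseteq> L" using uL' L'L by blast
      ultimately obtain b where b: "b \<in> L'" "b \<noteq> 0" "le j (\<sigma> b / b - 1)"
        using gen_ideal_dominated[of B' _ j] j(1) B'B unfolding J'_def by blast
      define u where "u = \<sigma> b / b - 1"
      have xu: "le x (u ^ p)" using xj le_power[OF b(3), of p] le_trans unfolding u_def by blast
      have "u \<noteq> 0" using b(3) \<open>j \<noteq> 0\<close> by (auto simp: u_def le_0_iff)
      then obtain h where h: "h \<in> \<AA>" "le (u ^ p) (\<zz> ^ p / (h - 1))"
        using kummer_of_L[OF _ b(2) u_def] b(1) L'L by (auto simp: \<AA>_def)
      define g where "g = \<zz> ^ p / (h - 1)"
      have g: "g \<in> K" "le x g" using gK h xu le_trans by (auto simp: g_def)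
      then have g0: "g \<noteq> 0" using False by (auto simp: le_0_iff)
      then have "x / g \<in> B" using g by (simp add: le_divide flip: le_1_iff)
      then have "x / g \<in> A" using xK' K'K g K AB subfield_divide by blast
      then have "x / g * g \<in> gen_ideal A {\<zz> ^ p / (h - 1) | h. h \<in> \<AA>}"
        using h by (intro gen_ideal_single) (auto simp: g_def)
      then show ?thesis using g0 by simp
    qed (simp add: gen_ideal_0)
    moreover have "l x = x" if "l \<in> Gal L' L" for l using GalD(4)[OF that] xK' K'L' by blast
    ultimately show "x \<in> ?H" by blast
  qed
qed

end

theorem theorem7p8:
  fixes K' L' A' B' A B :: "'a::field_char_0 set" and p :: nat and \<zeta> :: 'a
    and \<sigma> :: "'a \<Rightarrow> 'a"
  assumes "prime p" and "p > 2"
    and "subfield K'"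
    and "henselian K' A'"
    and "of_nat p \<in> max_ideal A'"
    and "galois_of_degree K' L' p"
    and "L' \<noteq> K'"
    and "\<zeta> ^ p = 1" and "\<zeta> \<noteq> 1"
    and "valuation_ring L' B'" and "B' \<inter> K' = A'"
    and "valuation_ring (gen_field (K' \<union> {\<zeta>})) A" and "A \<inter> K' = A'"
    and "valuation_ring (gen_field (L' \<union> {\<zeta>})) B" and "B \<inter> K' = A'"
    and "\<sigma> \<in> Gal (gen_field (K' \<union> {\<zeta>})) (gen_field (L' \<union> {\<zeta>}))"
    and "Gal (gen_field (K' \<union> {\<zeta>})) (gen_field (L' \<union> {\<zeta>})) = {\<sigma> ^^ k | k. True}"
  shows
    "(let K = gen_field (K' \<union> {\<zeta>}); L = gen_field (L' \<union> {\<zeta>}); z = \<zeta> - 1;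
          \<AA> = {h\<in>K. gen_field (K \<union> {x. x ^ p = h}) = L};
          H = gen_ideal A {z ^ p / (h - 1) | h. h \<in> \<AA>};
          H' = {x\<in>H. \<forall>l\<in>Gal L' L. l x = x};
          J' = gen_ideal B' {\<sigma> b / b - 1 | b. b \<in> L' \<and> b \<noteq> 0};
          N' = gen_ideal A' (field_norm K' L' ` J')
      in H' = N')"
proof -
  interpret henselian_cyclic K' L' p \<zeta> "gen_field (K' \<union> {\<zeta>})" "gen_field (L' \<union> {\<zeta>})" \<sigma> A' B
    by unfold_locales (use assms in auto)
  show ?thesis
    unfolding Let_def using ideals_eq[of A B'] assms by blast
qed

end
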